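(* Let $P$ and $Q$ be finite posets. Then (a) $|Q| \leq \operatorname{pdim} \mathbb{K}[P,Q] \leq |P|(|Q|-1)+1$, and (b) $|P|-1 \leq \operatorname{reg} \mathbb{K}[P,Q] \leq |Q|(|P|-1)$.
   Context: All posets are finite and nonempty; $\mathbb{K}$ is an arbitrary field. $\operatorname{Hom}(P,Q)$ is the set of order-preserving maps $P\to Q$. $S_{P,Q}=\mathbb{K}[x_{p,q} : p\in P, q\in Q]$, $u_\phi=\prod_{p\in P}x_{p,\phi(p)}$, $L(P,Q)=(u_\phi : \phi\in \operatorname{Hom}(P,Q))\subseteq S_{P,Q}$ and $\mathbb{K}[P,Q]=S_{P,Q}/L(P,Q)$. For $R=\mathbb{K}[P,Q]$ with graded Betti numbers $\beta_{i,j}(R)=\dim_{\mathbb K}\operatorname{Tor}_i^{S_{P,Q}}(R,\mathbb{K})_j$ (all variables of degree 1), $\operatorname{reg} R=\max\{j-i : \beta_{i,j}(R)\ne0\}$, and $\operatorname{pdim} R$ is the projective dimension over $S_{P,Q}$. *)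

theory Defs
  imports Complex_Main "HOL-Library.Poly_Mapping" "HOL-Library.Extended_Nat" "HOL-Library.Cardinality"
begin

section \<open>Submodules of free modules of countable rank\<close>

text \<open>
  The type \<open>nat \<Rightarrow>\<^sub>0 'a\<close> is the free \<open>'a\<close>-module with basis \<open>unit_vec k\<close> (\<open>k :: nat\<close>),
  scalars acting by \<open>vscale\<close>. Every module occurring in a resolution below is a submodule of it.
\<close>

definition vscale :: "'a::comm_ring_1 \<Rightarrow> (nat \<Rightarrow>\<^sub>0 'a) \<Rightarrow> (nat \<Rightarrow>\<^sub>0 'a)" where
  "vscale a v = Poly_Mapping.map ((*) a) v"

lemma lookup_vscale [simp]: "Poly_Mapping.lookup (vscale a v) k = a * Poly_Mapping.lookup v k"
  unfolding vscale_def by transfer (simp add: when_def)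

lemma module_vscale: "module (vscale :: 'a::comm_ring_1 \<Rightarrow> _)"
  by standard (rule poly_mapping_eqI, simp add: Poly_Mapping.lookup_add distrib_left distrib_right mult.assoc)+

lemma vector_space_vscale: "vector_space (vscale :: 'a::field \<Rightarrow> _)"
  by standard (rule poly_mapping_eqI, simp add: Poly_Mapping.lookup_add distrib_left distrib_right mult.assoc)+

lemma module_times: "module ((*) :: 'a::comm_ring_1 \<Rightarrow> 'a \<Rightarrow> 'a)"
  by standard (simp_all add: algebra_simps)

definition unit_vec :: "nat \<Rightarrow> (nat \<Rightarrow>\<^sub>0 'a::comm_ring_1)" where
  "unit_vec k = Poly_Mapping.single k 1"

definition free_mod :: "nat \<Rightarrow> (nat \<Rightarrow>\<^sub>0 'a::comm_ring_1) set" where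
  "free_mod r = {v. Poly_Mapping.keys v \<subseteq> {..<r}}"

definition projective_module :: "(nat \<Rightarrow>\<^sub>0 'a::comm_ring_1) set \<Rightarrow> bool" where
  "projective_module M \<longleftrightarrow> module.subspace vscale M \<and>
     (\<exists>N B. module.subspace vscale N \<and> M \<inter> N = {0} \<and>
        \<not> module.dependent vscale B \<and> {x + y | x y. x \<in> M \<and> y \<in> N} = module.span vscale B)"

definition module_map_on ::
  "(nat \<Rightarrow>\<^sub>0 'a::comm_ring_1) set \<Rightarrow> (nat \<Rightarrow>\<^sub>0 'a) set \<Rightarrow> ((nat \<Rightarrow>\<^sub>0 'a) \<Rightarrow> (nat \<Rightarrow>\<^sub>0 'a)) \<Rightarrow> bool" where
  "module_map_on M N f \<longleftrightarrow> f ` M \<subseteq> N \<and>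
     (\<forall>x\<in>M. \<forall>y\<in>M. f (x + y) = f x + f y) \<and> (\<forall>a. \<forall>x\<in>M. f (vscale a x) = vscale a (f x))"

text \<open>
  A homomorphism from \<open>M\<close> to the cyclic module \<open>'a / I\<close> is given by a function \<open>e\<close> choosing
  representatives in \<open>'a\<close> of its values; so \<open>e\<close> need only be linear modulo \<open>I\<close>.
\<close>

definition module_map_to_quotient ::
  "'a::comm_ring_1 set \<Rightarrow> (nat \<Rightarrow>\<^sub>0 'a) set \<Rightarrow> ((nat \<Rightarrow>\<^sub>0 'a) \<Rightarrow> 'a) \<Rightarrow> bool" where
  "module_map_to_quotient I M e \<longleftrightarrow>
     (\<forall>x\<in>M. \<forall>y\<in>M. e (x + y) - (e x + e y) \<in> I) \<and> (\<forall>a. \<forall>x\<in>M. e (vscale a x) - a * e x \<in> I)"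


section \<open>Resolutions and projective dimension of \<open>'a / I\<close>\<close>

text \<open>
  Exactness of \<open>\<dots> \<rightarrow> M 2 \<rightarrow> M 1 \<rightarrow> M 0 \<rightarrow> 'a / I \<rightarrow> 0\<close>, where
  \<open>d i : M (Suc i) \<rightarrow> M i\<close> and \<open>e : M 0 \<rightarrow> 'a / I\<close>.
\<close>

definition resolution ::
  "'a::comm_ring_1 set \<Rightarrow> (nat \<Rightarrow> (nat \<Rightarrow>\<^sub>0 'a) set) \<Rightarrow>
   (nat \<Rightarrow> (nat \<Rightarrow>\<^sub>0 'a) \<Rightarrow> (nat \<Rightarrow>\<^sub>0 'a)) \<Rightarrow> ((nat \<Rightarrow>\<^sub>0 'a) \<Rightarrow> 'a) \<Rightarrow> bool" where
  "resolution I M d e \<longleftrightarrow>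
     (\<forall>i. module.subspace vscale (M i)) \<and>
     (\<forall>i. module_map_on (M (Suc i)) (M i) (d i)) \<and>
     module_map_to_quotient I (M 0) e \<and>
     (\<forall>f. \<exists>x\<in>M 0. e x - f \<in> I) \<and>
     {x \<in> M 0. e x \<in> I} = d 0 ` M 1 \<and>
     (\<forall>i. {x \<in> M (Suc i). d i x = 0} = d (Suc i) ` M (Suc (Suc i)))"

text \<open>
  Any countably generated projective module is isomorphic to a direct summand of
  \<open>nat \<Rightarrow>\<^sub>0 'a\<close>, so for a Noetherian ring \<open>'a\<close> restricting to submodules of \<open>nat \<Rightarrow>\<^sub>0 'a\<close>
  does not change the minimal length. The value is \<open>\<infinity>\<close> if there is no finite resolution.
\<close>

definition pdim_quotient :: "'a::comm_ring_1 set \<Rightarrow> enat" where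
  "pdim_quotient I = (INF n \<in> {n. \<exists>M d e. resolution I M d e \<and>
      (\<forall>i. projective_module (M i)) \<and> (\<forall>i>n. M i = {0})}. enat n)"


section \<open>Graded Betti numbers and regularity\<close>

text \<open>Polynomials over \<open>'k\<close> in the variables \<open>'x\<close>; monomials are exponent vectors.\<close>

type_synonym ('x, 'k) mpoly = "('x \<Rightarrow>\<^sub>0 nat) \<Rightarrow>\<^sub>0 'k"

definition var :: "'x \<Rightarrow> ('x, 'k::comm_ring_1) mpoly" where
  "var v = Poly_Mapping.single (Poly_Mapping.single v 1) 1"

definition mono_deg :: "('x \<Rightarrow>\<^sub>0 nat) \<Rightarrow> nat" where
  "mono_deg m = (\<Sum>v\<in>Poly_Mapping.keys m. Poly_Mapping.lookup m v)"

definition homogeneous :: "int \<Rightarrow> ('x, 'k::comm_ring_1) mpoly \<Rightarrow> bool" where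
  "homogeneous n f \<longleftrightarrow> (\<forall>m\<in>Poly_Mapping.keys f. int (mono_deg m) = n)"

text \<open>
  Graded resolutions of \<open>S/I\<close> by free modules of finite rank: in homological degree \<open>i\<close> the
  module has rank \<open>r i\<close>, and its basis vector \<open>unit_vec k\<close> has degree \<open>\<delta> i k\<close>. The last two
  conditions say that \<open>d\<close> and \<open>e\<close> preserve degrees.
\<close>

definition graded_free_resolution ::
  "('x, 'k::comm_ring_1) mpoly set \<Rightarrow> (nat \<Rightarrow> nat) \<Rightarrow> (nat \<Rightarrow> nat \<Rightarrow> int) \<Rightarrow>
   (nat \<Rightarrow> (nat \<Rightarrow>\<^sub>0 ('x, 'k) mpoly) \<Rightarrow> (nat \<Rightarrow>\<^sub>0 ('x, 'k) mpoly)) \<Rightarrow>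
   ((nat \<Rightarrow>\<^sub>0 ('x, 'k) mpoly) \<Rightarrow> ('x, 'k) mpoly) \<Rightarrow> bool" where
  "graded_free_resolution I r \<delta> d e \<longleftrightarrow>
     resolution I (\<lambda>i. free_mod (r i)) d e \<and>
     (\<forall>i. \<forall>k<r (Suc i). \<forall>l<r i.
        homogeneous (\<delta> (Suc i) k - \<delta> i l) (Poly_Mapping.lookup (d i (unit_vec k)) l)) \<and>
     (\<forall>k<r 0. \<exists>f. homogeneous (\<delta> 0 k) f \<and> e (unit_vec k) - f \<in> I)"

text \<open>
  Tensoring such a resolution with \<open>\<bbbK> = S/(variables)\<close> replaces the free module of rank \<open>r i\<close> by
  \<open>\<bbbK>\<close> to the power \<open>r i\<close>, and the entries of the matrix of \<open>d i\<close> by their constant coefficients.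
\<close>

definition tensor_diff ::
  "(nat \<Rightarrow> (nat \<Rightarrow>\<^sub>0 ('x, 'k::field) mpoly) \<Rightarrow> (nat \<Rightarrow>\<^sub>0 ('x, 'k) mpoly)) \<Rightarrow>
   nat \<Rightarrow> (nat \<Rightarrow>\<^sub>0 'k) \<Rightarrow> (nat \<Rightarrow>\<^sub>0 'k)" where
  "tensor_diff d i v = (\<Sum>k\<in>Poly_Mapping.keys v.
     vscale (Poly_Mapping.lookup v k)
       (Poly_Mapping.map (\<lambda>f. Poly_Mapping.lookup f 0) (d i (unit_vec k))))"

definition tensor_part ::
  "(nat \<Rightarrow> nat) \<Rightarrow> (nat \<Rightarrow> nat \<Rightarrow> int) \<Rightarrow> nat \<Rightarrow> int \<Rightarrow> (nat \<Rightarrow>\<^sub>0 'k::field) set" where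
  "tensor_part r \<delta> i j = {v. Poly_Mapping.keys v \<subseteq> {k. k < r i \<and> \<delta> i k = j}}"

definition tensor_cycles where
  "tensor_cycles r \<delta> d i j = (case i of
      0 \<Rightarrow> tensor_part r \<delta> 0 j
    | Suc i' \<Rightarrow> {v \<in> tensor_part r \<delta> (Suc i') j. tensor_diff d i' v = 0})"

definition tensor_boundaries where
  "tensor_boundaries r \<delta> d i j = tensor_diff d i ` tensor_part r \<delta> (Suc i) j"

text \<open>
  The dimension of the degree \<open>j\<close> part of \<open>Tor\<^sub>i(S/I, \<bbbK>)\<close>, computed from one chosen graded free
  resolution. Boundaries form a subspace of the finite-dimensional space of cycles, so the
  difference of natural numbers below is the dimension of the quotient.
\<close>

definition betti :: "('x, 'k::field) mpoly set \<Rightarrow> nat \<Rightarrow> int \<Rightarrow> nat" where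
  "betti I i j =
     (let (r, \<delta>, d, e) = (SOME (r, \<delta>, d, e). graded_free_resolution I r \<delta> d e) in
        vector_space.dim vscale (tensor_cycles r \<delta> d i j) -
        vector_space.dim vscale (tensor_boundaries r \<delta> d i j))"

definition reg_quotient :: "('x, 'k::field) mpoly set \<Rightarrow> int" where
  "reg_quotient I = Max {j - int i | i j. betti I i j \<noteq> 0}"


section \<open>The ideal of order-preserving maps\<close>

definition hom_monomial :: "('p::finite \<Rightarrow> 'q) \<Rightarrow> ('p \<times> 'q, 'k::comm_ring_1) mpoly" where
  "hom_monomial \<phi> = (\<Prod>p\<in>UNIV. var (p, \<phi> p))"

definition hom_ideal :: "('p::{finite,order} \<times> 'q::{finite,order}, 'k::comm_ring_1) mpoly set" where
  "hom_ideal = module.span (*) {hom_monomial \<phi> | \<phi>. mono \<phi>}"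

end

(*
L(P,Q) is a squarefree monomial ideal generated in degree |P| in N = |P||Q| variables, and it contains
the |Q| monomials of the constant maps, whose supports are disjoint.

Upper bounds. Adjoin the generators one at a time. The colon ideal (J : m) of a squarefree monomial ideal
by a squarefree monomial m is generated by the sets g - m, hence is an ideal of the same kind in the
N - |m| variables outside m, and the mapping cone of multiplication by m from S/(J : m) to S/J resolves
S/(J + (m)). By induction, an ideal with generators of degree at least d >= 1, among which k have disjoint
supports, has a graded free resolution of length at most N - d + 1 whose i-th module is generated in
degrees between i and i + N - k. The comparison theorem carries the degree bounds over to the Betti
numbers, whichever resolution they are computed from.

Lower bounds. The Betti number beta_{1,|P|} is nonzero because L(P,Q) has no element of degree less than
|P|. For the projective dimension, fix p: the product of all x_{p',q} with p' different from p is not in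
L(P,Q), but all x_{p,q} multiply it into L(P,Q), so it represents a nonzero class in the bottom Koszul
cohomology of S/L(P,Q) with respect to these |Q| variables. Dimension shifting moves it up one degree for
each syzygy, and the Koszul cohomology of a projective module vanishes below degree |Q|.
*)
theory Submission
  imports Defs "HOL-Library.Disjoint_Sets"
begin

text \<open>The constants come from the cone. It raises homological degree by one and internal
  degree by card m, while the colon ideal loses card m variables. With d = 1 the colon ideal has
  length at most N - card m, so its part of the cone has length at most N - card m + 1 \<le> N - d +
  1. The excess of its degrees over the homological degree is at most (N - card m - k') + card m -
  1, where k' counts the disjoint generators other than m. For m in the disjoint family k' = k - 1,
  and the result is exactly N - k. The theorem is the case N = |P||Q|, d = |P|, k = |Q|.

  Two points of the definitions shape the rest. The projective dimension ranges over resolutions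
  without grading or finite generation; Koszul cohomology copes with these because its vanishing
  passes to direct summands. The Betti numbers belong to an unspecified, possibly non-minimal
  resolution, so ranks say nothing and all arguments compare cycles with boundaries.\<close>

abbreviation lookup where "lookup \<equiv> Poly_Mapping.lookup"
abbreviation keys where "keys \<equiv> Poly_Mapping.keys"
abbreviation single where "single \<equiv> Poly_Mapping.single"

interpretation vs: module vscale by (rule module_vscale)

text \<open>Linearity on the whole ambient module, even where only the restriction to some
  \<open>free_mod r\<close> matters; sums and composites then need no domain conditions.\<close>

abbreviation lin :: "((nat \<Rightarrow>\<^sub>0 'a::comm_ring_1) \<Rightarrow> (nat \<Rightarrow>\<^sub>0 'a)) \<Rightarrow> bool" where
  "lin \<equiv> module_hom vscale vscale"

section \<open>Koszul cochains\<close>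

text \<open>
  A cochain assigns a module element to each list of booleans as long as \<open>xs\<close>; such a list
  is the characteristic function of a set of positions in \<open>xs\<close>.
\<close>

fun kdiff :: "'a::comm_ring_1 list \<Rightarrow> (bool list \<Rightarrow> (nat \<Rightarrow>\<^sub>0 'a)) \<Rightarrow> bool list \<Rightarrow> (nat \<Rightarrow>\<^sub>0 'a)" where
  "kdiff (x # xs) c (False # l) = kdiff xs (\<lambda>l. c (False # l)) l"
| "kdiff (x # xs) c (True # l) = vscale x (c (False # l)) - kdiff xs (\<lambda>l. c (True # l)) l"
| "kdiff xs c l = 0"

text \<open>The size of the encoded set, which is the cohomological degree.\<close>

abbreviation ktrue :: "bool list \<Rightarrow> nat" where "ktrue l \<equiv> length (filter (\<lambda>h. h) l)"

definition cochain :: "nat \<Rightarrow> nat \<Rightarrow> (nat \<Rightarrow>\<^sub>0 'a::comm_ring_1) set \<Rightarrow> (bool list \<Rightarrow> (nat \<Rightarrow>\<^sub>0 'a)) \<Rightarrow> bool" where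
  "cochain m k M c \<longleftrightarrow> (\<forall>l. c l \<in> M) \<and> (\<forall>l. c l \<noteq> 0 \<longrightarrow> length l = m \<and> ktrue l = k)"

text \<open>For \<open>k = 0\<close> the bounding cochain \<open>b\<close> has to vanish.\<close>

definition acyclic_at :: "'a::comm_ring_1 list \<Rightarrow> nat \<Rightarrow> (nat \<Rightarrow>\<^sub>0 'a) set \<Rightarrow> bool" where
  "acyclic_at xs k M \<longleftrightarrow> (\<forall>c. cochain (length xs) k M c \<and> kdiff xs c = (\<lambda>l. 0) \<longrightarrow>
     (\<exists>b. (\<forall>l. b l \<in> M) \<and> (\<forall>l. b l \<noteq> 0 \<longrightarrow> length l = length xs \<and> Suc (ktrue l) = k) \<and>
          kdiff xs b = c))"

lemma kdiff_zero [simp]: "kdiff xs (\<lambda>l. 0) l = 0"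
  by (induction xs "\<lambda>l::bool list. 0 :: nat \<Rightarrow>\<^sub>0 'a" l rule: kdiff.induct) auto

lemma kdiff_diff: "kdiff xs (\<lambda>l. c l - c' l) l = kdiff xs c l - kdiff xs c' l"
proof (induction xs c l arbitrary: c' rule: kdiff.induct)
  case (2 x xs c l)
  then show ?case by (simp add: vs.scale_right_diff_distrib)
qed auto

lemma kdiff_uminus: "kdiff xs (\<lambda>l. - c l) l = - kdiff xs c l"
  using kdiff_diff[of xs "\<lambda>l. 0" c l] by simp

lemma kdiff_vscale: "kdiff xs (\<lambda>l. vscale a (c l)) l = vscale a (kdiff xs c l)"
proof (induction xs c l rule: kdiff.induct)
  case (2 x xs c l)
  then show ?case by (simp add: vs.scale_right_diff_distrib mult.commute)
qed auto

text \<open>On \<open>x # xs\<close> the differential is the cone of multiplication by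
  \<open>x\<close> on the complex of \<open>xs\<close>: the two terms that carry \<open>x\<close>
  cancel because of the minus sign in the True case.\<close>

lemma kdiff_kdiff: "kdiff xs (kdiff xs c) l = 0"
proof (induction xs c l rule: kdiff.induct)
  case (2 x xs c l)
  then show ?case by (simp add: kdiff_diff kdiff_vscale)
qed auto

text \<open>Only additivity and compatibility with the entries of \<open>xs\<close> are assumed,
  because the maps inserted below include division by a variable, which is not linear over the
  ring.\<close>

lemma kdiff_commute:
  assumes "\<And>l. c l \<in> M" and "vs.subspace M" and "\<And>u v. u \<in> M \<Longrightarrow> v \<in> M \<Longrightarrow> q (u - v) = q u - q v"
    and "\<And>x v. x \<in> set xs \<Longrightarrow> v \<in> M \<Longrightarrow> q (vscale x v) = vscale x (q v)"
  shows "kdiff xs (\<lambda>l. q (c l)) l = q (kdiff xs c l) \<and> kdiff xs c l \<in> M"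
proof -
  have q0: "q 0 = 0" using assms(2) assms(3)[of 0 0] vs.subspace_0 by force
  show ?thesis using assms(1,4)
  proof (induction xs c l rule: kdiff.induct)
    case (2 x xs c l)
    have "vscale x (c (False # l)) \<in> M" using 2 assms(2) vs.subspace_scale by blast
    moreover have "kdiff xs (\<lambda>l. c (True # l)) l \<in> M" and
      "kdiff xs (\<lambda>l. q (c (True # l))) l = q (kdiff xs (\<lambda>l. c (True # l)) l)"
      using 2 by auto
    ultimately show ?case using 2 assms(2,3) by (auto intro: vs.subspace_diff)
  qed (auto simp: q0 assms(2) vs.subspace_0)
qed

text \<open>A coboundary is built from products of entries of \<open>xs\<close> with values of
  \<open>c\<close>, so it can lie in \<open>N\<close> when \<open>c\<close> does not. This turns a
  socle element modulo \<open>N\<close> into a cocycle with values in \<open>N\<close>.\<close>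

lemma kdiff_mem:
  assumes "\<And>l. c l \<in> M" and "\<And>x l. x \<in> set xs \<Longrightarrow> vscale x (c l) \<in> N" and "vs.subspace N"
  shows "kdiff xs c l \<in> N"
  using assms(1,2)
proof (induction xs c l rule: kdiff.induct)
  case (2 x xs c l)
  then show ?case using assms(3) by (auto intro!: vs.subspace_diff)
qed (auto simp: assms(3) vs.subspace_0)

lemma kdiff_support:
  assumes "\<And>l. c l \<noteq> 0 \<Longrightarrow> length l = length xs \<and> ktrue l = k"
  shows "kdiff xs c l \<noteq> 0 \<longrightarrow> length l = length xs \<and> ktrue l = Suc k"
  using assms
proof (induction xs c l arbitrary: k rule: kdiff.induct)
  case (1 x xs c l)
  show ?case using "1.IH"[of k] "1.prems"[of "False # _"] by auto
next
  case (2 x xs c l)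
  show ?case
  proof (intro impI)
    assume "kdiff (x # xs) c (True # l) \<noteq> 0"
    then have "c (False # l) \<noteq> 0 \<or> kdiff xs (\<lambda>l. c (True # l)) l \<noteq> 0" by auto
    then show "length (True # l) = length (x # xs) \<and> ktrue (True # l) = Suc k"
    proof
      assume "c (False # l) \<noteq> 0"
      then show ?thesis using "2.prems"[of "False # l"] by auto
    next
      assume n: "kdiff xs (\<lambda>l. c (True # l)) l \<noteq> 0"
      show ?thesis
      proof (cases k)
        case 0
        then have "c (True # l) = 0" for l using "2.prems"[of "True # l"] by auto
        then show ?thesis using n by simp
      next
        case (Suc k')
        then show ?thesis using "2.IH"[of k'] "2.prems"[of "True # _"] n by auto
      qed
    qed
  qed
qed auto

text \<open>
  The operator \<open>q\<close> divides by the variable \<open>x\<close>, discarding the terms that \<open>x\<close> does not divide;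
  \<open>v - x q(v)\<close> is then the part of \<open>v\<close> free of \<open>x\<close>.
\<close>

lemma acyclic_at_free:
  assumes "vs.subspace M" and "distinct xs"
    and "\<And>x. x \<in> set xs \<Longrightarrow> \<exists>q. (\<forall>u\<in>M. q u \<in> M) \<and> (\<forall>u\<in>M. \<forall>v\<in>M. q (u - v) = q u - q v) \<and>
       (\<forall>u\<in>M. q (vscale x u) = u) \<and> (\<forall>y\<in>set xs. y \<noteq> x \<longrightarrow> (\<forall>u\<in>M. q (vscale y u) = vscale y (q u)))"
    and "k < length xs"
  shows "acyclic_at xs k M"
  using assms(2-)
proof (induction xs arbitrary: k)
  case Nil
  then show ?case by simp
next
  case (Cons x xs)
  have IH: "acyclic_at xs k M" if "k < length xs" for k
  proof (rule Cons.IH[OF _ _ that])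
    show "distinct xs" using Cons.prems(1) by simp
    fix y assume "y \<in> set xs"
    then show "\<exists>q. (\<forall>u\<in>M. q u \<in> M) \<and> (\<forall>u\<in>M. \<forall>v\<in>M. q (u - v) = q u - q v) \<and>
       (\<forall>u\<in>M. q (vscale y u) = u) \<and> (\<forall>z\<in>set xs. z \<noteq> y \<longrightarrow> (\<forall>u\<in>M. q (vscale z u) = vscale z (q u)))"
      using Cons.prems(2)[of y] by auto
  qed
  have "x \<notin> set xs" using Cons.prems(1) by simp
  moreover obtain q where q: "\<forall>u\<in>M. q u \<in> M" "\<forall>u\<in>M. \<forall>v\<in>M. q (u - v) = q u - q v"
    "\<forall>u\<in>M. q (vscale x u) = u" "\<forall>y\<in>set (x # xs). y \<noteq> x \<longrightarrow> (\<forall>u\<in>M. q (vscale y u) = vscale y (q u))"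
    using Cons.prems(2)[of x] by auto
  ultimately have qM: "\<And>u. u \<in> M \<Longrightarrow> q u \<in> M" and qd: "\<And>u v. u \<in> M \<Longrightarrow> v \<in> M \<Longrightarrow> q (u - v) = q u - q v"
    and qx: "\<And>u. u \<in> M \<Longrightarrow> q (vscale x u) = u"
    and qy: "\<And>y u. y \<in> set xs \<Longrightarrow> u \<in> M \<Longrightarrow> q (vscale y u) = vscale y (q u)"
    by auto
  have q0: "q 0 = 0" using assms(1) qd[of 0 0] vs.subspace_0 by force
  show ?case unfolding acyclic_at_def
  proof (intro allI impI)
    fix c assume c: "cochain (length (x # xs)) k M c \<and> kdiff (x # xs) c = (\<lambda>l. 0)"
    \<comment> \<open>On lists starting with True the cocycle condition reads
      \<open>x * a = kdiff xs b\<close>. Dividing by \<open>x\<close> gives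
      \<open>a = kdiff xs (q b)\<close>, and then \<open>p\<close>, the part of \<open>b\<close>
      free of \<open>x\<close>, is a cocycle for \<open>xs\<close> one degree lower.\<close>
    define a where "a = (\<lambda>l. c (False # l))"
    define b where "b = (\<lambda>l. c (True # l))"
    define p where "p = (\<lambda>l. b l - vscale x (q (b l)))"
    have aM: "a l \<in> M" and bM: "b l \<in> M" for l using c by (auto simp: a_def b_def cochain_def)
    have pM: "p l \<in> M" for l unfolding p_def by (intro vs.subspace_diff vs.subspace_scale assms(1) qM bM)
    have xa: "vscale x (a l) = kdiff xs b l" for l
      using fun_cong[OF conjunct2[OF c], of "True # l"] by (simp add: a_def b_def)
    have qb: "kdiff xs (\<lambda>l. q (b l)) l = q (kdiff xs b l)" for l
      using kdiff_commute[of b M q xs l] bM assms(1) qd qy by blast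
    have a: "a l = kdiff xs (\<lambda>l. q (b l)) l" for l
      unfolding qb xa[symmetric] by (simp add: qx aM)
    have p0: "kdiff xs p = (\<lambda>l. 0)"
      by (simp add: fun_eq_iff p_def kdiff_diff kdiff_vscale a[symmetric] xa)
    have bs: "length l = length xs \<and> Suc (ktrue l) = k" if "b l \<noteq> 0" for l
      using c that by (auto simp: b_def cochain_def dest!: spec[of _ "True # l"])
    have ps: "length l = length xs \<and> Suc (ktrue l) = k" if "p l \<noteq> 0" for l
      using bs[of l] that by (cases "b l = 0") (auto simp: p_def q0)
    obtain p' where p'M: "\<And>l. p' l \<in> M" and p': "kdiff xs p' = p"
      and p's: "\<And>l. p' l \<noteq> 0 \<Longrightarrow> length l = length xs \<and> Suc (Suc (ktrue l)) = k"
    proof (cases k)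
      case 0
      then have "p = (\<lambda>l. 0)" using ps by auto
      then show ?thesis using that[of "\<lambda>l. 0"] assms(1) vs.subspace_0 by (auto simp: fun_eq_iff)
    next
      case (Suc k')
      then have "acyclic_at xs k' M" using Cons.prems(3) IH by auto
      moreover have "cochain (length xs) k' M p" using pM ps Suc by (auto simp: cochain_def)
      ultimately show ?thesis using that p0 Suc unfolding acyclic_at_def by (metis old.nat.inject)
    qed
    \<comment> \<open>Here \<open>b = x * q b + kdiff xs p'\<close>; the sign of \<open>p'\<close>
      undoes the minus sign in the True case of \<open>kdiff\<close>.\<close>
    define B where "B = (\<lambda>l. case l of [] \<Rightarrow> 0 | h # l \<Rightarrow> if h then - p' l else q (b l))"
    have "B l \<in> M" for l
      using p'M bM qM vs.subspace_0[OF assms(1)] vs.subspace_neg[OF assms(1)]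
      by (auto simp: B_def split: list.split)
    moreover have "B l \<noteq> 0 \<longrightarrow> length l = length (x # xs) \<and> Suc (ktrue l) = k" for l
    proof (cases l)
      case Nil
      then show ?thesis by (simp add: B_def)
    next
      case (Cons h l')
      then show ?thesis using p's[of l'] bs[of l'] q0 by (cases h; cases "b l' = 0") (auto simp: B_def)
    qed
    moreover have "kdiff (x # xs) B l = c l" for l
    proof (cases l)
      case Nil
      then show ?thesis using c by (auto simp: cochain_def dest!: spec[of _ "[]"])
    next
      case (Cons h l')
      show ?thesis
      proof (cases h)
        case True
        have "kdiff xs (\<lambda>l. B (True # l)) l' = - p l'" by (simp add: B_def kdiff_uminus p')
        then show ?thesis using Cons True by (simp add: B_def p_def b_def)
      next
        case False
        then show ?thesis using Cons a[of l'] by (simp add: B_def a_def)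
      qed
    qed
    ultimately show "\<exists>b. (\<forall>l. b l \<in> M) \<and> (\<forall>l. b l \<noteq> 0 \<longrightarrow> length l = length (x # xs) \<and> Suc (ktrue l) = k) \<and>
          kdiff (x # xs) b = c" by (intro exI[of _ B]) auto
  qed
qed

text \<open>The long exact cohomology sequence of \<open>0 \<rightarrow> ker f \<rightarrow> M \<rightarrow> f M \<rightarrow> 0\<close>, at one spot.\<close>

lemma acyclic_at_image:
  assumes M: "vs.subspace M" and add: "\<And>u v. u \<in> M \<Longrightarrow> v \<in> M \<Longrightarrow> f (u - v) = f u - f v"
    and scale: "\<And>a u. u \<in> M \<Longrightarrow> f (vscale a u) = vscale a (f u)"
    and "acyclic_at xs k M" and "acyclic_at xs (Suc k) {u \<in> M. f u = 0}"
  shows "acyclic_at xs k (f ` M)"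
  unfolding acyclic_at_def
proof (intro allI impI)
  fix c assume c: "cochain (length xs) k (f ` M) c \<and> kdiff xs c = (\<lambda>l. 0)"
  have f0: "f 0 = 0" using M add[of 0 0] vs.subspace_0 by force
  \<comment> \<open>Zero is lifted to zero, so that the lift \<open>g\<close> keeps the support,
    hence the degree, of \<open>c\<close>.\<close>
  have "\<exists>u\<in>M. f u = c l \<and> (c l = 0 \<longrightarrow> u = 0)" for l
  proof -
    have "c l \<in> f ` M" using c by (simp add: cochain_def)
    then obtain u where "u \<in> M" "f u = c l" by auto
    then show ?thesis using vs.subspace_0[OF M] f0 by (cases "c l = 0") auto
  qed
  then obtain g where gM: "\<And>l. g l \<in> M" and fg: "\<And>l. f (g l) = c l" and g0: "\<And>l. c l = 0 \<Longrightarrow> g l = 0"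
    by metis
  have gs: "length l = length xs \<and> ktrue l = k" if "g l \<noteq> 0" for l
    using that g0[of l] c unfolding cochain_def by blast
  have comm: "kdiff xs (\<lambda>l. f (h l)) l = f (kdiff xs h l) \<and> kdiff xs h l \<in> M" if "\<And>l. h l \<in> M" for h l
    by (rule kdiff_commute) (use that M add scale in auto)
  \<comment> \<open>\<open>kdiff xs g\<close> represents the image of \<open>c\<close> under the
    connecting homomorphism; as it bounds in the kernel of \<open>f\<close>, the lift
    \<open>g\<close> can be corrected to a cocycle of \<open>M\<close>.\<close>
  have "cochain (length xs) (Suc k) {u \<in> M. f u = 0} (kdiff xs g)"
    unfolding cochain_def
  proof (intro conjI allI)
    show "kdiff xs g l \<in> {u \<in> M. f u = 0}" for l
      using comm[of g l] gM fg c by (simp add: fun_eq_iff)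
    show "kdiff xs g l \<noteq> 0 \<longrightarrow> length l = length xs \<and> ktrue l = Suc k" for l
      by (rule kdiff_support) (rule gs)
  qed
  moreover have "kdiff xs (kdiff xs g) = (\<lambda>l. 0)" by (simp add: fun_eq_iff kdiff_kdiff)
  ultimately obtain b where bM: "\<And>l. b l \<in> M" and fb: "\<And>l. f (b l) = 0" and
    bs: "\<And>l. b l \<noteq> 0 \<Longrightarrow> length l = length xs \<and> Suc (ktrue l) = Suc k" and b: "kdiff xs b = kdiff xs g"
    using assms(5) unfolding acyclic_at_def by blast
  have "cochain (length xs) k M (\<lambda>l. g l - b l)"
    unfolding cochain_def
  proof (intro conjI allI impI)
    show "g l - b l \<in> M" for l using M gM bM by (rule vs.subspace_diff)
    fix l assume "g l - b l \<noteq> 0"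
    then have "g l \<noteq> 0 \<or> b l \<noteq> 0" by auto
    then show "length l = length xs" "ktrue l = k" using gs[of l] bs[of l] by auto
  qed
  moreover have "kdiff xs (\<lambda>l. g l - b l) = (\<lambda>l. 0)" by (simp add: fun_eq_iff kdiff_diff b)
  ultimately obtain a where aM: "\<And>l. a l \<in> M" and
    as: "\<And>l. a l \<noteq> 0 \<Longrightarrow> length l = length xs \<and> Suc (ktrue l) = k" and a: "kdiff xs a = (\<lambda>l. g l - b l)"
    using assms(4)[unfolded acyclic_at_def, rule_format, OF conjI] by blast
  have "kdiff xs (\<lambda>l. f (a l)) l = c l" for l
    using comm[of a l] aM add[OF gM bM] by (simp add: a fg fb)
  then show "\<exists>b. (\<forall>l. b l \<in> f ` M) \<and> (\<forall>l. b l \<noteq> 0 \<longrightarrow> length l = length xs \<and> Suc (ktrue l) = k) \<and>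
      kdiff xs b = c"
    using aM as f0 by (intro exI[of _ "\<lambda>l. f (a l)"]) (simp add: fun_eq_iff, metis)
qed

section \<open>Koszul acyclicity of free and projective modules\<close>

lemma acyclic_at_zero: "acyclic_at xs k {0}"
  unfolding acyclic_at_def cochain_def
  by (auto intro!: exI[of _ "\<lambda>l. 0"] simp: fun_eq_iff)

text \<open>Division by a variable acts on the coordinates with respect to \<open>B\<close>, which
  makes \<open>acyclic_at_free\<close> applicable whatever the basis is.\<close>

lemma acyclic_at_span:
  assumes B: "vs.independent (B :: (nat \<Rightarrow>\<^sub>0 'a::comm_ring_1) set)" and "distinct xs" and "k < length xs"
    and q: "\<And>x. x \<in> set xs \<Longrightarrow> \<exists>q. (\<forall>a b. q (a - b) = q a - q b) \<and> (\<forall>a. q (x * a) = a) \<and>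
       (\<forall>y\<in>set xs. y \<noteq> x \<longrightarrow> (\<forall>a. q (y * a) = y * q a))"
  shows "acyclic_at xs k (vs.span B)"
proof (rule acyclic_at_free[OF vs.subspace_span assms(2) _ assms(3)])
  fix x assume "x \<in> set xs"
  from q[OF this] obtain q where "(\<forall>a b. q (a - b) = q a - q b) \<and> (\<forall>a. q (x * a) = a) \<and>
       (\<forall>y\<in>set xs. y \<noteq> x \<longrightarrow> (\<forall>a. q (y * a) = y * q a))" ..
  then have qd: "\<And>a b. q (a - b) = q a - q b" and qx: "\<And>a. q (x * a) = a"
    and qy: "\<And>a y. y \<in> set xs \<Longrightarrow> y \<noteq> x \<Longrightarrow> q (y * a) = y * q a" by auto
  have q0: "q 0 = 0" using qd[of 0 0] by simp
  let ?r = "vs.representation B"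
  define Q where "Q v = (\<Sum>b\<in>{b. ?r v b \<noteq> 0}. vscale (q (?r v b)) b)" for v
  have Q: "Q v = (\<Sum>b\<in>T. vscale (q (?r v b)) b)" if "finite T" "{b. ?r v b \<noteq> 0} \<subseteq> T" for v T
    unfolding Q_def using that by (intro sum.mono_neutral_left) (auto simp: q0)
  note fin = vs.finite_representation[of B]
  show "\<exists>q. (\<forall>u\<in>vs.span B. q u \<in> vs.span B) \<and> (\<forall>u\<in>vs.span B. \<forall>v\<in>vs.span B. q (u - v) = q u - q v) \<and>
       (\<forall>u\<in>vs.span B. q (vscale x u) = u) \<and>
       (\<forall>y\<in>set xs. y \<noteq> x \<longrightarrow> (\<forall>u\<in>vs.span B. q (vscale y u) = vscale y (q u)))"
  proof (intro exI[of _ Q] conjI ballI impI)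
    fix u assume u: "u \<in> vs.span B"
    show "Q u \<in> vs.span B" unfolding Q_def
      by (intro vs.span_sum vs.span_scale vs.span_base) (auto dest: vs.representation_ne_zero)
    show "Q (vscale x u) = u"
    proof -
      have "Q (vscale x u) = (\<Sum>b\<in>{b. ?r u b \<noteq> 0}. vscale (q (?r (vscale x u) b)) b)"
        by (rule Q[OF fin]) (auto simp: vs.representation_scale[OF B u])
      also have "\<dots> = u"
        by (simp add: vs.representation_scale[OF B u] qx vs.sum_nonzero_representation_eq[OF B u])
      finally show ?thesis .
    qed
    fix y assume y: "y \<in> set xs" "y \<noteq> x"
    have "Q (vscale y u) = (\<Sum>b\<in>{b. ?r u b \<noteq> 0}. vscale (q (?r (vscale y u) b)) b)"
      by (rule Q[OF fin]) (auto simp: vs.representation_scale[OF B u])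
    then show "Q (vscale y u) = vscale y (Q u)"
      by (simp add: vs.representation_scale[OF B u] qy[OF y] Q_def vs.scale_sum_right)
  next
    fix u v assume uv: "u \<in> vs.span B" "v \<in> vs.span B"
    let ?T = "{b. ?r u b \<noteq> 0} \<union> {b. ?r v b \<noteq> 0}"
    have T: "finite ?T" using fin by simp
    have "Q (u - v) = (\<Sum>b\<in>?T. vscale (q (?r (u - v) b)) b)"
      by (rule Q[OF T]) (auto simp: vs.representation_diff[OF B uv(2,1)])
    also have "\<dots> = (\<Sum>b\<in>?T. vscale (q (?r u b)) b) - (\<Sum>b\<in>?T. vscale (q (?r v b)) b)"
      by (simp add: vs.representation_diff[OF B uv(2,1)] qd vs.scale_left_diff_distrib sum_subtractf)
    also have "\<dots> = Q u - Q v" using Q[OF T, of u] Q[OF T, of v] by simp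
    finally show "Q (u - v) = Q u - Q v" .
  qed
qed

text \<open>A bounding cochain is found in the ambient free module and projected back to the direct
  summand \<open>M\<close>; the projection is compatible with \<open>kdiff\<close>.\<close>

lemma acyclic_at_projective:
  assumes "projective_module M" and "distinct xs" and "k < length xs"
    and q: "\<And>x. x \<in> set xs \<Longrightarrow> \<exists>q. (\<forall>a b. q (a - b) = q a - q b) \<and> (\<forall>a. q (x * a) = a) \<and>
       (\<forall>y\<in>set xs. y \<noteq> x \<longrightarrow> (\<forall>a. q (y * a) = y * q a))"
  shows "acyclic_at xs k M"
proof -
  obtain N B where M: "vs.subspace M" and N: "vs.subspace N" and MN: "M \<inter> N = {0}"
    and B: "vs.independent B" and sum: "{x + y | x y. x \<in> M \<and> y \<in> N} = vs.span B"
    using assms(1) unfolding projective_module_def by blast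
  have "\<forall>u\<in>vs.span B. \<exists>x. x \<in> M \<and> u - x \<in> N" unfolding sum[symmetric] by auto
  then obtain p where pM: "\<And>u. u \<in> vs.span B \<Longrightarrow> p u \<in> M" and pN: "\<And>u. u \<in> vs.span B \<Longrightarrow> u - p u \<in> N"
    by metis
  \<comment> \<open>The projection along \<open>N\<close> comes from a mere choice; uniqueness of
    the decomposition makes it linear.\<close>
  have p: "p u = x" if "u \<in> vs.span B" "x \<in> M" "u - x \<in> N" for u x
  proof -
    have "p u - x \<in> M" using that pM M vs.subspace_diff by blast
    moreover have "(u - x) - (u - p u) \<in> N" using that pN N vs.subspace_diff by blast
    ultimately have "p u - x \<in> M \<inter> N" by simp
    then show ?thesis using MN by simp
  qed
  have MB: "u \<in> vs.span B" if "u \<in> M" for u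
    using that N vs.subspace_0 unfolding sum[symmetric] by force
  show ?thesis unfolding acyclic_at_def
  proof (intro allI impI)
    fix c assume c: "cochain (length xs) k M c \<and> kdiff xs c = (\<lambda>l. 0)"
    then have cM: "c l \<in> M" for l by (auto simp: cochain_def)
    have "cochain (length xs) k (vs.span B) c" using c MB by (auto simp: cochain_def)
    then obtain b where bB: "\<And>l. b l \<in> vs.span B" and
      bs: "\<And>l. b l \<noteq> 0 \<Longrightarrow> length l = length xs \<and> Suc (ktrue l) = k" and b: "kdiff xs b = c"
      using acyclic_at_span[OF B assms(2,3) q] c unfolding acyclic_at_def by blast
    have "kdiff xs (\<lambda>l. p (b l)) l = p (kdiff xs b l) \<and> kdiff xs b l \<in> vs.span B" for l
    proof (rule kdiff_commute[OF bB vs.subspace_span])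
      fix u v assume uv: "u \<in> vs.span B" "v \<in> vs.span B"
      then have "(u - p u) - (v - p v) \<in> N" using pN N vs.subspace_diff by blast
      then have "(u - v) - (p u - p v) \<in> N" by (simp add: algebra_simps)
      then show "p (u - v) = p u - p v"
        using uv by (intro p vs.span_diff vs.subspace_diff[OF M] pM)
    next
      fix x v assume v: "v \<in> vs.span B"
      then have "vscale x (v - p v) \<in> N" using pN N vs.subspace_scale by blast
      then show "p (vscale x v) = vscale x (p v)"
        using v by (intro p vs.span_scale vs.subspace_scale[OF M] pM) (auto simp: vs.scale_right_diff_distrib)
    qed
    then have "kdiff xs (\<lambda>l. p (b l)) l = c l" for l
      using p[of "c l" "c l"] MB cM vs.subspace_0[OF N] by (simp add: b)
    moreover have "p 0 = 0" by (intro p) (auto simp: M N vs.subspace_0 vs.span_zero)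
    ultimately show "\<exists>b. (\<forall>l. b l \<in> M) \<and> (\<forall>l. b l \<noteq> 0 \<longrightarrow> length l = length xs \<and> Suc (ktrue l) = k) \<and>
      kdiff xs b = c"
      using pM bB bs by (intro exI[of _ "\<lambda>l. p (b l)"]) (simp add: fun_eq_iff, metis)
  qed
qed

text \<open>Dimension shifting: a socle element of \<open>'a / I\<close> yields a nonzero Koszul class in each syzygy.\<close>

theorem length_le_resolution:
  fixes I :: "'a::comm_ring_1 set"
  assumes res: "resolution I M d e" and proj: "\<And>i. projective_module (M i)" and fin: "\<And>i. i > n \<Longrightarrow> M i = {0}"
    and I: "module.subspace (*) I" and "distinct xs"
    and q: "\<And>x. x \<in> set xs \<Longrightarrow> \<exists>q. (\<forall>a b. q (a - b) = q a - q b) \<and> (\<forall>a. q (x * a) = a) \<and>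
       (\<forall>y\<in>set xs. y \<noteq> x \<longrightarrow> (\<forall>a. q (y * a) = y * q a))"
    and u: "u \<notin> I" "\<And>x. x \<in> set xs \<Longrightarrow> x * u \<in> I"
  shows "length xs \<le> n"
proof (rule ccontr)
  assume "\<not> length xs \<le> n"
  then have n: "n < length xs" by simp
  interpret I: module "(*) :: 'a \<Rightarrow> 'a \<Rightarrow> 'a" by (rule module_times)
  have sub: "vs.subspace (M i)" and d: "module_map_on (M (Suc i)) (M i) (d i)" for i
    using res unfolding resolution_def by auto
  have ker: "{x \<in> M (Suc i). d i x = 0} = d (Suc i) ` M (Suc (Suc i))" for i
    using res unfolding resolution_def by auto
  have ker0: "{x \<in> M 0. e x \<in> I} = d 0 ` M 1" using res unfolding resolution_def by auto
  have e: "module_map_to_quotient I (M 0) e" and surj: "\<exists>x\<in>M 0. e x - f \<in> I" for f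
    using res unfolding resolution_def by auto
  have acyc: "acyclic_at xs k (M i)" if "k < length xs" for k i
    using proj assms(5) that q by (rule acyclic_at_projective)
  have ddiff: "d i (u - v) = d i u - d i v" if "u \<in> M (Suc i)" "v \<in> M (Suc i)" for i u v
  proof -
    have "u - v \<in> M (Suc i)" using sub that vs.subspace_diff by blast
    then have "d i (u - v + v) = d i (u - v) + d i v" using d that unfolding module_map_on_def by blast
    then show ?thesis by simp
  qed
  have dscale: "d i (vscale a u) = vscale a (d i u)" if "u \<in> M (Suc i)" for i u a
    using d that unfolding module_map_on_def by blast
  \<comment> \<open>The image of \<open>d i\<close> is a syzygy with \<open>n - i\<close> steps left
    before the modules vanish. Each step costs one cohomological degree, which is why
    \<open>k + (n - i)\<close> must not exceed \<open>length xs\<close>. The base case is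
    \<open>n \<le> i\<close>.\<close>
  have im: "acyclic_at xs k (d i ` M (Suc i))" if "k + (n - i) \<le> length xs" for i k
    using that
  proof (induction "n - i" arbitrary: i k)
    case 0
    then have "M (Suc i) = {0}" by (intro fin) auto
    moreover have "d i 0 = 0" using ddiff[of 0 i 0] calculation by simp
    ultimately show ?case by (simp add: acyclic_at_zero)
  next
    case (Suc j)
    have "acyclic_at xs (Suc k) (d (Suc i) ` M (Suc (Suc i)))" by (rule Suc.hyps(1)) (use Suc in auto)
    moreover have "acyclic_at xs k (M (Suc i))" using Suc.prems Suc.hyps(2) by (intro acyc) linarith
    ultimately show ?case unfolding ker[symmetric]
      by (intro acyclic_at_image[OF sub ddiff dscale])
  qed
  obtain g where g: "g \<in> M 0" "e g - u \<in> I" using surj by blast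
  have Z: "vs.subspace (d 0 ` M 1)"
    unfolding vs.subspace_def
  proof (intro conjI ballI allI)
    show "0 \<in> d 0 ` M 1" using ddiff[of 0 0 0] sub vs.subspace_0 by (force simp: image_iff)
    fix x assume "x \<in> d 0 ` M 1"
    then obtain x' where x: "x' \<in> M (Suc 0)" "x = d 0 x'" by auto
    show "vscale c x \<in> d 0 ` M 1" for c
      using vs.subspace_scale[OF sub x(1)] by (auto simp: x dscale[symmetric])
    fix y assume "y \<in> d 0 ` M 1"
    then obtain y' where y: "y' \<in> M (Suc 0)" "y = d 0 y'" by auto
    have "x + y = d 0 (x' + y')" using d[of 0] x y unfolding module_map_on_def by simp
    then show "x + y \<in> d 0 ` M 1" using vs.subspace_add[OF sub x(1) y(1)] by simp
  qed
  \<comment> \<open>The degree 0 cochain with value \<open>g\<close>, a lift of \<open>u\<close>. It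
    is a cocycle modulo the image of \<open>d 0\<close>.\<close>
  define c where "c = (\<lambda>l. if length l = length xs \<and> ktrue l = 0 then g else 0)"
  have cs: "length l = length xs \<and> ktrue l = 0" if "c l \<noteq> 0" for l
    using that by (auto simp: c_def split: if_splits)
  have gx: "vscale x g \<in> d 0 ` M 1" if "x \<in> set xs" for x
  proof -
    have "e (vscale x g) - x * e g \<in> I" using e g unfolding module_map_to_quotient_def by blast
    moreover have "x * (e g - u) \<in> I" using I.subspace_scale[OF I g(2)] .
    ultimately have "(e (vscale x g) - x * e g) + x * (e g - u) + x * u \<in> I"
      using u(2)[OF that] I.subspace_add[OF I] by blast
    moreover have "(e (vscale x g) - x * e g) + x * (e g - u) + x * u = e (vscale x g)"
      by (simp add: algebra_simps)
    ultimately have "e (vscale x g) \<in> I" by simp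
    moreover have "vscale x g \<in> M 0" using sub g(1) vs.subspace_scale by blast
    ultimately show ?thesis using ker0 by blast
  qed
  have "cochain (length xs) (Suc 0) (d 0 ` M 1) (kdiff xs c)"
    unfolding cochain_def
  proof (intro conjI allI)
    show "kdiff xs c l \<in> d 0 ` M 1" for l
      by (rule kdiff_mem[of _ UNIV]) (use gx Z in \<open>auto simp: c_def vs.subspace_0\<close>)
    show "kdiff xs c l \<noteq> 0 \<longrightarrow> length l = length xs \<and> ktrue l = Suc 0" for l
      by (rule kdiff_support) (rule cs)
  qed
  moreover have "kdiff xs (kdiff xs c) = (\<lambda>l. 0)" by (simp add: fun_eq_iff kdiff_kdiff)
  moreover have "acyclic_at xs (Suc 0) (d 0 ` M 1)" using im[of "Suc 0" 0] n by simp
  ultimately obtain b where b: "\<And>l. b l \<in> d 0 ` M 1" "kdiff xs b = kdiff xs c"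
    and bs: "\<And>l. b l \<noteq> 0 \<Longrightarrow> length l = length xs \<and> Suc (ktrue l) = Suc 0"
    unfolding acyclic_at_def by blast
  have ZM: "d 0 ` M 1 \<subseteq> M 0" using ker0 by blast
  \<comment> \<open>\<open>c\<close> and \<open>b\<close> have the same coboundary, so their
    difference is a cocycle of degree 0 in \<open>M 0\<close>, hence zero. This forces
    \<open>g\<close> into the image of \<open>d 0\<close>, and \<open>u\<close> into
    \<open>I\<close>.\<close>
  have "cochain (length xs) 0 (M 0) (\<lambda>l. c l - b l)"
    unfolding cochain_def
  proof (intro conjI allI impI)
    show "c l - b l \<in> M 0" for l
    proof (rule vs.subspace_diff[OF sub])
      show "c l \<in> M 0" using g(1) vs.subspace_0[OF sub] by (simp add: c_def)
      show "b l \<in> M 0" using b(1) ZM by blast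
    qed
    fix l assume "c l - b l \<noteq> 0"
    then have "c l \<noteq> 0 \<or> b l \<noteq> 0" by auto
    then show "length l = length xs" "ktrue l = 0" using cs[of l] bs[of l] by auto
  qed
  moreover have "kdiff xs (\<lambda>l. c l - b l) = (\<lambda>l. 0)" by (simp add: fun_eq_iff kdiff_diff b(2))
  moreover have "acyclic_at xs 0 (M 0)" by (rule acyc) (use n in auto)
  ultimately have "\<exists>a. (\<forall>l. a l \<in> M 0) \<and> (\<forall>l. a l \<noteq> 0 \<longrightarrow> length l = length xs \<and> Suc (ktrue l) = 0) \<and>
      kdiff xs a = (\<lambda>l. c l - b l)"
    unfolding acyclic_at_def by (elim allE[of _ "\<lambda>l. c l - b l"] mp) (intro conjI)
  then obtain a where as: "\<forall>l. a l \<noteq> 0 \<longrightarrow> length l = length xs \<and> Suc (ktrue l) = 0"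
    and a: "kdiff xs a = (\<lambda>l. c l - b l)"
    by auto
  have "a = (\<lambda>l. 0)" using as by auto
  then have "c l = b l" for l using fun_cong[OF a, of l] by simp
  from this[of "replicate (length xs) False"] have "g \<in> d 0 ` M 1"
    using b(1) by (simp add: c_def)
  then have "e g \<in> I" using ker0 by blast
  then have "e g - (e g - u) \<in> I" using g(2) by (rule I.subspace_diff[OF I])
  then show False using u(1) by simp
qed

section \<open>Linear maps between free modules\<close>

definition vextend :: "(nat \<Rightarrow> (nat \<Rightarrow>\<^sub>0 'a)) \<Rightarrow> (nat \<Rightarrow>\<^sub>0 'a::comm_ring_1) \<Rightarrow> (nat \<Rightarrow>\<^sub>0 'a)" where
  "vextend b v = (\<Sum>k\<in>keys v. vscale (lookup v k) (b k))"

lemma vextend_superset: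
  "finite A \<Longrightarrow> keys v \<subseteq> A \<Longrightarrow> vextend b v = (\<Sum>k\<in>A. vscale (lookup v k) (b k))"
  unfolding vextend_def by (rule sum.mono_neutral_left) (auto simp: in_keys_iff)

lemma lin_vextend: "lin (vextend b)"
  unfolding module_hom_iff
proof (intro conjI allI module_vscale)
  fix x y :: "nat \<Rightarrow>\<^sub>0 'a"
  have "vextend b (x + y) = (\<Sum>k\<in>keys x \<union> keys y. vscale (lookup (x + y) k) (b k))"
    by (rule vextend_superset) (auto dest: subsetD[OF keys_add])
  also have "\<dots> = vextend b x + vextend b y"
    by (simp add: lookup_add vs.scale_left_distrib sum.distrib vextend_superset[of "keys x \<union> keys y"])
  finally show "vextend b (x + y) = vextend b x + vextend b y" .
next
  fix a and x :: "nat \<Rightarrow>\<^sub>0 'a"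
  have "vextend b (vscale a x) = (\<Sum>k\<in>keys x. vscale (lookup (vscale a x) k) (b k))"
    by (rule vextend_superset) (auto simp: in_keys_iff)
  then show "vextend b (vscale a x) = vscale a (vextend b x)"
    by (simp add: vextend_def vs.scale_sum_right)
qed

lemma keys_unit_vec [simp]: "keys (unit_vec k :: nat \<Rightarrow>\<^sub>0 'a::comm_ring_1) = {k}"
  by (simp add: unit_vec_def)

lemma lookup_unit_vec: "lookup (unit_vec k :: nat \<Rightarrow>\<^sub>0 'a::comm_ring_1) l = (if l = k then 1 else 0)"
  by (auto simp: unit_vec_def lookup_single)

lemma vextend_unit_vec [simp]: "vextend b (unit_vec k) = b k"
  by (simp add: vextend_def lookup_unit_vec)

lemma lookup_vextend: "lookup (vextend b v) l = (\<Sum>k\<in>keys v. lookup v k * lookup (b k) l)"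
  by (simp add: vextend_def lookup_sum)

lemma lookup_vextend_superset:
  "finite A \<Longrightarrow> keys v \<subseteq> A \<Longrightarrow> lookup (vextend b v) l = (\<Sum>k\<in>A. lookup v k * lookup (b k) l)"
  by (simp add: vextend_superset lookup_sum)

lemma vextend_units: "vextend unit_vec v = v"
  by (rule poly_mapping_eqI)
    (auto simp: lookup_vextend lookup_unit_vec in_keys_iff if_distrib[of "\<lambda>x. _ * x"] cong: if_cong)

lemma lin_eq_vextend:
  assumes "lin f" shows "f v = vextend (\<lambda>k. f (unit_vec k)) v"
proof -
  interpret module_hom vscale vscale f by fact
  have "f (vextend unit_vec v) = vextend (\<lambda>k. f (unit_vec k)) v"
    by (simp add: vextend_def sum scale)
  then show ?thesis by (simp add: vextend_units)
qed

lemma vextend_mem: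
  assumes "vs.subspace N" and "\<And>k. k \<in> keys v \<Longrightarrow> b k \<in> N" shows "vextend b v \<in> N"
  unfolding vextend_def by (intro vs.subspace_sum vs.subspace_scale assms)

lemma lin_mem:
  assumes "lin f" and "vs.subspace N" and "\<And>k. k \<in> keys v \<Longrightarrow> f (unit_vec k) \<in> N" shows "f v \<in> N"
  unfolding lin_eq_vextend[OF assms(1), of v] by (rule vextend_mem[OF assms(2,3)])

lemmas lin_add = module_hom.add[of vscale vscale]
  and lin_scale = module_hom.scale[of vscale vscale]
  and lin_zero = module_hom.zero[of vscale vscale]
  and lin_diff = module_hom.diff[of vscale vscale]
  and lin_uminus = module_hom.neg[of vscale vscale]

lemma lin_compose: "lin f \<Longrightarrow> lin g \<Longrightarrow> lin (\<lambda>v. g (f v))"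
  unfolding module_hom_iff by simp

lemma lin_sub: "lin f \<Longrightarrow> lin g \<Longrightarrow> lin (\<lambda>v. f v - g v)"
  unfolding module_hom_iff by (simp add: vs.scale_right_diff_distrib)

lemma lin_plus: "lin f \<Longrightarrow> lin g \<Longrightarrow> lin (\<lambda>v. f v + g v)"
  unfolding module_hom_iff by (simp add: vs.scale_right_distrib)

lemma lin_vscale: "lin (vscale a)"
  unfolding module_hom_iff by (simp add: module_vscale vs.scale_right_distrib mult.commute)

lemma lin_ident: "lin (\<lambda>v. v)" and lin_null: "lin (\<lambda>v. 0)"
  unfolding module_hom_iff by (simp_all add: module_vscale)

section \<open>Free modules of finite rank\<close>

lemma subspace_free_mod: "vs.subspace (free_mod r)"
  unfolding vs.subspace_def free_mod_def
  by (auto simp: in_keys_iff lookup_add subset_iff) (metis add.right_neutral, metis mult_zero_right)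

lemma unit_vec_in_free_mod: "k < r \<Longrightarrow> unit_vec k \<in> free_mod r"
  by (simp add: free_mod_def)

lemma lookup_free_mod: "v \<in> free_mod r \<Longrightarrow> r \<le> k \<Longrightarrow> lookup v k = 0"
  by (force simp: free_mod_def in_keys_iff)

lemma free_modD: "v \<in> free_mod r \<Longrightarrow> keys v \<subseteq> {..<r}"
  by (simp add: free_mod_def)

lemma free_mod_0: "free_mod 0 = {0}"
  by (auto simp: free_mod_def)

lemma lin_free_mod:
  assumes "lin f" and "\<And>k. k < r \<Longrightarrow> f (unit_vec k) \<in> free_mod s" and "v \<in> free_mod r"
  shows "f v \<in> free_mod s"
  using lin_mem[OF assms(1) subspace_free_mod] assms(2) free_modD[OF assms(3)] by blast

lemma lin_eq_free_mod:
  assumes "lin f" "lin g" and "\<And>k. k < r \<Longrightarrow> f (unit_vec k) = g (unit_vec k)" and "v \<in> free_mod r"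
  shows "f v = g v"
proof -
  have "f v - g v \<in> {0}"
    by (rule lin_mem[OF lin_sub[OF assms(1,2)] vs.subspace_single_0])
      (use assms(3) free_modD[OF assms(4)] in auto)
  then show ?thesis by simp
qed

lemma free_mod_induct [consumes 1, case_names zero unit add]:
  assumes "v \<in> free_mod r" and "P 0"
    and "\<And>a k x. k < r \<Longrightarrow> x \<in> free_mod r \<Longrightarrow> P x \<Longrightarrow> P (vscale a (unit_vec k) + x)"
  shows "P v"
proof -
  have "P (\<Sum>k\<in>A. vscale (lookup v k) (unit_vec k))" if "finite A" "A \<subseteq> {..<r}" for A
    using that
  proof (induction A)
    case (insert k A)
    have "(\<Sum>k\<in>A. vscale (lookup v k) (unit_vec k)) \<in> free_mod r"
      using insert by (intro vs.subspace_sum vs.subspace_scale subspace_free_mod unit_vec_in_free_mod) auto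
    then show ?case using insert assms(3) by simp
  qed (simp add: assms(2))
  from this[of "keys v"] show ?thesis
    using free_modD[OF assms(1)] vextend_units[of v] by (simp add: vextend_def)
qed

lemma projective_free_mod: "projective_module (free_mod r :: (nat \<Rightarrow>\<^sub>0 'a::comm_ring_1) set)"
  unfolding projective_module_def
proof (intro conjI exI)
  show "vs.subspace (free_mod r)" by (rule subspace_free_mod)
  show "vs.subspace {0}" by (rule vs.subspace_single_0)
  show "free_mod r \<inter> {0} = {0}" using vs.subspace_0[OF subspace_free_mod] by auto
  let ?B = "unit_vec ` {..<r} :: (nat \<Rightarrow>\<^sub>0 'a) set"
  have inj: "inj unit_vec" by (rule injI) (metis keys_unit_vec singleton_inject)
  show "vs.independent ?B"
    unfolding vs.independent_explicit_module
  proof (intro allI impI)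
    fix t u and v :: "nat \<Rightarrow>\<^sub>0 'a"
    assume t: "finite t" "t \<subseteq> ?B" "(\<Sum>v\<in>t. vscale (u v) v) = 0" "v \<in> t"
    then obtain k where k: "v = unit_vec k" by auto
    have "0 = (\<Sum>w\<in>t. u w * lookup w k)"
      using arg_cong[OF t(3), of "\<lambda>v. lookup v k"] by (simp add: lookup_sum)
    also have "\<dots> = (\<Sum>w\<in>t. if w = v then u v else 0)"
      using t(2) by (intro sum.cong) (auto simp: k lookup_unit_vec dest: injD[OF inj])
    finally show "u v = 0" using t(1,4) by simp
  qed
  have "vs.span ?B = free_mod r"
  proof
    show "vs.span ?B \<subseteq> free_mod r"
      by (rule vs.span_minimal) (auto intro: unit_vec_in_free_mod subspace_free_mod)
    show "free_mod r \<subseteq> vs.span ?B"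
    proof
      fix v :: "nat \<Rightarrow>\<^sub>0 'a" assume "v \<in> free_mod r"
      then have "vextend unit_vec v \<in> vs.span ?B"
        by (intro vextend_mem vs.subspace_span vs.span_base) (auto dest: free_modD)
      then show "v \<in> vs.span ?B" by (simp add: vextend_units)
    qed
  qed
  then show "{x + y |x y. x \<in> free_mod r \<and> y \<in> {0}} = vs.span ?B" by simp
qed

section \<open>Homogeneous components\<close>

lemma mpoly_induct [case_names zero single add]:
  fixes f :: "'b \<Rightarrow>\<^sub>0 'a::comm_monoid_add"
  assumes "P 0" and "\<And>m c. P (single m c)" and "\<And>f g. P f \<Longrightarrow> P g \<Longrightarrow> P (f + g)"
  shows "P f"
proof -
  have f: "f = (\<Sum>m\<in>keys f. single m (lookup f m))"
    by (rule poly_mapping_eqI) (auto simp: lookup_sum lookup_single when_def in_keys_iff)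
  have "P (\<Sum>m\<in>A. single m (lookup f m))" if "finite A" for A
    using that by induction (auto simp: assms)
  then show ?thesis by (subst f) simp
qed

lemma mono_deg_superset: "finite A \<Longrightarrow> keys m \<subseteq> A \<Longrightarrow> mono_deg m = (\<Sum>v\<in>A. lookup m v)"
  unfolding mono_deg_def by (rule sum.mono_neutral_left) (auto simp: in_keys_iff)

lemma mono_deg_add: "mono_deg (s + t) = mono_deg s + mono_deg t"
proof -
  have "mono_deg (s + t) = (\<Sum>v\<in>keys s \<union> keys t. lookup (s + t) v)"
    by (rule mono_deg_superset) (auto dest: subsetD[OF keys_add])
  then show ?thesis
    by (simp add: lookup_add sum.distrib mono_deg_superset[of "keys s \<union> keys t"])
qed

lemma mono_deg_eq_0 [simp]: "mono_deg m = 0 \<longleftrightarrow> m = 0"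
  by (auto simp: mono_deg_def in_keys_iff) (metis lookup_zero poly_mapping_eqI)

lemma add_eq_0_poly_mapping: "s + t = 0 \<longleftrightarrow> s = 0 \<and> t = (0 :: 'x \<Rightarrow>\<^sub>0 nat)"
  by (metis add_is_0 mono_deg_add mono_deg_eq_0)

text \<open>Degrees are integers because differences of degrees occur as arguments; components of
  negative degree are zero.\<close>

definition hpart :: "int \<Rightarrow> ('x, 'k::comm_ring_1) mpoly \<Rightarrow> ('x, 'k) mpoly" where
  "hpart n f = Poly_Mapping.mapp (\<lambda>m c. c when int (mono_deg m) = n) f"

lemma lookup_hpart: "lookup (hpart n f) m = (lookup f m when int (mono_deg m) = n)"
  by (auto simp: hpart_def lookup_mapp when_def in_keys_iff)

lemma hpart_zero [simp]: "hpart n 0 = 0"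
  and hpart_add: "hpart n (f + g) = hpart n f + hpart n g"
  by (rule poly_mapping_eqI; simp add: lookup_hpart lookup_add when_add_distrib)+

lemma hpart_sum: "hpart n (sum f A) = (\<Sum>a\<in>A. hpart n (f a))"
  by (induction A rule: infinite_finite_induct) (auto simp: hpart_add)

lemma homogeneous_iff: "homogeneous n f \<longleftrightarrow> hpart n f = f"
proof
  assume "homogeneous n f"
  then show "hpart n f = f"
    by (intro poly_mapping_eqI) (auto simp: lookup_hpart when_def homogeneous_def in_keys_iff)
next
  assume h: "hpart n f = f"
  show "homogeneous n f"
    unfolding homogeneous_def
    using lookup_hpart[of n f] h by (auto simp: in_keys_iff when_def) metis
qed

lemma hpart_single: "hpart n (single m c) = (single m c when int (mono_deg m) = n)"
  by (rule poly_mapping_eqI) (auto simp: lookup_hpart lookup_single when_def)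

lemma hpart_mult_single: "hpart n (f * single m c) = hpart (n - int (mono_deg m)) f * single m c"
proof (induction f rule: mpoly_induct)
  case (single s a)
  then show ?case by (auto simp: mult_single hpart_single when_def mono_deg_add)
qed (simp_all add: distrib_right hpart_add)

lemma hpart_mult:
  assumes "homogeneous k g" shows "hpart n (f * g) = hpart (n - k) f * g"
proof -
  have g: "g = (\<Sum>m\<in>keys g. single m (lookup g m))"
    by (rule poly_mapping_eqI) (auto simp: lookup_sum lookup_single when_def in_keys_iff)
  have "hpart n (f * (\<Sum>m\<in>keys g. single m (lookup g m))) = hpart (n - k) f * (\<Sum>m\<in>keys g. single m (lookup g m))"
    unfolding sum_distrib_left hpart_sum
    by (rule sum.cong) (use assms in \<open>auto simp: hpart_mult_single homogeneous_def\<close>)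
  then show ?thesis using g by simp
qed

lemma homogeneous_0 [simp]: "homogeneous n 0"
  by (simp add: homogeneous_def)

lemma homogeneous_mult: "homogeneous k f \<Longrightarrow> homogeneous n g \<Longrightarrow> homogeneous (k + n) (f * g)"
  by (simp add: hpart_mult homogeneous_iff[of _ "f * g"]) (simp add: homogeneous_iff)

lemma homogeneous_hpart: "homogeneous n (hpart n f)"
  by (simp add: homogeneous_iff lookup_hpart poly_mapping_eq_iff fun_eq_iff when_def)

lemma homogeneous_nonpos:
  assumes "homogeneous n f" "n \<le> 0" "lookup f 0 = 0" shows "f = 0"
proof -
  have "m \<notin> keys f" for m
  proof
    assume m: "m \<in> keys f"
    then have "int (mono_deg m) \<le> 0" using assms(1,2) by (auto simp: homogeneous_def)
    then show False using m assms(3) by (simp add: in_keys_iff)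
  qed
  then show ?thesis by (metis keys_eq_empty all_not_in_conv)
qed

text \<open>The exponent 0 splits only as 0 + 0. This makes reduction modulo the variables
  compatible with products.\<close>

lemma lookup_mult_0: "lookup (f * g) 0 = lookup f 0 * lookup (g :: ('x, 'k::comm_ring_1) mpoly) 0"
proof (induction f rule: mpoly_induct)
  case (single s a)
  show ?case
  proof (induction g rule: mpoly_induct)
    case (single t b)
    then show ?case
      by (auto simp: mult_single lookup_single when_def add_eq_0_poly_mapping)
  qed (simp_all add: distrib_left lookup_add)
qed (simp_all add: distrib_right lookup_add)

lemma homogeneous_lookup_0: "homogeneous n f \<Longrightarrow> n \<noteq> 0 \<Longrightarrow> lookup f 0 = 0"
  by (auto simp: homogeneous_def in_keys_iff)

lemma homogeneous_const: "homogeneous 0 (single 0 c)"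
  by (auto simp: homogeneous_def)

lemma homogeneous_1: "homogeneous 0 1"
  using homogeneous_const[of 1] by simp

text \<open>Homogeneity of degree \<open>n\<close> in the graded free module whose basis vector
  \<open>l\<close> has degree \<open>\<delta> l\<close>.\<close>

definition hvec :: "(nat \<Rightarrow> int) \<Rightarrow> int \<Rightarrow> (nat \<Rightarrow>\<^sub>0 ('x, 'k::comm_ring_1) mpoly) \<Rightarrow> bool" where
  "hvec \<delta> n v \<longleftrightarrow> (\<forall>l. homogeneous (n - \<delta> l) (lookup v l))"

definition vpart :: "(nat \<Rightarrow> int) \<Rightarrow> int \<Rightarrow> (nat \<Rightarrow>\<^sub>0 ('x, 'k::comm_ring_1) mpoly) \<Rightarrow> (nat \<Rightarrow>\<^sub>0 ('x, 'k) mpoly)" where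
  "vpart \<delta> n v = Poly_Mapping.mapp (\<lambda>l. hpart (n - \<delta> l)) v"

lemma lookup_vpart: "lookup (vpart \<delta> n v) l = hpart (n - \<delta> l) (lookup v l)"
  by (auto simp: vpart_def lookup_mapp when_def in_keys_iff)

lemma hvec_iff: "hvec \<delta> n v \<longleftrightarrow> vpart \<delta> n v = v"
  by (simp add: hvec_def homogeneous_iff poly_mapping_eq_iff fun_eq_iff lookup_vpart)

lemma hvec_vpart: "hvec \<delta> n (vpart \<delta> n v)"
  by (simp add: hvec_def lookup_vpart homogeneous_hpart)

lemma hvec_0: "hvec \<delta> n 0"
  by (simp add: hvec_def)

lemma vpart_free_mod: "v \<in> free_mod r \<Longrightarrow> vpart \<delta> n v \<in> free_mod r"
  unfolding free_mod_def vpart_def by (auto dest: subsetD[OF keys_mapp_subset])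

lemma vpart_diff: "vpart \<delta> n (v - w) = vpart \<delta> n v - vpart \<delta> n w"
  by (rule poly_mapping_eqI)
    (metis (no_types) add_diff_cancel_right' diff_add_cancel hpart_add lookup_minus lookup_vpart)

text \<open>This allows solutions of linear equations to be replaced by homogeneous ones. The shift
  \<open>s\<close> covers chain maps that lift multiplication by an element of degree
  \<open>s\<close>.\<close>

lemma vpart_lin:
  assumes "lin f" and "\<And>k. k < r \<Longrightarrow> hvec \<delta>' (\<delta> k + s) (f (unit_vec k))" and "v \<in> free_mod r"
  shows "vpart \<delta>' (n + s) (f v) = f (vpart \<delta> n v)"
proof (rule poly_mapping_eqI)
  fix l
  have f: "lookup (f x) l = (\<Sum>k<r. lookup x k * lookup (f (unit_vec k)) l)" if "x \<in> free_mod r" for x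
    unfolding lin_eq_vextend[OF assms(1), of x] using free_modD[OF that]
    by (rule lookup_vextend_superset[rotated]) simp
  have "hpart (n + s - \<delta>' l) (lookup (f v) l) =
      (\<Sum>k<r. hpart (n + s - \<delta>' l - (\<delta> k + s - \<delta>' l)) (lookup v k) * lookup (f (unit_vec k)) l)"
    unfolding f[OF assms(3)] hpart_sum
    by (intro sum.cong refl hpart_mult) (use assms(2) in \<open>auto simp: hvec_def\<close>)
  also have "\<dots> = lookup (f (vpart \<delta> n v)) l"
    unfolding f[OF vpart_free_mod[OF assms(3)]] by (simp add: lookup_vpart)
  finally show "lookup (vpart \<delta>' (n + s) (f v)) l = lookup (f (vpart \<delta> n v)) l"
    by (simp add: lookup_vpart)
qed

lemma hvec_lin:
  assumes "lin f" and "\<And>k. k < r \<Longrightarrow> hvec \<delta>' (\<delta> k + s) (f (unit_vec k))" and "v \<in> free_mod r" and "hvec \<delta> n v"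
  shows "hvec \<delta>' (n + s) (f v)"
  using vpart_lin[OF assms(1,2,3), of n] assms(4) by (simp add: hvec_iff)

section \<open>Augmented graded resolutions\<close>

definition graded_ideal :: "('x, 'k::comm_ring_1) mpoly set \<Rightarrow> bool" where
  "graded_ideal I \<longleftrightarrow> module.subspace (*) I \<and> (\<forall>f\<in>I. \<forall>n. hpart n f \<in> I)"

text \<open>
  The augmented complex has the ring itself, embedded as \<open>free_mod 1\<close>, in position \<open>0\<close>.
  All conditions on \<open>D i w\<close> are imposed modulo \<open>aug I i\<close>, so that the augmentation
  onto the quotient ring is not a special case.
\<close>

definition aug :: "'a::comm_ring_1 set \<Rightarrow> nat \<Rightarrow> (nat \<Rightarrow>\<^sub>0 'a) set" where
  "aug I i = {v. \<forall>l. lookup v l \<in> (if i = 0 then I else {0})}"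

text \<open>The complex ends at position 0, where everything is a cycle; exactness there is
  surjectivity onto the quotient ring.\<close>

definition cyc :: "'a::comm_ring_1 set \<Rightarrow> (nat \<Rightarrow> (nat \<Rightarrow>\<^sub>0 'a) \<Rightarrow> (nat \<Rightarrow>\<^sub>0 'a)) \<Rightarrow> nat \<Rightarrow> (nat \<Rightarrow>\<^sub>0 'a) \<Rightarrow> bool" where
  "cyc I D i v \<longleftrightarrow> (case i of 0 \<Rightarrow> True | Suc j \<Rightarrow> D j v \<in> aug I j)"

text \<open>Homological degree \<open>i\<close> sits in position \<open>Suc i\<close>. Read from
  right to left, the final equivalence says that consecutive differentials compose to zero modulo
  \<open>aug I\<close>; read from left to right, it is exactness.\<close>

definition aug_res ::
  "('x, 'k::comm_ring_1) mpoly set \<Rightarrow> (nat \<Rightarrow> nat) \<Rightarrow> (nat \<Rightarrow> nat \<Rightarrow> int) \<Rightarrow>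
   (nat \<Rightarrow> (nat \<Rightarrow>\<^sub>0 ('x, 'k) mpoly) \<Rightarrow> (nat \<Rightarrow>\<^sub>0 ('x, 'k) mpoly)) \<Rightarrow> bool" where
  "aug_res I r \<delta> D \<longleftrightarrow> r 0 = 1 \<and> \<delta> 0 0 = 0 \<and> (\<forall>i. lin (D i)) \<and>
     (\<forall>i. \<forall>k<r (Suc i). D i (unit_vec k) \<in> free_mod (r i) \<and> hvec (\<delta> i) (\<delta> (Suc i) k) (D i (unit_vec k))) \<and>
     (\<forall>i. \<forall>v\<in>free_mod (r i). cyc I D i v \<longleftrightarrow> (\<exists>w\<in>free_mod (r (Suc i)). D i w - v \<in> aug I i))"

lemma aug_Suc [simp]: "aug I (Suc i) = {0}"
  by (auto simp: aug_def poly_mapping_eq_iff fun_eq_iff)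

lemma cyc_0 [simp]: "cyc I D 0 v" and cyc_Suc [simp]: "cyc I D (Suc i) v \<longleftrightarrow> D i v \<in> aug I i"
  by (simp_all add: cyc_def)

lemma subspace_aug:
  fixes I :: "'a::comm_ring_1 set"
  assumes "module.subspace (*) I" shows "vs.subspace (aug I i)"
proof -
  interpret I: module "(*) :: 'a \<Rightarrow> 'a \<Rightarrow> 'a" by (rule module_times)
  show ?thesis
    unfolding vs.subspace_def aug_def
    using I.subspace_0[OF assms] I.subspace_add[OF assms] I.subspace_scale[OF assms]
    by (auto simp: lookup_add)
qed

lemma vpart_aug: "graded_ideal I \<Longrightarrow> v \<in> aug I i \<Longrightarrow> vpart \<delta> n v \<in> aug I i"
  by (auto simp: aug_def lookup_vpart graded_ideal_def split: if_splits)

context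
  fixes I :: "('x, 'k::comm_ring_1) mpoly set" and r \<delta> D
  assumes F: "aug_res I r \<delta> D"
begin

lemma aug_res_lin: "lin (D i)"
  and aug_res_0: "r 0 = 1" "\<delta> 0 0 = 0"
  and aug_res_unit: "k < r (Suc i) \<Longrightarrow> D i (unit_vec k) \<in> free_mod (r i)"
  and aug_res_hvec: "k < r (Suc i) \<Longrightarrow> hvec (\<delta> i) (\<delta> (Suc i) k) (D i (unit_vec k))"
  and aug_res_exact: "v \<in> free_mod (r i) \<Longrightarrow> cyc I D i v \<longleftrightarrow> (\<exists>w\<in>free_mod (r (Suc i)). D i w - v \<in> aug I i)"
  using F unfolding aug_res_def by blast+

lemma aug_res_free_mod: "v \<in> free_mod (r (Suc i)) \<Longrightarrow> D i v \<in> free_mod (r i)"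
  using lin_free_mod[OF aug_res_lin aug_res_unit] .

lemma aug_res_vpart: "v \<in> free_mod (r (Suc i)) \<Longrightarrow> vpart (\<delta> i) n (D i v) = D i (vpart (\<delta> (Suc i)) n v)"
  using vpart_lin[OF aug_res_lin, of "r (Suc i)" "\<delta> i" "\<delta> (Suc i)" 0 i v n] aug_res_hvec by simp

lemma aug_res_hvecD: "v \<in> free_mod (r (Suc i)) \<Longrightarrow> hvec (\<delta> (Suc i)) n v \<Longrightarrow> hvec (\<delta> i) n (D i v)"
  by (simp add: hvec_iff aug_res_vpart)

lemma aug_res_cyc:
  assumes "graded_ideal I" and "v \<in> free_mod (r (Suc i))" shows "cyc I D i (D i v)"
proof -
  have "D i v - D i v \<in> aug I i"
    using assms(1) vs.subspace_0[OF subspace_aug, of I i] by (simp add: graded_ideal_def)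
  then show ?thesis using aug_res_exact[OF aug_res_free_mod[OF assms(2)]] assms(2) by blast
qed

end

text \<open>
  \<open>c = 1\<close> gives the comparison map of two resolutions, \<open>I = (J : c)\<close> the map whose cone is taken below.
\<close>

lemma aug_res_lift:
  assumes F: "aug_res I rF \<delta>F DF" and G: "aug_res J rG \<delta>G DG" and I: "graded_ideal I" and J: "graded_ideal J"
    and c: "homogeneous s c" and cI: "\<And>f. f \<in> I \<Longrightarrow> c * f \<in> J"
  obtains \<alpha> where "\<And>i. lin (\<alpha> i)" and "\<alpha> 0 = vscale c"
    and "\<And>i k. k < rF i \<Longrightarrow> \<alpha> i (unit_vec k) \<in> free_mod (rG i)"
    and "\<And>i k. k < rF i \<Longrightarrow> hvec (\<delta>G i) (\<delta>F i k + s) (\<alpha> i (unit_vec k))"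
    and "\<And>i v. v \<in> free_mod (rF (Suc i)) \<Longrightarrow> DG i (\<alpha> (Suc i) v) - \<alpha> i (DF i v) \<in> aug J i"
proof -
  have subJ: "vs.subspace (aug J i)" for i using J by (auto simp: graded_ideal_def intro: subspace_aug)
  \<comment> \<open>That cycles go to cycles is carried along, since exactness of the target lifts
    cycles only.\<close>
  define P where "P i a \<longleftrightarrow> lin a \<and> (i = 0 \<longrightarrow> a = vscale c) \<and>
     (\<forall>k<rF i. a (unit_vec k) \<in> free_mod (rG i) \<and> hvec (\<delta>G i) (\<delta>F i k + s) (a (unit_vec k))) \<and>
     (\<forall>v\<in>free_mod (rF i). cyc I DF i v \<longrightarrow> cyc J DG i (a v))" for i a
  define Q where "Q i a a' \<longleftrightarrow> (\<forall>v\<in>free_mod (rF (Suc i)). DG i (a' v) - a (DF i v) \<in> aug J i)" for i a a'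
  have aug_mem: "a v \<in> aug J i" if "P i a" "v \<in> aug I i" for i a v
  proof (cases i)
    case 0
    then show ?thesis using that cI by (auto simp: P_def aug_def)
  next
    case (Suc j)
    then show ?thesis using that lin_zero[of a] by (simp add: P_def)
  qed
  have "\<exists>a. \<forall>i. P i (a i) \<and> Q i (a i) (a (Suc i))"
  proof (rule dependent_nat_choice)
    have "vscale c (unit_vec 0) \<in> free_mod (rG 0)"
      using aug_res_0(1)[OF G] by (intro vs.subspace_scale subspace_free_mod unit_vec_in_free_mod) simp
    moreover have "hvec (\<delta>G 0) (\<delta>F 0 0 + s) (vscale c (unit_vec 0))"
      using c aug_res_0(2)[OF F] aug_res_0(2)[OF G] by (auto simp: hvec_def lookup_unit_vec)
    ultimately have "P 0 (vscale c)"
      using aug_res_0(1)[OF F] by (simp add: P_def lin_vscale)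
    then show "\<exists>a. P 0 a" by blast
  next
    fix a i assume P: "P i a"
    then have lin: "lin a" and af: "\<And>k. k < rF i \<Longrightarrow> a (unit_vec k) \<in> free_mod (rG i)"
      and ah: "\<And>k. k < rF i \<Longrightarrow> hvec (\<delta>G i) (\<delta>F i k + s) (a (unit_vec k))"
      and acyc: "\<And>v. v \<in> free_mod (rF i) \<Longrightarrow> cyc I DF i v \<Longrightarrow> cyc J DG i (a v)" by (auto simp: P_def)
    have "\<exists>w\<in>free_mod (rG (Suc i)). hvec (\<delta>G (Suc i)) (\<delta>F (Suc i) k + s) w \<and>
        DG i w - a (DF i (unit_vec k)) \<in> aug J i" if k: "k < rF (Suc i)" for k
    proof -
      let ?n = "\<delta>F (Suc i) k + s"
      have u: "unit_vec k \<in> free_mod (rF (Suc i))" using k by (rule unit_vec_in_free_mod)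
      have x: "DF i (unit_vec k) \<in> free_mod (rF i)" "cyc I DF i (DF i (unit_vec k))"
        using aug_res_free_mod[OF F u] aug_res_cyc[OF F I u] .
      have ax: "a (DF i (unit_vec k)) \<in> free_mod (rG i)" using lin_free_mod[OF lin af x(1)] .
      then obtain w where w: "w \<in> free_mod (rG (Suc i))" "DG i w - a (DF i (unit_vec k)) \<in> aug J i"
        using aug_res_exact[OF G] acyc[OF x] by blast
      \<comment> \<open>The preimage \<open>w\<close> need not be homogeneous; as its target is, the
        component of degree \<open>?n\<close> is a preimage as well.\<close>
      have "hvec (\<delta>G i) ?n (a (DF i (unit_vec k)))"
        using hvec_lin[OF lin ah x(1) aug_res_hvec[OF F k]] .
      then have "vpart (\<delta>G i) ?n (DG i w - a (DF i (unit_vec k))) =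
          DG i (vpart (\<delta>G (Suc i)) ?n w) - a (DF i (unit_vec k))"
        using aug_res_vpart[OF G w(1)] by (simp add: vpart_diff hvec_iff)
      then show ?thesis using vpart_aug[OF J w(2)] vpart_free_mod[OF w(1)] hvec_vpart by metis
    qed
    then obtain b where b: "\<And>k. k < rF (Suc i) \<Longrightarrow> b k \<in> free_mod (rG (Suc i))"
      "\<And>k. k < rF (Suc i) \<Longrightarrow> hvec (\<delta>G (Suc i)) (\<delta>F (Suc i) k + s) (b k)"
      "\<And>k. k < rF (Suc i) \<Longrightarrow> DG i (b k) - a (DF i (unit_vec k)) \<in> aug J i"
      by metis
    have "DG i (vextend b v) - a (DF i v) \<in> aug J i" if "v \<in> free_mod (rF (Suc i))" for v
      by (rule lin_mem[of "\<lambda>v. DG i (vextend b v) - a (DF i v)"])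
        (use free_modD[OF that] b(3) in \<open>auto intro!: lin_sub lin_compose[OF lin_vextend] lin_compose[OF aug_res_lin[OF F]]
            aug_res_lin[OF G] lin subJ\<close>)
    then have Q: "Q i a (vextend b)" by (simp add: Q_def)
    have "cyc J DG (Suc i) (vextend b v)" if v: "v \<in> free_mod (rF (Suc i))" "cyc I DF (Suc i) v" for v
    proof -
      have "DG i (vextend b v) - a (DF i v) \<in> aug J i" using Q v by (simp add: Q_def)
      moreover have "a (DF i v) \<in> aug J i" using v aug_mem[OF P] by simp
      ultimately have "DG i (vextend b v) - a (DF i v) + a (DF i v) \<in> aug J i"
        by (rule vs.subspace_add[OF subJ])
      then show ?thesis by simp
    qed
    then have "P (Suc i) (vextend b)" using b by (simp add: P_def lin_vextend)
    then show "\<exists>a'. P (Suc i) a' \<and> Q i a a'" using Q by blast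
  qed
  then obtain a where "\<And>i. P i (a i)" "\<And>i. Q i (a i) (a (Suc i))" by blast
  then show ?thesis using that[of a] by (simp add: P_def Q_def)
qed

text \<open>The uniqueness half of the comparison theorem. As \<open>\<phi> 0\<close> is the
  identity, the homotopy can start with 0. Degrees are not tracked: it is applied only before
  reduction modulo the variables.\<close>

lemma aug_res_homotopy:
  fixes I :: "('x, 'k::comm_ring_1) mpoly set"
  assumes F: "aug_res I r \<delta> D" and I: "graded_ideal I"
    and lin: "\<And>i. lin (\<phi> i)" and id: "\<And>v. \<phi> 0 v = v"
    and free: "\<And>i k. k < r i \<Longrightarrow> \<phi> i (unit_vec k) \<in> free_mod (r i)"
    and chain: "\<And>i v. v \<in> free_mod (r (Suc i)) \<Longrightarrow> D i (\<phi> (Suc i) v) - \<phi> i (D i v) \<in> aug I i"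
  obtains h where "\<And>i. lin (h i)" and "h 0 = (\<lambda>v. 0)" and "\<And>i k. k < r i \<Longrightarrow> h i (unit_vec k) \<in> free_mod (r (Suc i))"
    and "\<And>i v. v \<in> free_mod (r (Suc i)) \<Longrightarrow> D (Suc i) (h (Suc i) v) = v - \<phi> (Suc i) v - h i (D i v)"
proof -
  have subI: "vs.subspace (aug I i)" for i using I by (auto simp: graded_ideal_def intro: subspace_aug)
  define P where "P i a \<longleftrightarrow> lin a \<and> (i = 0 \<longrightarrow> a = (\<lambda>v. 0)) \<and>
     (\<forall>k<r i. a (unit_vec k) \<in> free_mod (r (Suc i))) \<and>
     (\<forall>v\<in>free_mod (r i). cyc I D i v \<longrightarrow> D i (a v) - (v - \<phi> i v) \<in> aug I i)" for i a
  define Q where "Q i a a' \<longleftrightarrow> (\<forall>v\<in>free_mod (r (Suc i)). D (Suc i) (a' v) = v - \<phi> (Suc i) v - a (D i v))" for i a a'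
  have "\<exists>a. \<forall>i. P i (a i) \<and> Q i (a i) (a (Suc i))"
  proof (rule dependent_nat_choice)
    have "P 0 (\<lambda>v. 0)"
      using id by (simp add: P_def lin_null lin_zero[OF aug_res_lin[OF F]] vs.subspace_0[OF subI]
          vs.subspace_0[OF subspace_free_mod])
    then show "\<exists>a. P 0 a" by blast
  next
    fix a i assume P: "P i a"
    then have lina: "lin a" and af: "\<And>k. k < r i \<Longrightarrow> a (unit_vec k) \<in> free_mod (r (Suc i))"
      and aD: "\<And>v. v \<in> free_mod (r i) \<Longrightarrow> cyc I D i v \<Longrightarrow> D i (a v) - (v - \<phi> i v) \<in> aug I i" by (auto simp: P_def)
    have "\<exists>w\<in>free_mod (r (Suc (Suc i))). D (Suc i) w = unit_vec k - \<phi> (Suc i) (unit_vec k) - a (D i (unit_vec k))"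
      if k: "k < r (Suc i)" for k
    proof -
      let ?u = "unit_vec k" let ?x = "D i ?u"
      let ?v = "?u - \<phi> (Suc i) ?u - a ?x"
      have u: "?u \<in> free_mod (r (Suc i))" using k by (rule unit_vec_in_free_mod)
      have x: "?x \<in> free_mod (r i)" "cyc I D i ?x"
        using aug_res_free_mod[OF F u] aug_res_cyc[OF F I u] .
      have v: "?v \<in> free_mod (r (Suc i))"
        using u free[OF k] lin_free_mod[OF lina af x(1)] by (intro vs.subspace_diff subspace_free_mod)
      \<comment> \<open>The differential of \<open>?v\<close> splits into the chain map defect of
        \<open>\<phi>\<close> and the defect of the homotopy one step below, both in
        \<open>aug I i\<close>.\<close>
      have "- (D i (\<phi> (Suc i) ?u) - \<phi> i ?x) - (D i (a ?x) - (?x - \<phi> i ?x)) \<in> aug I i"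
        by (rule vs.subspace_diff[OF subI vs.subspace_neg[OF subI chain[OF u]] aD[OF x]])
      moreover have "D i ?v = - (D i (\<phi> (Suc i) ?u) - \<phi> i ?x) - (D i (a ?x) - (?x - \<phi> i ?x))"
        by (simp add: lin_diff[OF aug_res_lin[OF F]])
      ultimately have "cyc I D (Suc i) ?v" by simp
      then show ?thesis using aug_res_exact[OF F v] by simp
    qed
    then obtain b where b: "\<And>k. k < r (Suc i) \<Longrightarrow> b k \<in> free_mod (r (Suc (Suc i)))"
      "\<And>k. k < r (Suc i) \<Longrightarrow> D (Suc i) (b k) = unit_vec k - \<phi> (Suc i) (unit_vec k) - a (D i (unit_vec k))"
      by metis
    have "D (Suc i) (vextend b v) = v - \<phi> (Suc i) v - a (D i v)" if "v \<in> free_mod (r (Suc i))" for v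
      by (rule lin_eq_free_mod[OF _ _ _ that])
        (simp_all add: b(2) lin_compose[OF lin_vextend] aug_res_lin[OF F] lin_sub lin_ident lin lin_compose[OF _ lina])
    then have Q: "Q i a (vextend b)" by (simp add: Q_def)
    have "D (Suc i) (vextend b v) - (v - \<phi> (Suc i) v) \<in> aug I (Suc i)"
      if v: "v \<in> free_mod (r (Suc i))" "cyc I D (Suc i) v" for v
    proof -
      \<comment> \<open>For \<open>i = 0\<close> the map \<open>a\<close> is zero; otherwise the
        cycle condition is \<open>D i v = 0\<close>.\<close>
      have "a (D i v) = 0"
        using v(2) P lin_zero[OF lina] by (cases i) (auto simp: P_def)
      then show ?thesis using Q v(1) by (simp add: Q_def)
    qed
    then have "P (Suc i) (vextend b)" using b(1) by (simp add: P_def lin_vextend)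
    then show "\<exists>a'. P (Suc i) a' \<and> Q i a a'" using Q by blast
  qed
  then obtain a where "\<And>i. P i (a i)" "\<And>i. Q i (a i) (a (Suc i))" by blast
  then show ?thesis using that[of a] by (simp add: P_def Q_def)
qed

section \<open>Reduction modulo the variables\<close>

definition vconst :: "(nat \<Rightarrow>\<^sub>0 ('x, 'k::comm_ring_1) mpoly) \<Rightarrow> (nat \<Rightarrow>\<^sub>0 'k)" where
  "vconst v = Poly_Mapping.map (\<lambda>f. lookup f 0) v"

lemma lookup_map_zero: "f 0 = 0 \<Longrightarrow> lookup (Poly_Mapping.map f v) k = f (lookup v k)"
  by (simp add: Poly_Mapping.map.rep_eq when_def)

lemma lookup_vconst [simp]: "lookup (vconst v) k = lookup (lookup v k) 0"
  by (simp add: vconst_def lookup_map_zero)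

lemma vconst_0 [simp]: "vconst 0 = 0"
  by (rule poly_mapping_eqI) simp

lemma vconst_minus: "vconst (v - w) = vconst v - vconst w"
  by (rule poly_mapping_eqI) (simp add: lookup_minus)

lemma vconst_lin:
  assumes "lin f" shows "vconst (f v) = vextend (\<lambda>k. vconst (f (unit_vec k))) (vconst v)"
proof (rule poly_mapping_eqI)
  fix l
  have "lookup (vconst (f v)) l = (\<Sum>k\<in>keys v. lookup (lookup v k) 0 * lookup (lookup (f (unit_vec k)) l) 0)"
    unfolding lin_eq_vextend[OF assms, of v] by (simp add: lookup_vextend lookup_sum lookup_mult_0)
  also have "\<dots> = lookup (vextend (\<lambda>k. vconst (f (unit_vec k))) (vconst v)) l"
    by (subst lookup_vextend_superset[of "keys v"]) (auto simp: in_keys_iff)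
  finally show "lookup (vconst (f v)) l = \<dots>" .
qed

lemma vconst_lin_0: "lin f \<Longrightarrow> vconst v = 0 \<Longrightarrow> vconst (f v) = 0"
  using vconst_lin[of f v] by (simp add: vextend_def)

definition vlift :: "(nat \<Rightarrow>\<^sub>0 'k) \<Rightarrow> (nat \<Rightarrow>\<^sub>0 ('x, 'k::comm_ring_1) mpoly)" where
  "vlift z = Poly_Mapping.map (single 0) z"

lemma lookup_vlift: "lookup (vlift z) k = single 0 (lookup z k)"
  by (simp add: vlift_def lookup_map_zero)

lemma vconst_vlift [simp]: "vconst (vlift z) = z"
  by (rule poly_mapping_eqI) (simp add: lookup_vlift)

lemma keys_vlift [simp]: "keys (vlift z) = keys z"
  by (auto simp: in_keys_iff lookup_vlift) (metis lookup_single_eq lookup_zero)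

lemma hvec_vlift: "(\<And>k. k \<in> keys z \<Longrightarrow> \<delta> k = n) \<Longrightarrow> hvec \<delta> n (vlift z)"
  unfolding hvec_def lookup_vlift by (metis diff_self homogeneous_0 homogeneous_const in_keys_iff single_zero)

lemma hvec_vconst: "hvec \<delta> n v \<Longrightarrow> \<delta> k \<noteq> n \<Longrightarrow> lookup (vconst v) k = 0"
  by (metis eq_iff_diff_eq_0 homogeneous_lookup_0 hvec_def lookup_vconst)

text \<open>
  If \<open>G\<close> has no basis vector of degree \<open>j\<close> in position \<open>i\<close>, then every composite \<open>F \<rightarrow> G \<rightarrow> F\<close>
  vanishes modulo the variables on the degree \<open>j\<close> part, while being homotopic to the identity.
\<close>

lemma aug_res_boundary:
  fixes I :: "('x, 'k::comm_ring_1) mpoly set"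
  assumes F: "aug_res I rF \<delta>F DF" and G: "aug_res I rG \<delta>G DG" and I: "graded_ideal I"
    and no: "\<And>k. k < rG (Suc i) \<Longrightarrow> \<delta>G (Suc i) k \<noteq> j"
    and z: "z \<in> free_mod (rF (Suc i))" "hvec (\<delta>F (Suc i)) j z" and Dz: "i = 0 \<or> vconst (DF i z) = 0"
  shows "\<exists>w\<in>free_mod (rF (Suc (Suc i))). vconst (DF (Suc i) w) = vconst z"
proof -
  obtain \<alpha> where \<alpha>: "\<And>i. lin (\<alpha> i)" "\<alpha> 0 = vscale 1"
    and \<alpha>f: "\<And>i k. k < rF i \<Longrightarrow> \<alpha> i (unit_vec k) \<in> free_mod (rG i)"
    and \<alpha>h: "\<And>i k. k < rF i \<Longrightarrow> hvec (\<delta>G i) (\<delta>F i k + 0) (\<alpha> i (unit_vec k))"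
    and \<alpha>c: "\<And>i v. v \<in> free_mod (rF (Suc i)) \<Longrightarrow> DG i (\<alpha> (Suc i) v) - \<alpha> i (DF i v) \<in> aug I i"
    by (rule aug_res_lift[OF F G I I homogeneous_1]) auto
  obtain \<beta> where \<beta>: "\<And>i. lin (\<beta> i)" "\<beta> 0 = vscale 1"
    and \<beta>f: "\<And>i k. k < rG i \<Longrightarrow> \<beta> i (unit_vec k) \<in> free_mod (rF i)"
    and \<beta>c: "\<And>i v. v \<in> free_mod (rG (Suc i)) \<Longrightarrow> DF i (\<beta> (Suc i) v) - \<beta> i (DG i v) \<in> aug I i"
    by (rule aug_res_lift[OF G F I I homogeneous_1]) auto
  have \<alpha>free: "\<alpha> i v \<in> free_mod (rG i)" if "v \<in> free_mod (rF i)" for i v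
    using lin_free_mod[OF \<alpha>(1) \<alpha>f that] .
  have subI: "vs.subspace (aug I i)" for i using I by (auto simp: graded_ideal_def intro: subspace_aug)
  have \<beta>aug: "\<beta> i v \<in> aug I i" if "v \<in> aug I i" for i v
    using that \<beta> lin_zero[OF \<beta>(1)] by (cases i) auto
  obtain h where h: "\<And>i. lin (h i)" "h 0 = (\<lambda>v. 0)"
    and hf: "\<And>i k. k < rF i \<Longrightarrow> h i (unit_vec k) \<in> free_mod (rF (Suc i))"
    and hD: "\<And>i v. v \<in> free_mod (rF (Suc i)) \<Longrightarrow> DF (Suc i) (h (Suc i) v) = v - \<beta> (Suc i) (\<alpha> (Suc i) v) - h i (DF i v)"
  proof (rule aug_res_homotopy[OF F I, where \<phi> = "\<lambda>i v. \<beta> i (\<alpha> i v)"])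
    show "lin (\<lambda>v. \<beta> i (\<alpha> i v))" for i using lin_compose[OF \<alpha>(1) \<beta>(1)] .
    show "\<beta> 0 (\<alpha> 0 v) = v" for v by (simp add: \<alpha>(2) \<beta>(2))
    show "\<beta> i (\<alpha> i (unit_vec k)) \<in> free_mod (rF i)" if "k < rF i" for i k
      using lin_free_mod[OF \<beta>(1) \<beta>f \<alpha>f[OF that]] .
    fix i and v :: "nat \<Rightarrow>\<^sub>0 ('x, 'k) mpoly" assume v: "v \<in> free_mod (rF (Suc i))"
    have "(DF i (\<beta> (Suc i) (\<alpha> (Suc i) v)) - \<beta> i (DG i (\<alpha> (Suc i) v))) + \<beta> i (DG i (\<alpha> (Suc i) v) - \<alpha> i (DF i v)) \<in> aug I i"
      using \<beta>c[OF \<alpha>free[OF v]] \<beta>aug[OF \<alpha>c[OF v]] by (rule vs.subspace_add[OF subI])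
    then show "DF i (\<beta> (Suc i) (\<alpha> (Suc i) v)) - \<beta> i (\<alpha> i (DF i v)) \<in> aug I i"
      by (simp add: lin_diff[OF \<beta>(1)])
  qed (rule that)
  \<comment> \<open>Modulo the variables, \<open>DF (Suc i) ?w\<close> is \<open>z\<close> minus two
    terms: the composite through \<open>G\<close>, zero for want of generators of degree
    \<open>j\<close>, and \<open>h i (DF i z)\<close>, zero because \<open>DF i z\<close> reduces to
    zero or, for \<open>i = 0\<close>, because \<open>h 0 = 0\<close>.\<close>
  let ?w = "h (Suc i) z"
  have "hvec (\<delta>G (Suc i)) (j + 0) (\<alpha> (Suc i) z)" by (rule hvec_lin[OF \<alpha>(1) \<alpha>h z])
  then have "lookup (vconst (\<alpha> (Suc i) z)) k = 0" for k
    using no[of k] lookup_free_mod[OF \<alpha>free[OF z(1)], of k] hvec_vconst[of "\<delta>G (Suc i)" j "\<alpha> (Suc i) z" k]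
    by (cases "k < rG (Suc i)") auto
  then have "vconst (\<alpha> (Suc i) z) = 0" by (intro poly_mapping_eqI) simp
  then have "vconst (\<beta> (Suc i) (\<alpha> (Suc i) z)) = 0" by (rule vconst_lin_0[OF \<beta>(1)])
  moreover have "vconst (h i (DF i z)) = 0"
  proof (cases i)
    case 0
    then show ?thesis using h(2) by simp
  qed (use Dz vconst_lin_0[OF h(1)] in auto)
  ultimately have "vconst (DF (Suc i) ?w) = vconst z"
    unfolding hD[OF z(1)] by (simp add: vconst_minus)
  then show ?thesis using lin_free_mod[OF h(1) hf z(1)] by blast
qed

section \<open>Mapping cones\<close>

text \<open>The direct sum of \<open>free_mod R\<close> and \<open>free_mod t\<close> is realised as
  \<open>free_mod (R + t)\<close>, the second summand occupying the coordinates from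
  \<open>R\<close> on.\<close>

definition fst_part :: "nat \<Rightarrow> (nat \<Rightarrow>\<^sub>0 'a) \<Rightarrow> (nat \<Rightarrow>\<^sub>0 'a::comm_ring_1)" where
  "fst_part R = vextend (\<lambda>k. if k < R then unit_vec k else 0)"

definition snd_part :: "nat \<Rightarrow> (nat \<Rightarrow>\<^sub>0 'a) \<Rightarrow> (nat \<Rightarrow>\<^sub>0 'a::comm_ring_1)" where
  "snd_part R = vextend (\<lambda>k. if k < R then 0 else unit_vec (k - R))"

definition shift :: "nat \<Rightarrow> (nat \<Rightarrow>\<^sub>0 'a) \<Rightarrow> (nat \<Rightarrow>\<^sub>0 'a::comm_ring_1)" where
  "shift R = vextend (\<lambda>k. unit_vec (k + R))"

lemma lin_parts: "lin (fst_part R)" "lin (snd_part R)" "lin (shift R)"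
  by (simp_all add: fst_part_def snd_part_def shift_def lin_vextend)

lemma lookup_fst_part: "lookup (fst_part R v) l = (if l < R then lookup v l else 0)"
proof -
  have "lookup (fst_part R v) l = (\<Sum>k\<in>keys v. if k = l then (if l < R then lookup v k else 0) else 0)"
    unfolding fst_part_def lookup_vextend by (rule sum.cong) (auto simp: lookup_unit_vec)
  then show ?thesis by (simp add: in_keys_iff)
qed

lemma lookup_snd_part: "lookup (snd_part R v) l = lookup v (l + R)"
proof -
  have "lookup (snd_part R v) l = (\<Sum>k\<in>keys v. if k = l + R then lookup v k else 0)"
    unfolding snd_part_def lookup_vextend by (rule sum.cong) (auto simp: lookup_unit_vec)
  then show ?thesis by (simp add: in_keys_iff)
qed

lemma lookup_shift: "lookup (shift R v) l = (if l < R then 0 else lookup v (l - R))"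
proof -
  have "lookup (shift R v) l = (\<Sum>k\<in>keys v. if k = l - R then (if l < R then 0 else lookup v k) else 0)"
    unfolding shift_def lookup_vextend by (rule sum.cong) (auto simp: lookup_unit_vec)
  then show ?thesis by (simp add: in_keys_iff)
qed

lemma parts_eq: "fst_part R v + shift R (snd_part R v) = v"
  by (rule poly_mapping_eqI) (simp add: lookup_add lookup_fst_part lookup_snd_part lookup_shift)

lemma free_mod_iff: "v \<in> free_mod r \<longleftrightarrow> (\<forall>k\<ge>r. lookup v k = 0)"
  unfolding free_mod_def by (auto simp: in_keys_iff subset_iff) (meson not_le)

lemma fst_part_free_mod: "fst_part R v \<in> free_mod R"
  by (simp add: free_mod_iff lookup_fst_part)

lemma snd_part_free_mod: "v \<in> free_mod (R + t) \<Longrightarrow> snd_part R v \<in> free_mod t"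
  by (simp add: free_mod_iff lookup_snd_part)

lemma shift_free_mod: "v \<in> free_mod t \<Longrightarrow> shift R v \<in> free_mod (R + t)"
  by (auto simp: free_mod_iff lookup_shift)

lemma free_mod_mono: "v \<in> free_mod r \<Longrightarrow> r \<le> s \<Longrightarrow> v \<in> free_mod s"
  by (auto simp: free_mod_iff)

lemma fst_part_add_shift: "g \<in> free_mod R \<Longrightarrow> fst_part R (g + shift R f) = g"
  and snd_part_add_shift: "g \<in> free_mod R \<Longrightarrow> snd_part R (g + shift R f) = f"
  by (auto intro!: poly_mapping_eqI simp: lookup_fst_part lookup_snd_part lookup_add lookup_shift free_mod_iff)

lemma add_shift_eqD:
  assumes "g + shift R f = g' + shift R f'" and "g \<in> free_mod R" "g' \<in> free_mod R"
  shows "g = g'" "f = f'"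
  using fst_part_add_shift[of g R f] fst_part_add_shift[of g' R f']
    snd_part_add_shift[of g R f] snd_part_add_shift[of g' R f'] assms by simp_all

lemma hvec_add_shift:
  assumes "g \<in> free_mod R" "hvec \<delta>G n g" "hvec \<delta>F (n - s) f"
  shows "hvec (\<lambda>l. if l < R then \<delta>G l else \<delta>F (l - R) + s) n (g + shift R f)"
  using assms unfolding hvec_def
  by (auto simp: lookup_add lookup_shift free_mod_iff algebra_simps)

lemma hvec_uminus: "hvec \<delta> n v \<Longrightarrow> hvec \<delta> n (- v)"
  unfolding hvec_def homogeneous_def by (simp add: in_keys_iff)

text \<open>
  The cone of the lift of multiplication by \<open>c\<close> resolves the third term of
  \<open>0 \<rightarrow> S/(J : c) \<rightarrow> S/J \<rightarrow> S/(J + (c)) \<rightarrow> 0\<close>.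
\<close>

lemma aug_res_cone:
  fixes J :: "('x, 'k::comm_ring_1) mpoly set"
  assumes F: "aug_res {f. c * f \<in> J} rF \<delta>F DF" and G: "aug_res J rG \<delta>G DG"
    and C: "graded_ideal {f. c * f \<in> J}" and J: "graded_ideal J" and c: "homogeneous s c"
  obtains r \<delta> D where "aug_res {a + c * b | a b. a \<in> J} r \<delta> D"
    and "\<And>i. r (Suc i) = rG (Suc i) + (if i = 0 then 0 else rF i)"
    and "\<And>i k. k < r (Suc i) \<Longrightarrow> k < rG (Suc i) \<and> \<delta> (Suc i) k = \<delta>G (Suc i) k \<or>
           i \<noteq> 0 \<and> (\<exists>k'<rF i. \<delta> (Suc i) k = \<delta>F i k' + s)"
proof -
  let ?C = "{f. c * f \<in> J}"
  define K where "K = {a + c * b | a b. a \<in> J}"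
  obtain \<phi> where \<phi>: "\<And>i. lin (\<phi> i)" "\<phi> 0 = vscale c"
    and \<phi>u: "\<And>i k. k < rF i \<Longrightarrow> \<phi> i (unit_vec k) \<in> free_mod (rG i)"
    and \<phi>h: "\<And>i k. k < rF i \<Longrightarrow> hvec (\<delta>G i) (\<delta>F i k + s) (\<phi> i (unit_vec k))"
    and \<phi>c: "\<And>i v. v \<in> free_mod (rF (Suc i)) \<Longrightarrow> DG i (\<phi> (Suc i) v) - \<phi> i (DF i v) \<in> aug J i"
    by (rule aug_res_lift[OF F G C J c]) auto
  note lG = aug_res_lin[OF G] and lF = aug_res_lin[OF F]
  note linD = lin_add[OF lG] lin_add[OF lF] lin_add[OF \<phi>(1)] lin_diff[OF lG] lin_diff[OF lF] lin_diff[OF \<phi>(1)]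
    lin_uminus[OF lG] lin_uminus[OF lF] lin_uminus[OF \<phi>(1)] lin_zero[OF lG] lin_zero[OF lF] lin_zero[OF \<phi>(1)]
  have \<phi>f: "\<phi> i v \<in> free_mod (rG i)" if "v \<in> free_mod (rF i)" for i v
    using lin_free_mod[OF \<phi>(1) \<phi>u that] .
  have \<phi>c': "DG (Suc i) (\<phi> (Suc (Suc i)) v) = \<phi> (Suc i) (DF (Suc i) v)" if "v \<in> free_mod (rF (Suc (Suc i)))" for i v
    using \<phi>c[OF that] by simp
  have DDG: "DG i (DG (Suc i) v) \<in> aug J i" if "v \<in> free_mod (rG (Suc (Suc i)))" for i v
    using aug_res_cyc[OF G J that] by simp
  have DDF: "DF i (DF (Suc i) v) \<in> aug ?C i" if "v \<in> free_mod (rF (Suc (Suc i)))" for i v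
    using aug_res_cyc[OF F C that] by simp
  have subJ: "vs.subspace (aug J i)" for i using J by (auto simp: graded_ideal_def intro: subspace_aug)
  have cC: "vscale c v \<in> aug J 0 \<longleftrightarrow> v \<in> aug ?C 0" for v by (simp add: aug_def)
  have J0: "0 \<in> J" using vs.subspace_0[OF subJ, of 0] by (simp add: aug_def)
  have augK: "x + vscale c y \<in> aug K 0" if "x \<in> aug J 0" for x y
    using that by (auto simp: aug_def K_def lookup_add)
  \<comment> \<open>Position 0 of \<open>F\<close> is the ring itself and not a module of the
    resolution, so it contributes no summand to the cone.\<close>
  define t where "t i = (if i = 0 then 0 else rF i)" for i
  define r where "r i = (case i of 0 \<Rightarrow> rG 0 | Suc j \<Rightarrow> rG (Suc j) + t j)" for i
  define \<delta> where "\<delta> i k = (if k < rG i then \<delta>G i k else \<delta>F (i - 1) (k - rG i) + s)" for i k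
  \<comment> \<open>The cone differential sends (g, f) to (DG g + \<phi> f, - DF f). For
    \<open>i \<le> 1\<close> the target has no summand from \<open>F\<close>.\<close>
  define D where "D i v = DG i (fst_part (rG (Suc i)) v) + \<phi> i (snd_part (rG (Suc i)) v) +
     shift (rG i) (if i \<le> 1 then 0 else - DF (i - 1) (snd_part (rG (Suc i)) v))" for i v
  have r_Suc: "r (Suc i) = rG (Suc i) + t i" for i by (simp add: r_def)
  have lfs: "lin (\<lambda>v. DG i (fst_part R v))" "lin (\<lambda>v. \<phi> i (snd_part R v))" "lin (\<lambda>v. DF i (snd_part R v))" for i R
    using lin_compose[OF lin_parts(1) lG] lin_compose[OF lin_parts(2) \<phi>(1)] lin_compose[OF lin_parts(2) lF] by auto
  have linDi: "lin (D i)" for i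
  proof -
    have "lin (\<lambda>v. if i \<le> 1 then 0 else - DF (i - 1) (snd_part (rG (Suc i)) v))"
      using lin_sub[OF lin_null lfs(3)] by (cases "i \<le> 1") (simp_all add: lin_null)
    from lin_plus[OF lin_plus[OF lfs(1,2)] lin_compose[OF this lin_parts(3)]] show ?thesis
      by (simp add: D_def[abs_def])
  qed
  have D_eq: "D i (g + shift (rG (Suc i)) f) = DG i g + \<phi> i f + shift (rG i) (if i \<le> 1 then 0 else - DF (i - 1) f)"
    if "g \<in> free_mod (rG (Suc i))" for i g f
    using that by (simp add: D_def fst_part_add_shift snd_part_add_shift)
  have s0: "shift R 0 = 0" for R using lin_zero[OF lin_parts(3)] .
  have D0: "D 0 v = DG 0 v" if "v \<in> free_mod (rG 1)" for v
    using D_eq[of v 0 0] that by (simp add: s0 linD)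
  have D1: "D 1 (g + shift (rG 2) f) = DG 1 g + \<phi> 1 f" if "g \<in> free_mod (rG 2)" for g f
    using D_eq[of g 1 f] that by (simp add: s0 numeral_2_eq_2)
  have split: "\<exists>g f. g \<in> free_mod (rG (Suc i)) \<and> f \<in> free_mod (t i) \<and> v = g + shift (rG (Suc i)) f"
    if "v \<in> free_mod (r (Suc i))" for i v
    using that fst_part_free_mod snd_part_free_mod parts_eq[of "rG (Suc i)" v] unfolding r_Suc by metis
  have join: "g + shift (rG (Suc i)) f \<in> free_mod (r (Suc i))"
    if "g \<in> free_mod (rG (Suc i))" "f \<in> free_mod (t i)" for i g f
    unfolding r_Suc by (intro vs.subspace_add subspace_free_mod shift_free_mod that free_mod_mono[OF that(1)]) simp
  have "aug_res K r \<delta> D"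
    unfolding aug_res_def
  proof (intro conjI allI impI ballI)
    show "r 0 = 1" "\<delta> 0 0 = 0" using aug_res_0[OF G] by (simp_all add: r_def \<delta>_def)
    show "lin (D i)" for i by (rule linDi)
  next
    fix i k assume k: "k < r (Suc i)"
    obtain g f where gf: "D i (unit_vec k) = g + shift (rG i) f" "g \<in> free_mod (rG i)"
      "hvec (\<delta>G i) (\<delta> (Suc i) k) g" "f \<in> free_mod (if i = 0 then 0 else t (i - 1))"
      "hvec (\<delta>F (i - 1)) (\<delta> (Suc i) k - s) f"
    proof (cases "k < rG (Suc i)")
      case True
      have "D i (unit_vec k) = DG i (unit_vec k) + shift (rG i) 0"
        using D_eq[OF unit_vec_in_free_mod[OF True], of 0] by (simp add: s0 linD)
      then show ?thesis using that[of "DG i (unit_vec k)" 0] True aug_res_unit[OF G True] aug_res_hvec[OF G True]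
        by (simp add: \<delta>_def hvec_0 vs.subspace_0[OF subspace_free_mod])
    next
      case False
      define k' where "k' = k - rG (Suc i)"
      have k': "k' < t i" using k False by (auto simp: r_Suc k'_def)
      then have i: "i \<noteq> 0" and k'F: "k' < rF i" by (auto simp: t_def split: if_splits)
      have u: "unit_vec k = 0 + shift (rG (Suc i)) (unit_vec k')"
        using False by (simp add: shift_def k'_def)
      have Du: "D i (unit_vec k) = \<phi> i (unit_vec k') + shift (rG i) (if i \<le> 1 then 0 else - DF (i - 1) (unit_vec k'))"
        unfolding u using D_eq[of 0 i "unit_vec k'"] by (simp add: linD vs.subspace_0[OF subspace_free_mod])
      have dk: "\<delta> (Suc i) k = \<delta>F i k' + s" using False by (simp add: \<delta>_def k'_def)
      have "DF (i - 1) (unit_vec k') \<in> free_mod (rF (i - 1))" "hvec (\<delta>F (i - 1)) (\<delta>F i k') (DF (i - 1) (unit_vec k'))"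
        using aug_res_unit[OF F, of k' "i - 1"] aug_res_hvec[OF F, of k' "i - 1"] k'F i by auto
      then show ?thesis using that[OF Du \<phi>u[OF k'F]] \<phi>h[OF k'F] i
        by (auto simp: dk hvec_0 hvec_uminus t_def vs.subspace_0[OF subspace_free_mod] vs.subspace_neg[OF subspace_free_mod])
    qed
    show "D i (unit_vec k) \<in> free_mod (r i)"
      using join[of g "i - 1" f] gf by (cases i) (auto simp: gf(1) r_def free_mod_0 s0)
    have "hvec (\<lambda>l. if l < rG i then \<delta>G i l else \<delta>F (i - 1) (l - rG i) + s) (\<delta> (Suc i) k) (g + shift (rG i) f)"
      using gf by (intro hvec_add_shift)
    then show "hvec (\<delta> i) (\<delta> (Suc i) k) (D i (unit_vec k))"
      by (simp add: gf(1) \<delta>_def[abs_def])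
  next
    fix i and v :: "nat \<Rightarrow>\<^sub>0 ('x, 'k) mpoly" assume v: "v \<in> free_mod (r i)"
    consider "i = 0" | "i = 1" | j where "i = Suc (Suc j)" by (metis One_nat_def not0_implies_Suc)
    then show "cyc K D i v \<longleftrightarrow> (\<exists>w\<in>free_mod (r (Suc i)). D i w - v \<in> aug K i)"
    proof cases
      case 1
      then obtain w where w: "w \<in> free_mod (rG 1)" "DG 0 w - v \<in> aug J 0"
        using v aug_res_exact[OF G, of v 0] by (auto simp: r_def)
      then have "D 0 w - v \<in> aug K 0" using augK[of _ 0] D0 by simp
      then show ?thesis using 1 w(1) by (auto simp: r_def t_def)
    next
      case 2
      then have v: "v \<in> free_mod (rG 1)" using v by (simp add: r_def t_def)
      show ?thesis unfolding 2
      proof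
        assume "cyc K D 1 v"
        then have "DG 0 v \<in> aug K 0" using D0[OF v] by simp
        then have "lookup (DG 0 v) 0 \<in> K" by (simp add: aug_def)
        then obtain a b where ab: "a \<in> J" "lookup (DG 0 v) 0 = a + c * b" by (auto simp: K_def)
        have DGv: "DG 0 v \<in> free_mod 1" using aug_res_free_mod[OF G, of v 0] v aug_res_0[OF G] by simp
        \<comment> \<open>Modulo \<open>J\<close>, the part \<open>c * b\<close> of
          \<open>DG 0 v\<close> is the image of \<open>\<phi> 1 f\<close> for an \<open>f\<close>
          over \<open>b\<close>; subtracting \<open>\<phi> 1 f\<close> from \<open>v\<close> leaves
          a cycle of \<open>G\<close>.\<close>
        let ?b = "vscale b (unit_vec 0)"
        have "DG 0 v - vscale c ?b \<in> aug J 0"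
          using ab J0 lookup_free_mod[OF DGv] by (auto simp: aug_def lookup_minus lookup_unit_vec)
        moreover have "?b \<in> free_mod (rF 0)"
          using aug_res_0[OF F] by (intro vs.subspace_scale subspace_free_mod unit_vec_in_free_mod) simp
        then obtain f where f: "f \<in> free_mod (rF 1)" "DF 0 f - ?b \<in> aug ?C 0"
          using aug_res_exact[OF F, of ?b 0] by auto
        then have "vscale c (DF 0 f - ?b) \<in> aug J 0" using cC by blast
        moreover have "DG 0 (\<phi> 1 f) - vscale c (DF 0 f) \<in> aug J 0" using \<phi>c[of f 0] f(1) \<phi>(2) by simp
        ultimately have "(DG 0 v - vscale c ?b) - vscale c (DF 0 f - ?b) - (DG 0 (\<phi> 1 f) - vscale c (DF 0 f)) \<in> aug J 0"
          by (rule vs.subspace_diff[OF subJ vs.subspace_diff[OF subJ]])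
        then have "cyc J DG 1 (v - \<phi> 1 f)" by (simp add: linD vs.scale_right_diff_distrib)
        moreover have "v - \<phi> 1 f \<in> free_mod (rG 1)" using v \<phi>f[OF f(1)] by (intro vs.subspace_diff subspace_free_mod)
        ultimately obtain g where g: "g \<in> free_mod (rG 2)" "DG 1 g = v - \<phi> 1 f"
          using aug_res_exact[OF G, of "v - \<phi> 1 f" 1] by (auto simp: numeral_2_eq_2)
        have "g + shift (rG 2) f \<in> free_mod (r 2)"
          using join[of g 1 f] g(1) f(1) by (simp add: numeral_2_eq_2 t_def)
        then show "\<exists>w\<in>free_mod (r (Suc 1)). D 1 w - v \<in> aug K 1"
          using D1[OF g(1), of f] g(2) by (intro bexI[of _ "g + shift (rG 2) f"]) (simp_all add: numeral_2_eq_2)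
      next
        assume "\<exists>w\<in>free_mod (r (Suc 1)). D 1 w - v \<in> aug K 1"
        then obtain w where "w \<in> free_mod (r (Suc 1))" "D 1 w = v" by auto
        then obtain g f where g: "g \<in> free_mod (rG 2)" and f: "f \<in> free_mod (rF 1)" and w: "v = DG 1 g + \<phi> 1 f"
          using split[of w 1] D1 by (auto simp: numeral_2_eq_2 t_def)
        have "DG 0 (DG 1 g) \<in> aug J 0" using DDG[of g 0] g by (simp add: numeral_2_eq_2)
        moreover have "DG 0 (\<phi> 1 f) - vscale c (DF 0 f) \<in> aug J 0" using \<phi>c[of f 0] f \<phi>(2) by simp
        ultimately have "DG 0 (DG 1 g) + (DG 0 (\<phi> 1 f) - vscale c (DF 0 f)) \<in> aug J 0"
          by (rule vs.subspace_add[OF subJ])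
        from augK[OF this, of "DF 0 f"] have "DG 0 v \<in> aug K 0" by (simp add: w linD add.assoc)
        then show "cyc K D 1 v" using D0[OF v] by simp
      qed
    next
      case (3 j)
      obtain g f where g: "g \<in> free_mod (rG (Suc (Suc j)))" and f: "f \<in> free_mod (rF (Suc j))"
        and vgf: "v = g + shift (rG (Suc (Suc j))) f"
        using split[of v "Suc j"] v 3 by (auto simp: t_def)
      have Dv: "D (Suc j) v = DG (Suc j) g + \<phi> (Suc j) f + shift (rG (Suc j)) (if j = 0 then 0 else - DF j f)"
        using D_eq[OF g] by (simp add: vgf)
      have g1: "DG (Suc j) g + \<phi> (Suc j) f \<in> free_mod (rG (Suc j))"
        using aug_res_free_mod[OF G g] \<phi>f[OF f] by (intro vs.subspace_add subspace_free_mod)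
      show ?thesis unfolding 3
      proof
        assume "cyc K D (Suc (Suc j)) v"
        then have "D (Suc j) v = 0" by simp
        then have "DG (Suc j) g + \<phi> (Suc j) f + shift (rG (Suc j)) (if j = 0 then 0 else - DF j f) =
            0 + shift (rG (Suc j)) 0" by (simp add: Dv s0)
        from add_shift_eqD[OF this g1 vs.subspace_0[OF subspace_free_mod]]
        have a: "DG (Suc j) g + \<phi> (Suc j) f = 0" and b: "j \<noteq> 0 \<Longrightarrow> DF j f = 0" by simp_all
        \<comment> \<open>For \<open>j = 0\<close> the cone differential forgets
          \<open>DF 0 f\<close>. That it lies in the colon ideal follows from \<open>a\<close>,
          since \<open>c * DF 0 f\<close> agrees modulo \<open>J\<close> with the image of
          \<open>\<phi> 1 f\<close>.\<close>
        have "DF j f \<in> aug ?C j"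
        proof (cases j)
          case 0
          have "\<phi> 1 f = - DG 1 g" using a 0 by (simp add: eq_neg_iff_add_eq_0 add.commute)
          then have "DG 0 (\<phi> 1 f) = - DG 0 (DG 1 g)" by (simp add: linD)
          then have "DG 0 (\<phi> 1 f) \<in> aug J 0"
            using DDG[of g 0] g 0 vs.subspace_neg[OF subJ] by simp
          from vs.subspace_diff[OF subJ this \<phi>c[of f 0]] have "vscale c (DF 0 f) \<in> aug J 0"
            using f 0 \<phi>(2) by simp
          then show ?thesis using cC 0 by simp
        qed (use b in simp)
        then have "cyc ?C DF (Suc j) f" by simp
        then obtain f' where f': "f' \<in> free_mod (rF (Suc (Suc j)))" "DF (Suc j) f' = f"
          using aug_res_exact[OF F f] by auto
        have g': "g + \<phi> (Suc (Suc j)) f' \<in> free_mod (rG (Suc (Suc j)))"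
          using g \<phi>f[OF f'(1)] by (intro vs.subspace_add subspace_free_mod)
        have "DG (Suc j) (g + \<phi> (Suc (Suc j)) f') = 0"
          using a \<phi>c'[OF f'(1)] f'(2) by (simp add: linD)
        then have "cyc J DG (Suc (Suc j)) (g + \<phi> (Suc (Suc j)) f')"
          using vs.subspace_0[OF subJ] by simp
        then obtain g2 where g2: "g2 \<in> free_mod (rG (Suc (Suc (Suc j))))" "DG (Suc (Suc j)) g2 = g + \<phi> (Suc (Suc j)) f'"
          using aug_res_exact[OF G g'] by auto
        \<comment> \<open>The sign of \<open>f'\<close> matches the sign of \<open>DF\<close> in the
          cone differential and cancels the term \<open>\<phi> f'\<close> in the image of
          \<open>g2\<close>.\<close>
        have "D (Suc (Suc j)) (g2 + shift (rG (Suc (Suc (Suc j)))) (- f')) = v"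
          unfolding D_eq[OF g2(1)] by (simp add: linD g2(2) f'(2) vgf)
        moreover have "g2 + shift (rG (Suc (Suc (Suc j)))) (- f') \<in> free_mod (r (Suc (Suc (Suc j))))"
          using f'(1) by (intro join g2(1)) (simp add: t_def vs.subspace_neg[OF subspace_free_mod])
        ultimately show "\<exists>w\<in>free_mod (r (Suc (Suc (Suc j)))). D (Suc (Suc j)) w - v \<in> aug K (Suc (Suc j))"
          by (metis aug_Suc diff_self singletonI)
      next
        assume "\<exists>w\<in>free_mod (r (Suc (Suc (Suc j)))). D (Suc (Suc j)) w - v \<in> aug K (Suc (Suc j))"
        then obtain w where "w \<in> free_mod (r (Suc (Suc (Suc j))))" "D (Suc (Suc j)) w = v" by auto
        then obtain g' f' where g': "g' \<in> free_mod (rG (Suc (Suc (Suc j))))" and f': "f' \<in> free_mod (rF (Suc (Suc j)))"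
          and v': "v = DG (Suc (Suc j)) g' + \<phi> (Suc (Suc j)) f' + shift (rG (Suc (Suc j))) (- DF (Suc j) f')"
          using split[of w "Suc (Suc j)"] D_eq by (auto simp: t_def)
        have "DG (Suc (Suc j)) g' + \<phi> (Suc (Suc j)) f' \<in> free_mod (rG (Suc (Suc j)))"
          using aug_res_free_mod[OF G g'] \<phi>f[OF f'] by (intro vs.subspace_add subspace_free_mod)
        from add_shift_eqD[OF trans[OF vgf[symmetric] v'] g this]
        have gf: "g = DG (Suc (Suc j)) g' + \<phi> (Suc (Suc j)) f'" "f = - DF (Suc j) f'" .
        have "DG (Suc j) (DG (Suc (Suc j)) g') = 0" using DDG[OF g'] by simp
        moreover have "j \<noteq> 0 \<Longrightarrow> DF j (DF (Suc j) f') = 0" using DDF[OF f'] by (cases j) auto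
        ultimately have "D (Suc j) v = 0" unfolding Dv by (auto simp: gf linD \<phi>c'[OF f'] s0)
        then show "cyc K D (Suc (Suc j)) v" by simp
      qed
    qed
  qed
  then show ?thesis
  proof (rule that[unfolded K_def[symmetric]])
    show "r (Suc i) = rG (Suc i) + (if i = 0 then 0 else rF i)" for i by (simp add: r_Suc t_def)
    fix i k assume k: "k < r (Suc i)"
    show "k < rG (Suc i) \<and> \<delta> (Suc i) k = \<delta>G (Suc i) k \<or> i \<noteq> 0 \<and> (\<exists>k'<rF i. \<delta> (Suc i) k = \<delta>F i k' + s)"
    proof (cases "k < rG (Suc i)")
      case False
      then have "k - rG (Suc i) < t i" "\<delta> (Suc i) k = \<delta>F i (k - rG (Suc i)) + s"
        using k by (auto simp: r_Suc \<delta>_def)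
      then show ?thesis by (auto simp: t_def split: if_splits)
    qed (simp add: \<delta>_def)
  qed
qed

section \<open>Squarefree monomial ideals\<close>

definition sqfree_mono :: "'x set \<Rightarrow> ('x \<Rightarrow>\<^sub>0 nat)" where
  "sqfree_mono g = (\<Sum>v\<in>g. single v 1)"

text \<open>The ideal generated by the monomials \<open>\<Prod>v\<in>g. x\<^sub>v\<close>, \<open>g \<in> \<G>\<close>.\<close>

definition sqfree_ideal :: "'x set set \<Rightarrow> ('x, 'k::comm_ring_1) mpoly set" where
  "sqfree_ideal \<G> = {f. \<forall>t\<in>keys f. \<exists>g\<in>\<G>. g \<subseteq> keys t}"

lemma lookup_sqfree_mono: "finite g \<Longrightarrow> lookup (sqfree_mono g) v = (if v \<in> g then 1 else 0)"
  by (simp add: sqfree_mono_def lookup_sum lookup_single when_def)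

lemma keys_sqfree_mono: "finite g \<Longrightarrow> keys (sqfree_mono g) = g"
  by (auto simp: in_keys_iff lookup_sqfree_mono split: if_splits)

lemma mono_deg_sqfree_mono: "finite g \<Longrightarrow> mono_deg (sqfree_mono g) = card g"
  by (simp add: mono_deg_def keys_sqfree_mono lookup_sqfree_mono)

lemma keys_add_nat: "keys (s + t) = keys s \<union> keys (t :: 'x \<Rightarrow>\<^sub>0 nat)"
  by (auto simp: in_keys_iff lookup_add)

lemma lookup_single_mult: "lookup (single s a * f) (s + t) = a * lookup (f :: ('x, 'k::comm_ring_1) mpoly) t"
  by (induction f rule: mpoly_induct) (auto simp: mult_single lookup_single when_def distrib_left lookup_add)

lemma keys_single_mult: "keys (single s 1 * f) = (+) s ` keys (f :: ('x, 'k::comm_ring_1) mpoly)"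
proof
  show "keys (single s 1 * f) \<subseteq> (+) s ` keys f"
    using keys_mult[of "single s 1" f] by (auto split: if_splits)
  show "(+) s ` keys f \<subseteq> keys (single s 1 * f)"
    by (auto simp: in_keys_iff lookup_single_mult)
qed

lemma graded_ideal_sqfree: "graded_ideal (sqfree_ideal \<G> :: ('x, 'k::comm_ring_1) mpoly set)"
proof -
  interpret R: module "(*) :: ('x, 'k) mpoly \<Rightarrow> _ \<Rightarrow> _" by (rule module_times)
  show ?thesis
    unfolding graded_ideal_def R.subspace_def sqfree_ideal_def
  proof (intro conjI ballI allI; clarify?)
    fix f g :: "('x, 'k) mpoly" and t
    assume f: "\<forall>t\<in>keys f. \<exists>g\<in>\<G>. g \<subseteq> keys t" and g: "\<forall>t\<in>keys g. \<exists>g\<in>\<G>. g \<subseteq> keys t" and "t \<in> keys (f + g)"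
    then show "\<exists>g\<in>\<G>. g \<subseteq> keys t" using keys_add[of f g] by blast
  next
    fix c f :: "('x, 'k) mpoly" and t
    assume f: "\<forall>t\<in>keys f. \<exists>g\<in>\<G>. g \<subseteq> keys t" and "t \<in> keys (c * f)"
    then obtain s s' where "s' \<in> keys f" "t = s + s'" using keys_mult[of c f] by blast
    moreover obtain g where "g \<in> \<G>" "g \<subseteq> keys s'" using f calculation(1) by blast
    ultimately show "\<exists>g\<in>\<G>. g \<subseteq> keys t" by (auto simp: keys_add_nat)
  next
    fix f :: "('x, 'k) mpoly" and n t
    assume f: "\<forall>t\<in>keys f. \<exists>g\<in>\<G>. g \<subseteq> keys t" and "t \<in> keys (hpart n f)"
    then show "\<exists>g\<in>\<G>. g \<subseteq> keys t" by (simp add: in_keys_iff lookup_hpart)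
  qed simp
qed

text \<open>Membership depends on supports alone. Multiplication by the monomial of \<open>m\<close>
  adds \<open>m\<close> to the support of a term, and the enlarged support contains \<open>g\<close>
  iff the old one contains \<open>g - m\<close>.\<close>

lemma sqfree_ideal_colon:
  assumes "finite m"
  shows "{f. single (sqfree_mono m) 1 * f \<in> sqfree_ideal \<G>} =
    (sqfree_ideal ((\<lambda>g. g - m) ` \<G>) :: ('x, 'k::comm_ring_1) mpoly set)"
  by (auto simp: sqfree_ideal_def keys_single_mult keys_add_nat keys_sqfree_mono[OF assms] Diff_subset_conv)

lemma sqfree_ideal_insert:
  assumes "finite m"
  shows "{a + single (sqfree_mono m) 1 * b | a b. a \<in> sqfree_ideal \<G>} =
    (sqfree_ideal (insert m \<G>) :: ('x, 'k::comm_ring_1) mpoly set)"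
proof (intro subset_antisym subsetI)
  fix f :: "('x, 'k) mpoly" assume "f \<in> {a + single (sqfree_mono m) 1 * b | a b. a \<in> sqfree_ideal \<G>}"
  then obtain a b where f: "f = a + single (sqfree_mono m) 1 * b" "a \<in> sqfree_ideal \<G>" by auto
  show "f \<in> sqfree_ideal (insert m \<G>)" unfolding sqfree_ideal_def
  proof (intro CollectI ballI)
    fix t assume "t \<in> keys f"
    then consider "t \<in> keys a" | "t \<in> keys (single (sqfree_mono m) 1 * b)"
      using keys_add[of a "single (sqfree_mono m) 1 * b"] f(1) by blast
    then show "\<exists>g\<in>insert m \<G>. g \<subseteq> keys t"
      by cases (use f(2) in \<open>auto simp: sqfree_ideal_def keys_single_mult keys_add_nat keys_sqfree_mono[OF assms]\<close>)
  qed
next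
  fix f :: "('x, 'k) mpoly" assume f: "f \<in> sqfree_ideal (insert m \<G>)"
  let ?m = "sqfree_mono m"
  have inj: "inj ((+) ?m)" by simp
  \<comment> \<open>\<open>b\<close> collects the terms divisible by the monomial of
    \<open>m\<close>, with that monomial cancelled; no term of the remainder \<open>a\<close> has
    \<open>m\<close> in its support.\<close>
  define b where "b = Poly_Mapping.map_key ((+) ?m) f"
  have b: "lookup b t = lookup f (?m + t)" for t
    by (simp add: b_def map_key.rep_eq[OF inj])
  define a where "a = f - single ?m 1 * b"
  have "\<exists>g\<in>\<G>. g \<subseteq> keys t" if t: "t \<in> keys a" for t
  proof -
    have nm: "\<not> m \<subseteq> keys t"
    proof
      assume "m \<subseteq> keys t"
      then have "t = ?m + (t - ?m)"
        by (intro poly_mapping_eqI) (auto simp: lookup_add lookup_minus lookup_sqfree_mono[OF assms] in_keys_iff subset_iff Suc_le_eq)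
      then obtain t' where "t = ?m + t'" by blast
      then have "lookup a t = 0" by (simp add: a_def lookup_minus lookup_single_mult b)
      then show False using t by (simp add: in_keys_iff)
    qed
    then have "t \<notin> keys (single ?m 1 * b)"
      by (auto simp: keys_single_mult keys_add_nat keys_sqfree_mono[OF assms])
    then have "t \<in> keys f" using t by (auto simp: a_def in_keys_iff lookup_minus)
    then show ?thesis using f nm by (auto simp: sqfree_ideal_def)
  qed
  then have "a \<in> sqfree_ideal \<G>" by (simp add: sqfree_ideal_def)
  moreover have "f = a + single ?m 1 * b" by (simp add: a_def)
  ultimately show "f \<in> {a + single ?m 1 * b | a b. a \<in> sqfree_ideal \<G>}" by blast
qed

text \<open>\<open>n\<close> bounds the length, \<open>\<rho>\<close> the excess of generator
  degrees over the homological degree. The lower bound \<open>int i\<close> serves to make the set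
  whose maximum is the regularity finite.\<close>

definition bounded_res :: "('x, 'k::comm_ring_1) mpoly set \<Rightarrow> nat \<Rightarrow> int \<Rightarrow> bool" where
  "bounded_res I n \<rho> \<longleftrightarrow> (\<exists>r \<delta> D. aug_res I r \<delta> D \<and> (\<forall>i>n. r (Suc i) = 0) \<and>
     (\<forall>i. \<forall>k<r (Suc i). int i \<le> \<delta> (Suc i) k \<and> \<delta> (Suc i) k \<le> int i + \<rho>))"

lemma bounded_res_zero:
  assumes "0 \<le> \<rho>" shows "bounded_res ({0} :: ('x, 'k::comm_ring_1) mpoly set) n \<rho>"
  unfolding bounded_res_def
proof (intro exI conjI)
  define r :: "nat \<Rightarrow> nat" where "r i = (if i \<le> 1 then 1 else 0)" for i
  define D :: "nat \<Rightarrow> (nat \<Rightarrow>\<^sub>0 ('x, 'k) mpoly) \<Rightarrow> _" where "D i = (if i = 0 then (\<lambda>v. v) else (\<lambda>v. 0))" for i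
  show "\<forall>i>n. r (Suc i) = 0" by (simp add: r_def)
  show "\<forall>i. \<forall>k<r (Suc i). int i \<le> (\<lambda>i k. 0) (Suc i) k \<and> (\<lambda>i k. 0) (Suc i) k \<le> int i + \<rho>"
    using assms by (simp add: r_def)
  have aug: "aug {0} i = {0 :: nat \<Rightarrow>\<^sub>0 ('x, 'k) mpoly}" for i
    by (auto simp: aug_def poly_mapping_eq_iff fun_eq_iff)
  show "aug_res {0} r (\<lambda>i k. 0) D"
    unfolding aug_res_def
  proof (intro conjI allI impI ballI)
    show "lin (D i)" for i by (simp add: D_def lin_ident lin_null)
    fix i k assume "k < r (Suc i)"
    then show "D i (unit_vec k) \<in> free_mod (r i)" "hvec (\<lambda>k. 0) 0 (D i (unit_vec k))"
      by (auto simp: r_def D_def hvec_def lookup_unit_vec homogeneous_1 split: if_splits intro!: unit_vec_in_free_mod)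
  next
    fix i and v :: "nat \<Rightarrow>\<^sub>0 ('x, 'k) mpoly" assume "v \<in> free_mod (r i)"
    then show "cyc {0} D i v \<longleftrightarrow> (\<exists>w\<in>free_mod (r (Suc i)). D i w - v \<in> aug {0} i)"
      by (auto simp: cyc_def aug D_def r_def free_mod_0 split: nat.splits if_splits)
  qed (simp_all add: r_def)
qed

text \<open>Homological degree \<open>i - 1\<close> of the colon resolution lands in degree
  \<open>i\<close> of the cone, with internal degrees raised by \<open>card m\<close>. This accounts
  for \<open>Suc nF\<close>, for the \<open>+ 1\<close> after \<open>\<rho>\<close>, and for
  \<open>1 \<le> card m\<close>, which keeps the degrees at least \<open>i\<close>.\<close>

lemma bounded_res_insert:
  fixes \<G> :: "'x set set"
  assumes m: "finite m" and G: "bounded_res (sqfree_ideal \<G> :: ('x, 'k::comm_ring_1) mpoly set) nG \<rho>G"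
    and F: "bounded_res (sqfree_ideal ((\<lambda>g. g - m) ` \<G>) :: ('x, 'k) mpoly set) nF \<rho>F"
    and n: "nG \<le> n" "Suc nF \<le> n" and \<rho>: "\<rho>G \<le> \<rho>" "\<rho>F + int (card m) \<le> \<rho> + 1" and "1 \<le> card m"
  shows "bounded_res (sqfree_ideal (insert m \<G>) :: ('x, 'k) mpoly set) n \<rho>"
proof -
  let ?J = "sqfree_ideal \<G> :: ('x, 'k) mpoly set" let ?c = "single (sqfree_mono m) 1 :: ('x, 'k) mpoly"
  obtain rG \<delta>G DG where G: "aug_res ?J rG \<delta>G DG" and G0: "\<And>i. i > nG \<Longrightarrow> rG (Suc i) = 0"
    and Gd: "\<And>i k. k < rG (Suc i) \<Longrightarrow> int i \<le> \<delta>G (Suc i) k \<and> \<delta>G (Suc i) k \<le> int i + \<rho>G"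
    using G unfolding bounded_res_def by blast
  obtain rF \<delta>F DF where F: "aug_res {f. ?c * f \<in> ?J} rF \<delta>F DF" and F0: "\<And>i. i > nF \<Longrightarrow> rF (Suc i) = 0"
    and Fd: "\<And>i k. k < rF (Suc i) \<Longrightarrow> int i \<le> \<delta>F (Suc i) k \<and> \<delta>F (Suc i) k \<le> int i + \<rho>F"
    using F unfolding bounded_res_def sqfree_ideal_colon[OF m] by blast
  have c: "homogeneous (int (card m)) ?c"
    by (simp add: homogeneous_def mono_deg_sqfree_mono[OF m])
  have C: "graded_ideal {f. ?c * f \<in> ?J}"
    unfolding sqfree_ideal_colon[OF m] by (rule graded_ideal_sqfree)
  obtain r \<delta> D where D: "aug_res (sqfree_ideal (insert m \<G>) :: ('x, 'k) mpoly set) r \<delta> D"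
    and r: "\<And>i. r (Suc i) = rG (Suc i) + (if i = 0 then 0 else rF i)"
    and \<delta>: "\<And>i k. k < r (Suc i) \<Longrightarrow> k < rG (Suc i) \<and> \<delta> (Suc i) k = \<delta>G (Suc i) k \<or>
           i \<noteq> 0 \<and> (\<exists>k'<rF i. \<delta> (Suc i) k = \<delta>F i k' + int (card m))"
    by (rule aug_res_cone[OF F G C graded_ideal_sqfree c, unfolded sqfree_ideal_insert[OF m]]) (rule that)
  have "r (Suc i) = 0" if "i > n" for i
    using G0[of i] F0[of "i - 1"] n that by (auto simp: r)
  moreover have "int i \<le> \<delta> (Suc i) k \<and> \<delta> (Suc i) k \<le> int i + \<rho>" if k: "k < r (Suc i)" for i k
    using \<delta>[OF k]
  proof
    assume "k < rG (Suc i) \<and> \<delta> (Suc i) k = \<delta>G (Suc i) k"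
    then show ?thesis using Gd[of k i] \<rho>(1) by auto
  next
    assume "i \<noteq> 0 \<and> (\<exists>k'<rF i. \<delta> (Suc i) k = \<delta>F i k' + int (card m))"
    then obtain k' j where "i = Suc j" "k' < rF (Suc j)" "\<delta> (Suc i) k = \<delta>F (Suc j) k' + int (card m)"
      by (cases i) auto
    then show ?thesis using Fd[of k' j] \<rho>(2) \<open>1 \<le> card m\<close> by auto
  qed
  ultimately show ?thesis using D unfolding bounded_res_def by blast
qed

lemma sqfree_ideal_redundant:
  assumes "h \<in> \<G>" "h \<subseteq> m" shows "sqfree_ideal (insert m \<G>) = sqfree_ideal \<G>"
  using assms unfolding sqfree_ideal_def by (auto; blast)

text \<open>
  The disjoint generators \<open>C\<close> are adjoined first, the others, among which \<open>m\<close>, afterwards: then the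
  sets \<open>g - m\<close> with \<open>g \<in> C\<close> are again disjoint, and they lie in \<open>V - m\<close>.
\<close>

lemma bounded_res_sqfree:
  fixes \<G> :: "'x set set"
  assumes "finite V" and "\<G> \<subseteq> Pow V" and "1 \<le> d" and "\<And>g. g \<in> \<G> \<Longrightarrow> d \<le> card g"
    and "C \<subseteq> \<G>" and "disjoint C"
  shows "bounded_res (sqfree_ideal \<G> :: ('x, 'k::comm_ring_1) mpoly set) (card V + 1 - d) (int (card V) - int (card C))"
  using assms
proof (induction "card \<G>" arbitrary: \<G> V d C rule: less_induct)
  case less
  note V = \<open>finite V\<close> and GV = \<open>\<G> \<subseteq> Pow V\<close> and disj = \<open>disjoint C\<close>
  have finG: "finite \<G>" using GV V finite_subset by blast
  have fin: "finite g" if "g \<in> \<G>" for g using GV V that finite_subset by blast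
  have ne: "1 \<le> card g" if "g \<in> \<G>" for g using less.prems(3,4) that by force
  show ?case
  proof (cases "\<G> = {}")
    case True
    then show ?thesis using less.prems(5) bounded_res_zero[of "int (card V)"] by (simp add: sqfree_ideal_def)
  next
    case False
    obtain m where m: "m \<in> \<G>" and mC: "\<G> \<noteq> C \<Longrightarrow> m \<notin> C" using False less.prems(5) by blast
    let ?H = "\<G> - {m}" let ?C = "C - {m}"
    have H: "insert m ?H = \<G>" using m by blast
    have card: "card ?H < card \<G>" using card_Diff1_less[OF finG m] .
    have mV: "m \<subseteq> V" using m GV by blast
    then have cmV: "card m \<le> card V" using V card_mono by blast
    have finC: "finite C" using finG less.prems(5) finite_subset by blast
    show ?thesis
    \<comment> \<open>A generator containing another one is redundant. Once this is excluded all
      \<open>g - m\<close> are nonempty, and the colon ideal satisfies the hypotheses with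
      \<open>d = 1\<close>.\<close>
    proof (cases "\<exists>h\<in>?H. h \<subseteq> m")
      case True
      then obtain h where h: "h \<in> ?H" "h \<subseteq> m" by blast
      have "m \<notin> C"
      proof
        assume "m \<in> C"
        then have "\<G> = C" using mC by blast
        then have "h \<inter> m = {}" using h(1) m disj by (auto simp: disjoint_def)
        then show False using h ne[of h] by (auto simp: Int_absorb2)
      qed
      then have "bounded_res (sqfree_ideal ?H :: ('x, 'k) mpoly set) (card V + 1 - d) (int (card V) - int (card C))"
        using less.prems by (intro less.hyps[OF card]) auto
      then show ?thesis using sqfree_ideal_redundant[OF h] H by metis
    next
      case nsub: False
      let ?F = "(\<lambda>g. g - m) ` ?H" let ?D = "(\<lambda>g. g - m) ` ?C"
      have cardV: "card (V - m) = card V - card m" using mV V by (simp add: card_Diff_subset finite_subset)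
      have cardF: "card ?F < card \<G>"
        using card card_image_le[of ?H "\<lambda>g. g - m"] finG by simp
      have neF: "1 \<le> card g" if "g \<in> ?F" for g
        using that nsub fin by (auto simp: Suc_le_eq card_gt_0_iff)
      have injC: "inj_on (\<lambda>g. g - m) ?C"
      proof (rule inj_onI)
        fix g h assume gh: "g \<in> ?C" "h \<in> ?C" "g - m = h - m"
        then have "g - m \<noteq> {}" using nsub less.prems(5) by blast
        then have "g \<inter> h \<noteq> {}" using gh(3) by blast
        then show "g = h" using disj gh by (auto simp: disjoint_def)
      qed
      have F: "bounded_res (sqfree_ideal ?F :: ('x, 'k) mpoly set) (card V - card m) (int (card V) - int (card m) - int (card ?C))"
      proof -
        have "disjoint ?D" using disj by (fastforce simp: disjoint_def)
        moreover have "?D \<subseteq> ?F" using less.prems(5) by blast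
        ultimately have "bounded_res (sqfree_ideal ?F :: ('x, 'k) mpoly set) (card (V - m) + 1 - 1) (int (card (V - m)) - int (card ?D))"
          using GV V neF by (intro less.hyps[OF cardF]) auto
        then show ?thesis using cmV by (simp add: cardV card_image[OF injC] of_nat_diff)
      qed
      have "d \<le> card m" using less.prems(4) m by blast
      show ?thesis
      proof (cases "m \<in> C")
        case True
        then have GC: "\<G> = C" using mC by blast
        have cC: "int (card ?C) = int (card C) - 1" using True finC
          by (simp add: card_Diff_singleton) (metis One_nat_def Suc_leI card_gt_0_iff empty_iff of_nat_1 of_nat_diff)
        \<comment> \<open>With \<open>V\<close> itself the induction hypothesis would lose one, as
          \<open>?C\<close> has one set fewer than \<open>C\<close>. All other generators avoid
          \<open>m\<close>, so \<open>V - m\<close> can replace \<open>V\<close>, which gains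
          \<open>card m\<close>.\<close>
        have "g \<inter> m = {}" if "g \<in> ?H" for g using disjointD[OF disj, of g m] that m GC by blast
        then have "?H \<subseteq> Pow (V - m)" using GV by blast
        then have "bounded_res (sqfree_ideal ?H :: ('x, 'k) mpoly set) (card (V - m) + 1 - d) (int (card (V - m)) - int (card ?C))"
          using V less.prems pairwise_subset[OF disj] by (intro less.hyps[OF card]) (auto simp: GC)
        from bounded_res_insert[OF fin[OF m] this F, unfolded H, of "card V + 1 - d" "int (card V) - int (card C)"]
        show ?thesis using ne[OF m] cmV \<open>d \<le> card m\<close> by (simp add: cardV cC of_nat_diff)
      next
        case False
        then have "bounded_res (sqfree_ideal ?H :: ('x, 'k) mpoly set) (card V + 1 - d) (int (card V) - int (card C))"
          using less.prems by (intro less.hyps[OF card]) auto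
        from bounded_res_insert[OF fin[OF m] this F, unfolded H, of "card V + 1 - d" "int (card V) - int (card C)"]
        show ?thesis using ne[OF m] cmV \<open>d \<le> card m\<close> False by simp
      qed
    qed
  qed
qed

section \<open>Graded free resolutions and augmented resolutions\<close>

text \<open>\<open>module_map_on\<close> says nothing about \<open>d\<close> outside
  \<open>free_mod r\<close>, whereas \<open>aug_res\<close> asks for maps linear everywhere; cutting
  off after \<open>r\<close> basis vectors provides one.\<close>

lemma module_map_on_eq_vextend:
  assumes d: "module_map_on (free_mod r) N d" and "v \<in> free_mod r"
  shows "vextend (\<lambda>k. if k < r then d (unit_vec k) else 0) v = d v"
  using assms(2)
proof (induction rule: free_mod_induct)
  case zero
  have "0 \<in> free_mod r" by (rule vs.subspace_0[OF subspace_free_mod])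
  then have "d (0 + 0) = d 0 + d 0" using d unfolding module_map_on_def by blast
  then show ?case by (simp add: vextend_def)
next
  case (unit a k x)
  have u: "unit_vec k \<in> free_mod r" using unit(1) by (rule unit_vec_in_free_mod)
  then have "vscale a (unit_vec k) \<in> free_mod r" by (rule vs.subspace_scale[OF subspace_free_mod])
  then have "d (vscale a (unit_vec k) + x) = d (vscale a (unit_vec k)) + d x"
    using d unit(2) unfolding module_map_on_def by blast
  moreover have "d (vscale a (unit_vec k)) = vscale a (d (unit_vec k))"
    using d u unfolding module_map_on_def by blast
  ultimately have "d (vscale a (unit_vec k) + x) = vscale a (d (unit_vec k)) + d x" by simp
  then show ?case using unit by (simp add: lin_add[OF lin_vextend] lin_scale[OF lin_vextend])
qed

text \<open>\<open>e\<close> is linear only modulo \<open>I\<close>. Representatives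
  \<open>f k\<close> of its values on the basis define a genuinely linear augmentation into
  \<open>free_mod 1\<close>.\<close>

lemma module_map_to_quotient_eq_vextend:
  fixes I :: "'a::comm_ring_1 set"
  assumes I: "module.subspace (*) I" and e: "module_map_to_quotient I (free_mod r) e"
    and f: "\<And>k. k < r \<Longrightarrow> e (unit_vec k) - f k \<in> I" and "v \<in> free_mod r"
  shows "e v - lookup (vextend (\<lambda>k. if k < r then single 0 (f k) else 0) v) 0 \<in> I"
  using assms(4)
proof (induction rule: free_mod_induct)
  interpret I: module "(*) :: 'a \<Rightarrow> 'a \<Rightarrow> 'a" by (rule module_times)
  let ?E = "vextend (\<lambda>k. if k < r then single 0 (f k) else 0)"
  {
    case zero
    have "0 \<in> free_mod r" by (rule vs.subspace_0[OF subspace_free_mod])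
    then have "e (0 + 0) - (e 0 + e 0) \<in> I" using e unfolding module_map_to_quotient_def by blast
    from I.subspace_neg[OF I this] show ?case by (simp add: vextend_def)
  next
    case (unit a k x)
    have u: "unit_vec k \<in> free_mod r" using unit(1) by (rule unit_vec_in_free_mod)
    then have au: "vscale a (unit_vec k) \<in> free_mod r" by (rule vs.subspace_scale[OF subspace_free_mod])
    have "e (vscale a (unit_vec k) + x) - (e (vscale a (unit_vec k)) + e x) \<in> I"
      "e (vscale a (unit_vec k)) - a * e (unit_vec k) \<in> I"
      using e u au unit(2) unfolding module_map_to_quotient_def by blast+
    moreover have "a * (e (unit_vec k) - f k) \<in> I" using f[OF unit(1)] by (rule I.subspace_scale[OF I])
    ultimately have "(e (vscale a (unit_vec k) + x) - (e (vscale a (unit_vec k)) + e x)) +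
        (e (vscale a (unit_vec k)) - a * e (unit_vec k)) + a * (e (unit_vec k) - f k) +
        (e x - lookup (?E x) 0) \<in> I"
      using unit(3) by (intro I.subspace_add[OF I])
    moreover have "lookup (?E (vscale a (unit_vec k) + x)) 0 = a * f k + lookup (?E x) 0"
      using unit(1) by (simp add: lin_add[OF lin_vextend] lin_scale[OF lin_vextend] lookup_add)
    ultimately show ?case by (simp add: algebra_simps)
  }
qed

lemma aug_0_iff:
  assumes "0 \<in> I" and "x \<in> free_mod 1" shows "x \<in> aug I 0 \<longleftrightarrow> lookup x 0 \<in> I"
proof -
  have "lookup x l \<in> I" if "lookup x 0 \<in> I" for l
    using lookup_free_mod[OF assms(2), of l] that assms(1) by (cases l) auto
  then show ?thesis by (auto simp: aug_def)
qed

lemma aug_res_of_graded_free_resolution: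
  fixes I :: "('x, 'k::comm_ring_1) mpoly set"
  assumes R: "graded_free_resolution I r \<delta> d e" and I: "graded_ideal I"
  obtains D where "aug_res I (case_nat 1 r) (case_nat (\<lambda>_. 0) \<delta>) D"
    and "\<And>i v. v \<in> free_mod (r (Suc i)) \<Longrightarrow> D (Suc i) v = d i v"
proof -
  interpret R: module "(*) :: ('x, 'k) mpoly \<Rightarrow> _ \<Rightarrow> _" by (rule module_times)
  let ?r = "case_nat 1 r" and ?\<delta> = "case_nat (\<lambda>_. 0) \<delta>"
  have subI: "R.subspace I" using I by (simp add: graded_ideal_def)
  have res: "resolution I (\<lambda>i. free_mod (r i)) d e"
    and hom: "\<And>i k l. k < r (Suc i) \<Longrightarrow> l < r i \<Longrightarrow> homogeneous (\<delta> (Suc i) k - \<delta> i l) (lookup (d i (unit_vec k)) l)"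
    using R unfolding graded_free_resolution_def by auto
  have "\<forall>k. \<exists>f. k < r 0 \<longrightarrow> homogeneous (\<delta> 0 k) f \<and> e (unit_vec k) - f \<in> I"
    using R unfolding graded_free_resolution_def by blast
  then obtain f where f: "\<And>k. k < r 0 \<Longrightarrow> homogeneous (\<delta> 0 k) (f k)" "\<And>k. k < r 0 \<Longrightarrow> e (unit_vec k) - f k \<in> I"
    by metis
  have d: "module_map_on (free_mod (r (Suc i))) (free_mod (r i)) (d i)" for i
    using res unfolding resolution_def by auto
  have ker: "{x \<in> free_mod (r (Suc i)). d i x = 0} = d (Suc i) ` free_mod (r (Suc (Suc i)))" for i
    using res unfolding resolution_def by auto
  have ker0: "{x \<in> free_mod (r 0). e x \<in> I} = d 0 ` free_mod (r 1)" using res unfolding resolution_def by auto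
  have e: "module_map_to_quotient I (free_mod (r 0)) e" and surj: "\<exists>x\<in>free_mod (r 0). e x - f \<in> I" for f
    using res unfolding resolution_def by auto
  define D where "D i = (case i of 0 \<Rightarrow> vextend (\<lambda>k. if k < r 0 then single 0 (f k) else 0)
     | Suc j \<Rightarrow> vextend (\<lambda>k. if k < r (Suc j) then d j (unit_vec k) else 0))" for i
  have Dd: "D (Suc i) v = d i v" if "v \<in> free_mod (r (Suc i))" for i v
    using module_map_on_eq_vextend[OF d that] by (simp add: D_def)
  have eD: "e v - lookup (D 0 v) 0 \<in> I" if "v \<in> free_mod (r 0)" for v
    using module_map_to_quotient_eq_vextend[OF subI e f(2) that] by (simp add: D_def)
  have D0: "D 0 v \<in> free_mod 1" for v
    unfolding D_def by (auto intro!: vextend_mem subspace_free_mod simp: vs.subspace_0[OF subspace_free_mod])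
      (simp add: free_mod_def)
  note aug0 = aug_0_iff[OF R.subspace_0[OF subI]]
  have eI: "e v \<in> I \<longleftrightarrow> D 0 v \<in> aug I 0" if "v \<in> free_mod (r 0)" for v
    unfolding aug0[OF D0] using R.subspace_diff[OF subI _ eD[OF that], of "e v"]
      R.subspace_add[OF subI eD[OF that], of "lookup (D 0 v) 0"] by auto
  have "aug_res I ?r ?\<delta> D"
    unfolding aug_res_def
  proof (intro conjI allI impI ballI)
    show "lin (D i)" for i by (simp add: D_def lin_vextend split: nat.split)
    fix i k assume k: "k < ?r (Suc i)"
    then have u: "unit_vec k \<in> free_mod (r i)" by (simp add: unit_vec_in_free_mod)
    show Df: "D i (unit_vec k) \<in> free_mod (?r i)"
    proof (cases i)
      case 0
      then show ?thesis using D0 by simp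
    next
      case (Suc j)
      then show ?thesis using Dd[of "unit_vec k" j] u d[of j] unfolding module_map_on_def by auto
    qed
    show "hvec (?\<delta> i) (?\<delta> (Suc i) k) (D i (unit_vec k))"
      unfolding hvec_def
    proof
      fix l
      show "homogeneous (?\<delta> (Suc i) k - ?\<delta> i l) (lookup (D i (unit_vec k)) l)"
      proof (cases "l < ?r i")
        case True
        show ?thesis
        proof (cases i)
          case 0
          then show ?thesis using f(1)[of k] k True by (simp add: D_def)
        next
          case (Suc j)
          then have "D i (unit_vec k) = d j (unit_vec k)" using Dd u by simp
          then show ?thesis using hom[of k j l] k True Suc by simp
        qed
      next
        case False
        then show ?thesis using lookup_free_mod[OF Df, of l] by simp
      qed
    qed
  next
    fix i and v :: "nat \<Rightarrow>\<^sub>0 ('x, 'k) mpoly" assume v: "v \<in> free_mod (?r i)"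
    consider "i = 0" | "i = 1" | j where "i = Suc (Suc j)" by (metis One_nat_def not0_implies_Suc)
    then show "cyc I D i v \<longleftrightarrow> (\<exists>w\<in>free_mod (?r (Suc i)). D i w - v \<in> aug I i)"
    proof cases
      case 1
      obtain x where x: "x \<in> free_mod (r 0)" "e x - lookup v 0 \<in> I" using surj by blast
      have "(e x - lookup v 0) - (e x - lookup (D 0 x) 0) \<in> I" by (rule R.subspace_diff[OF subI x(2) eD[OF x(1)]])
      then have "lookup (D 0 x - v) 0 \<in> I" by (simp add: lookup_minus)
      moreover have "D 0 x - v \<in> free_mod 1" using D0 v 1 by (auto intro: vs.subspace_diff subspace_free_mod)
      ultimately show ?thesis using aug0 x(1) 1 by auto
    next
      case 2
      then have "cyc I D i v \<longleftrightarrow> v \<in> d 0 ` free_mod (r 1)" using v eI[of v] ker0 by auto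
      then show ?thesis using Dd[of _ 0] 2 by (auto simp: image_iff)
    next
      case (3 j)
      then have "cyc I D i v \<longleftrightarrow> v \<in> d (Suc j) ` free_mod (r (Suc (Suc j)))" using v Dd[of v j] ker[of j] by auto
      then show ?thesis using Dd[of _ "Suc j"] 3 by (auto simp: image_iff)
    qed
  qed simp_all
  then show ?thesis using that Dd by blast
qed

text \<open>This serves twice: it shows that the choice in \<open>betti\<close> is not void, and it
  supplies the resolution behind the upper bound for \<open>pdim_quotient\<close>.\<close>

lemma graded_free_resolution_of_aug_res:
  fixes I :: "('x, 'k::comm_ring_1) mpoly set"
  assumes F: "aug_res I r \<delta> D" and I: "graded_ideal I"
  shows "graded_free_resolution I (\<lambda>i. r (Suc i)) (\<lambda>i. \<delta> (Suc i)) (\<lambda>i. D (Suc i)) (\<lambda>v. lookup (D 0 v) 0)"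
proof -
  interpret R: module "(*) :: ('x, 'k) mpoly \<Rightarrow> _ \<Rightarrow> _" by (rule module_times)
  have I0: "0 \<in> I" using I R.subspace_0 by (auto simp: graded_ideal_def)
  note lD = aug_res_lin[OF F]
  note aug0 = aug_0_iff[OF I0]
  have D0: "D 0 v \<in> free_mod 1" if "v \<in> free_mod (r 1)" for v
    using aug_res_free_mod[OF F, of v 0] that aug_res_0[OF F] by simp
  have surj: "\<exists>x\<in>free_mod (r (Suc 0)). lookup (D 0 x) 0 - f \<in> I" for f
  proof -
    let ?v = "vscale f (unit_vec 0)"
    have "?v \<in> free_mod (r 0)"
      using aug_res_0[OF F] by (intro vs.subspace_scale subspace_free_mod unit_vec_in_free_mod) simp
    then obtain w where w: "w \<in> free_mod (r 1)" "D 0 w - ?v \<in> aug I 0" using aug_res_exact[OF F, of ?v 0] by auto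
    then have "lookup (D 0 w - ?v) 0 \<in> I" by (simp add: aug_def)
    then show ?thesis using w(1) by (auto simp: lookup_minus lookup_unit_vec)
  qed
  have img: "x \<in> D (Suc i) ` free_mod (r (Suc (Suc i))) \<longleftrightarrow> x \<in> free_mod (r (Suc i)) \<and> D i x \<in> aug I i" for i x
    using aug_res_exact[OF F, of x "Suc i"] aug_res_free_mod[OF F, of _ "Suc i"] by (auto simp: image_iff)
  have ker: "{x \<in> free_mod (r (Suc (Suc i))). D (Suc i) x = 0} = D (Suc (Suc i)) ` free_mod (r (Suc (Suc (Suc i))))" for i
    using img[of _ "Suc i"] by auto
  have ker0: "{x \<in> free_mod (r (Suc 0)). lookup (D 0 x) 0 \<in> I} = D (Suc 0) ` free_mod (r (Suc 1))"
    using img[of _ 0] aug0[OF D0] by auto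
  have "homogeneous (\<delta> (Suc (Suc i)) k - \<delta> (Suc i) l) (lookup (D (Suc i) (unit_vec k)) l)"
    if "k < r (Suc (Suc i))" for i k l
    using aug_res_hvec[OF F that] by (simp add: hvec_def)
  moreover have "\<exists>f. homogeneous (\<delta> (Suc 0) k) f \<and> lookup (D 0 (unit_vec k)) 0 - f \<in> I" if "k < r (Suc 0)" for k
    using aug_res_hvec[OF F that] aug_res_0[OF F] I0
    by (intro exI[of _ "lookup (D 0 (unit_vec k)) 0"]) (auto simp: hvec_def dest: spec[of _ 0])
  ultimately show ?thesis
    unfolding graded_free_resolution_def resolution_def
    using surj ker ker0 aug_res_free_mod[OF F]
    by (auto simp: subspace_free_mod module_map_on_def module_map_to_quotient_def lin_add[OF lD] lin_scale[OF lD]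
        lookup_add I0)
qed

section \<open>Betti numbers\<close>

interpretation vsf: vector_space "vscale :: 'k::field \<Rightarrow> _" by (rule vector_space_vscale)

text \<open>A basis of \<open>A\<close> and one vector of \<open>B\<close> outside \<open>A\<close>
  extend to a basis of \<open>B\<close>. The finite spanning set excludes infinite bases, whose
  \<open>card\<close> would be 0.\<close>

lemma dim_less:
  fixes A B W :: "(nat \<Rightarrow>\<^sub>0 'k::field) set"
  assumes A: "vs.subspace A" and AB: "A \<subset> B" and W: "finite W" "B \<subseteq> vs.span W"
  shows "vsf.dim A < vsf.dim B"
proof -
  have fin: "finite S" if "S \<subseteq> B" "vs.independent S" for S
    using vsf.independent_span_bound[OF W(1) that(2)] that(1) W(2) by blast
  obtain S where S: "S \<subseteq> A" "vs.independent S" "A \<subseteq> vs.span S" "card S = vsf.dim A"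
    by (rule vsf.basis_exists)
  obtain x where x: "x \<in> B" "x \<notin> A" using AB by blast
  have xS: "x \<notin> vs.span S" using vs.span_minimal[OF S(1) A] x by blast
  have "vs.independent (insert x S)" using vsf.independent_insertI[OF xS S(2)] .
  then obtain T where T: "insert x S \<subseteq> T" "T \<subseteq> B" "vs.independent T" "B \<subseteq> vs.span T"
    using vsf.maximal_independent_subset_extend[of "insert x S" B] x S(1) AB by blast
  have "x \<notin> S" using x S(1) by blast
  then have "card S < card (insert x S)" using fin[of S] S AB by simp
  also have "\<dots> \<le> card T" using T fin by (intro card_mono) auto
  also have "\<dots> = vsf.dim B" using vsf.basis_card_eq_dim[OF T(2,4,3)] .
  finally show ?thesis using S(4) by simp
qed

lemma tensor_diff_eq_vextend: "tensor_diff d i v = vextend (\<lambda>k. vconst (d i (unit_vec k))) v"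
  by (simp add: tensor_diff_def vextend_def vconst_def)

lemma subspace_tensor_part: "vs.subspace (tensor_part r \<delta> i j)"
  unfolding vs.subspace_def tensor_part_def
  by (auto simp: in_keys_iff lookup_add subset_iff) (metis add.right_neutral)+

context
  fixes I :: "('x, 'k::field) mpoly set" and r \<delta> d e
  assumes R: "graded_free_resolution I r \<delta> d e" and I: "graded_ideal I"
begin

lemma tensor_diff_vconst:
  assumes "\<And>v. v \<in> free_mod (r (Suc i)) \<Longrightarrow> D v = d i v" and "lin D" and "w \<in> free_mod (r (Suc i))"
  shows "tensor_diff d i (vconst w) = vconst (D w)"
  unfolding tensor_diff_eq_vextend vconst_lin[OF assms(2), of w] vextend_def
proof (rule sum.cong[OF refl])
  fix k assume "k \<in> keys (vconst w)"
  then have "k < r (Suc i)" using lookup_free_mod[OF assms(3), of k] by (force simp: in_keys_iff)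
  then show "vscale (lookup (vconst w) k) (vconst (d i (unit_vec k))) = vscale (lookup (vconst w) k) (vconst (D (unit_vec k)))"
    using assms(1)[OF unit_vec_in_free_mod] by simp
qed

lemma vconst_tensor_part:
  assumes "w \<in> free_mod (r i)" "hvec (\<delta> i) j w" shows "vconst w \<in> tensor_part r \<delta> i j"
proof -
  have "k < r i \<and> \<delta> i k = j" if "lookup (vconst w) k \<noteq> 0" for k
    using that hvec_vconst[OF assms(2), of k] lookup_free_mod[OF assms(1), of k] by (cases "k < r i") auto
  then show ?thesis unfolding tensor_part_def in_keys_iff subset_iff by blast
qed

lemma vlift_tensor_part:
  assumes "z \<in> tensor_part r \<delta> i j" shows "vlift z \<in> free_mod (r i)" "hvec (\<delta> i) j (vlift z)"
  using assms by (auto simp: tensor_part_def free_mod_def intro: hvec_vlift)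

text \<open>Vectors over the field are lifted to constants, mapped in the resolution and reduced
  again. This inclusion gives the natural subtraction in \<open>betti\<close> its meaning.\<close>

lemma tensor_boundaries_subset: "tensor_boundaries r \<delta> d i j \<subseteq> tensor_cycles r \<delta> d i j"
proof
  obtain D where F: "aug_res I (case_nat 1 r) (case_nat (\<lambda>_. 0) \<delta>) D"
    and Dd: "\<And>i v. v \<in> free_mod (r (Suc i)) \<Longrightarrow> D (Suc i) v = d i v"
    by (rule aug_res_of_graded_free_resolution[OF R I]) (rule that)
  have td: "tensor_diff d i (vconst w) = vconst (D (Suc i) w)" if "w \<in> free_mod (r (Suc i))" for i w
    using tensor_diff_vconst[OF Dd aug_res_lin[OF F] that] .
  fix y assume "y \<in> tensor_boundaries r \<delta> d i j"
  then obtain z where z: "z \<in> tensor_part r \<delta> (Suc i) j" "y = tensor_diff d i z" by (auto simp: tensor_boundaries_def)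
  let ?w = "D (Suc i) (vlift z)"
  have y: "y = vconst ?w" using td[OF vlift_tensor_part(1)[OF z(1)]] z(2) by simp
  have w: "?w \<in> free_mod (r i)" "hvec (\<delta> i) j ?w"
    using aug_res_free_mod[OF F, of "vlift z" "Suc i"] aug_res_hvecD[OF F, of "vlift z" "Suc i" j] vlift_tensor_part[OF z(1)]
    by auto
  show "y \<in> tensor_cycles r \<delta> d i j"
  proof (cases i)
    case 0
    then show ?thesis using vconst_tensor_part[OF w] y by (simp add: tensor_cycles_def)
  next
    case (Suc i')
    have "tensor_diff d i' y = vconst (D (Suc i') ?w)" using td[of ?w i'] w(1) y Suc by simp
    moreover have "D (Suc i') ?w = 0"
      using aug_res_cyc[OF F I, of "vlift z" "Suc i"] vlift_tensor_part(1)[OF z(1)] Suc by simp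
    ultimately show ?thesis using vconst_tensor_part[OF w] y Suc by (simp add: tensor_cycles_def)
  qed
qed

text \<open>Generator degrees of one resolution control Betti numbers computed from another:
  \<open>aug_res_boundary\<close> makes the constant lift of a cycle a boundary modulo the
  variables.\<close>

lemma tensor_cycles_eq_boundaries:
  assumes G: "aug_res I rG \<delta>G DG" and no: "\<And>k. k < rG (Suc i) \<Longrightarrow> \<delta>G (Suc i) k \<noteq> j"
  shows "tensor_cycles r \<delta> d i j = tensor_boundaries r \<delta> d i j"
proof (rule subset_antisym[OF subsetI tensor_boundaries_subset])
  obtain D where F: "aug_res I (case_nat 1 r) (case_nat (\<lambda>_. 0) \<delta>) D"
    and Dd: "\<And>i v. v \<in> free_mod (r (Suc i)) \<Longrightarrow> D (Suc i) v = d i v"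
    by (rule aug_res_of_graded_free_resolution[OF R I]) (rule that)
  have td: "tensor_diff d i (vconst w) = vconst (D (Suc i) w)" if "w \<in> free_mod (r (Suc i))" for i w
    using tensor_diff_vconst[OF Dd aug_res_lin[OF F] that] .
  fix z assume "z \<in> tensor_cycles r \<delta> d i j"
  then have z: "z \<in> tensor_part r \<delta> i j" and dz: "\<And>i'. i = Suc i' \<Longrightarrow> tensor_diff d i' z = 0"
    by (auto simp: tensor_cycles_def split: nat.splits)
  have "i = 0 \<or> vconst (D i (vlift z)) = 0"
    using td[of "vlift z" "i - 1"] vlift_tensor_part(1)[OF z] dz by (cases i) auto
  then obtain w where w: "w \<in> free_mod (r (Suc i))" "vconst (D (Suc i) w) = vconst (vlift z)"
    using aug_res_boundary[OF F G I no, of "vlift z"] vlift_tensor_part[OF z] by auto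
  \<comment> \<open>Nothing is known about the degree of \<open>w\<close>. Its component of degree
    \<open>j\<close> still reduces to \<open>z\<close>, which has coordinates only at basis vectors
    of degree \<open>j\<close>.\<close>
  let ?w = "vpart (\<delta> (Suc i)) j w"
  have w': "?w \<in> free_mod (r (Suc i))" using w(1) by (rule vpart_free_mod)
  have "D (Suc i) ?w = vpart (\<delta> i) j (D (Suc i) w)"
    using aug_res_vpart[OF F, of w "Suc i" j] w(1) by simp
  moreover have "vconst (vpart (\<delta> i) j (D (Suc i) w)) = z"
  proof (rule poly_mapping_eqI)
    fix l
    have "lookup (lookup (D (Suc i) w) l) 0 = lookup z l"
      using arg_cong[OF w(2), of "\<lambda>x. lookup x l"] by simp
    moreover have "lookup z l = 0" if "\<delta> i l \<noteq> j"
      using z that by (auto simp: tensor_part_def in_keys_iff)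
    ultimately show "lookup (vconst (vpart (\<delta> i) j (D (Suc i) w))) l = lookup z l"
      by (auto simp: lookup_vpart lookup_hpart when_def mono_deg_def)
  qed
  ultimately have "tensor_diff d i (vconst ?w) = z" using td[OF w'] by simp
  moreover have "vconst ?w \<in> tensor_part r \<delta> (Suc i) j" using vconst_tensor_part[OF w' hvec_vpart] .
  ultimately show "z \<in> tensor_boundaries r \<delta> d i j" by (auto simp: tensor_boundaries_def)
qed

text \<open>
  The cycle expresses \<open>u\<close> through generators of \<open>I\<close>. Were it a boundary, \<open>u\<close> would be a combination
  of elements of \<open>I\<close> of smaller degree.
\<close>

lemma tensor_cycles_1_neq_boundaries:
  assumes u: "u \<in> I" "homogeneous (int n) u" "u \<noteq> 0" and n: "1 \<le> n"
    and low: "\<And>f m. f \<in> I \<Longrightarrow> homogeneous m f \<Longrightarrow> m < int n \<Longrightarrow> f = 0"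
  shows "tensor_cycles r \<delta> d 1 (int n) \<noteq> tensor_boundaries r \<delta> d 1 (int n)"
proof
  assume eq: "tensor_cycles r \<delta> d 1 (int n) = tensor_boundaries r \<delta> d 1 (int n)"
  interpret R: module "(*) :: ('x, 'k) mpoly \<Rightarrow> _ \<Rightarrow> _" by (rule module_times)
  have subI: "R.subspace I" using I by (simp add: graded_ideal_def)
  define rF where "rF = case_nat 1 r"
  define \<delta>F where "\<delta>F = case_nat (\<lambda>_. 0) \<delta>"
  have rF: "rF (Suc i) = r i" and \<delta>F: "\<delta>F (Suc i) = \<delta> i" for i by (simp_all add: rF_def \<delta>F_def)
  obtain D where F: "aug_res I rF \<delta>F D"
    and Dd: "\<And>i v. v \<in> free_mod (r (Suc i)) \<Longrightarrow> D (Suc i) v = d i v"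
    unfolding rF_def \<delta>F_def
    by (rule aug_res_of_graded_free_resolution[OF R I]) (rule that[unfolded rF_def \<delta>F_def])
  have td: "tensor_diff d i (vconst w) = vconst (D (Suc i) w)" if "w \<in> free_mod (r (Suc i))" for i w
    using tensor_diff_vconst[OF Dd aug_res_lin[OF F] that] .
  note lD = aug_res_lin[OF F]
  have e0: "(unit_vec 0 :: nat \<Rightarrow>\<^sub>0 ('x, 'k) mpoly) \<in> free_mod (rF 0)"
    "hvec (\<delta>F 0) 0 (unit_vec 0 :: nat \<Rightarrow>\<^sub>0 ('x, 'k) mpoly)"
    using aug_res_0[OF F] by (auto simp: hvec_def lookup_unit_vec homogeneous_1 intro: unit_vec_in_free_mod)
  then obtain g0 where g0: "g0 \<in> free_mod (rF (Suc 0))" "D 0 g0 - unit_vec 0 \<in> aug I 0"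
    using aug_res_exact[OF F, of "unit_vec 0" 0] by auto
  define g where "g = vpart (\<delta>F (Suc 0)) 0 g0"
  have g: "g \<in> free_mod (rF (Suc 0))" "hvec (\<delta>F (Suc 0)) 0 g"
    using vpart_free_mod[OF g0(1)] hvec_vpart by (auto simp: g_def)
  have "D 0 g - unit_vec 0 = vpart (\<delta>F 0) 0 (D 0 g0 - unit_vec 0)"
    using aug_res_vpart[OF F g0(1)] e0(2) by (simp add: g_def vpart_diff hvec_iff)
  then have "lookup (D 0 g - unit_vec 0) 0 \<in> I" "homogeneous (0 - \<delta>F 0 0) (lookup (D 0 g - unit_vec 0) 0)"
    using vpart_aug[OF I g0(2), of "\<delta>F 0" 0] hvec_vpart[of "\<delta>F 0" 0 "D 0 g0 - unit_vec 0"]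
    by (auto simp: aug_def hvec_def)
  \<comment> \<open>The error in \<open>D 0 g = 1\<close> lies in \<open>I\<close> and has degree 0,
    below \<open>n\<close>, so it vanishes.\<close>
  from low[OF this] have Dg: "lookup (D 0 g) 0 = 1"
    using n aug_res_0[OF F] by (simp add: lookup_minus lookup_unit_vec)
  \<comment> \<open>\<open>u * g\<close> maps to \<open>u\<close> and is therefore a cycle. As
    \<open>u\<close> has no constant term, every \<open>w\<close> over \<open>u * g\<close> becomes
    a cycle modulo the variables.\<close>
  have ug: "vscale u g \<in> free_mod (rF (Suc 0))" using g(1) by (rule vs.subspace_scale[OF subspace_free_mod])
  have hug: "hvec (\<delta>F (Suc 0)) (int n) (vscale u g)"
    unfolding hvec_def
  proof
    fix l
    have "homogeneous (0 - \<delta>F (Suc 0) l) (lookup g l)" using g(2) by (simp add: hvec_def)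
    from homogeneous_mult[OF u(2) this] show "homogeneous (int n - \<delta>F (Suc 0) l) (lookup (vscale u g) l)" by simp
  qed
  have "D 0 (vscale u g) \<in> aug I 0"
    using R.subspace_scale[OF subI u(1)] by (simp add: aug_def lin_scale[OF lD] mult.commute[of u])
  then obtain w0 where w0: "w0 \<in> free_mod (rF (Suc (Suc 0)))" "D (Suc 0) w0 = vscale u g"
    using aug_res_exact[OF F ug] by auto
  define w where "w = vpart (\<delta>F (Suc (Suc 0))) (int n) w0"
  have w: "w \<in> free_mod (rF (Suc (Suc 0)))" "hvec (\<delta>F (Suc (Suc 0))) (int n) w"
    using vpart_free_mod[OF w0(1)] hvec_vpart by (auto simp: w_def)
  have Dw: "D (Suc 0) w = vscale u g"
    using aug_res_vpart[OF F w0(1), of "int n"] hug w0(2) by (simp add: w_def hvec_iff)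
  have "lookup u 0 = 0" using homogeneous_lookup_0[OF u(2)] n by simp
  then have "vconst (D (Suc 0) w) = 0" by (intro poly_mapping_eqI) (simp add: Dw lookup_mult_0)
  then have "tensor_diff d 0 (vconst w) = 0" using td[of w 0] w(1) by (simp add: rF)
  then have "vconst w \<in> tensor_cycles r \<delta> d 1 (int n)"
    using vconst_tensor_part[of w "Suc 0" "int n"] w by (simp add: tensor_cycles_def rF \<delta>F)
  then obtain y where y: "y \<in> tensor_part r \<delta> (Suc 1) (int n)" "vconst w = tensor_diff d 1 y"
    unfolding eq tensor_boundaries_def by blast
  let ?v = "D (Suc (Suc 0)) (vlift y)"
  \<comment> \<open>Subtracting the supposed boundary removes the constant terms of all coefficients
    without changing the image \<open>u * g\<close>.\<close>
  define w' where "w' = w - ?v"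
  have yf: "vlift y \<in> free_mod (rF (Suc (Suc (Suc 0))))" "hvec (\<delta>F (Suc (Suc (Suc 0)))) (int n) (vlift y)"
    using vlift_tensor_part[OF y(1)] by (simp_all add: rF \<delta>F)
  have w': "w' \<in> free_mod (rF (Suc (Suc 0)))"
    using w(1) aug_res_free_mod[OF F yf(1)] by (auto simp: w'_def intro: vs.subspace_diff subspace_free_mod)
  have hw': "hvec (\<delta>F (Suc (Suc 0))) (int n) w'"
    using w(2) aug_res_hvecD[OF F yf] by (simp add: w'_def hvec_iff vpart_diff)
  have "vconst ?v = tensor_diff d 1 y" using td[OF vlift_tensor_part(1)[OF y(1)]] by simp
  then have cw': "vconst w' = 0" using y(2) by (simp add: w'_def vconst_minus)
  have "D (Suc 0) ?v = 0" using aug_res_cyc[OF F I yf(1)] by simp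
  then have Dw': "D (Suc 0) w' = vscale u g" by (simp add: w'_def lin_diff[OF lD] Dw)
  have "lookup (D 0 (D (Suc 0) w')) 0 =
      (\<Sum>k\<in>keys w'. lookup w' k * lookup (D 0 (D (Suc 0) (unit_vec k))) 0)"
    by (subst lin_eq_vextend[OF lin_compose[OF lD lD]]) (rule lookup_vextend)
  also have "\<dots> = 0"
  proof (rule sum.neutral, rule ballI)
    fix k assume k: "k \<in> keys w'"
    then have kr: "k < rF (Suc (Suc 0))" using free_modD[OF w'] by auto
    let ?u = "D (Suc 0) (unit_vec k)"
    have h: "homogeneous (int n - \<delta>F (Suc (Suc 0)) k) (lookup w' k)" using hw' by (simp add: hvec_def)
    \<comment> \<open>A nonzero coefficient without constant term has positive degree, so the
      generator \<open>k\<close> has degree below \<open>n\<close>, where \<open>I\<close> has no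
      nonzero elements.\<close>
    have "\<not> int n - \<delta>F (Suc (Suc 0)) k \<le> 0"
    proof
      assume le: "int n - \<delta>F (Suc (Suc 0)) k \<le> 0"
      have "lookup (lookup w' k) 0 = 0" using arg_cong[OF cw', of "\<lambda>x. lookup x k"] by simp
      then have "lookup w' k = 0"
        using homogeneous_nonpos[OF h le] by blast
      then show False using k by (simp add: in_keys_iff)
    qed
    moreover have "?u \<in> free_mod (rF (Suc 0))" "hvec (\<delta>F (Suc 0)) (\<delta>F (Suc (Suc 0)) k) ?u"
      using aug_res_unit[OF F kr] aug_res_hvec[OF F kr] .
    then have "hvec (\<delta>F 0) (\<delta>F (Suc (Suc 0)) k) (D 0 ?u)" by (rule aug_res_hvecD[OF F])
    then have "homogeneous (\<delta>F (Suc (Suc 0)) k - \<delta>F 0 0) (lookup (D 0 ?u) 0)" by (simp add: hvec_def)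
    then have "homogeneous (\<delta>F (Suc (Suc 0)) k) (lookup (D 0 ?u) 0)" using aug_res_0[OF F] by simp
    moreover have "lookup (D 0 ?u) 0 \<in> I"
      using aug_res_cyc[OF F I unit_vec_in_free_mod[OF kr]] by (simp add: aug_def)
    ultimately have "lookup (D 0 ?u) 0 = 0" by (intro low) auto
    then show "lookup w' k * lookup (D 0 ?u) 0 = 0" by simp
  qed
  finally have "u * lookup (D 0 g) 0 = 0" by (simp add: Dw' lin_scale[OF lD])
  then show False using Dg u(3) by simp
qed

end

text \<open>The resolution behind \<open>betti\<close> is an arbitrary choice, of which only the
  defining property is known; the existence of one resolution makes that property available.\<close>

lemma betti_obtain:
  fixes I :: "('x, 'k::field) mpoly set"
  assumes "graded_free_resolution I r0 \<delta>0 d0 e0"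
  obtains r \<delta> d e where "graded_free_resolution I r \<delta> d e"
    and "\<And>i j. betti I i j = vsf.dim (tensor_cycles r \<delta> d i j) - vsf.dim (tensor_boundaries r \<delta> d i j)"
proof -
  obtain r \<delta> d e where p: "(SOME (r, \<delta>, d, e). graded_free_resolution I r \<delta> d e) = (r, \<delta>, d, e)"
    by (metis prod_cases4)
  have "case (r, \<delta>, d, e) of (r, \<delta>, d, e) \<Rightarrow> graded_free_resolution I r \<delta> d e"
    unfolding p[symmetric] by (rule someI_ex) (use assms in auto)
  then show ?thesis using that[of r \<delta> d e] by (simp add: betti_def p)
qed

section \<open>The ideal of order-preserving maps\<close>

definition map_graph :: "('p \<Rightarrow> 'q) \<Rightarrow> ('p \<times> 'q) set" where
  "map_graph \<phi> = range (\<lambda>p. (p, \<phi> p))"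

lemma card_map_graph: "card (map_graph (\<phi> :: 'p::finite \<Rightarrow> 'q)) = CARD('p)"
  unfolding map_graph_def by (rule card_image) (auto intro: injI)

lemma prod_single: "(\<Prod>a\<in>A. single (s a) (1 :: 'k::comm_ring_1)) = single (\<Sum>a\<in>A. s a) 1"
  by (induction A rule: infinite_finite_induct) (auto simp: mult_single)

lemma hom_monomial_eq: "hom_monomial \<phi> = single (sqfree_mono (map_graph \<phi>)) 1"
proof -
  have "(\<Sum>v\<in>map_graph \<phi>. single v (1::nat)) = (\<Sum>p\<in>UNIV. single (p, \<phi> p) 1)"
    unfolding map_graph_def by (rule sum.reindex_cong[of "\<lambda>p. (p, \<phi> p)"]) (auto intro: injI)
  then show ?thesis by (simp add: hom_monomial_def var_def prod_single sqfree_mono_def)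
qed

text \<open>Polynomials are treated term by term: an exponent whose support contains the graph of
  \<open>\<phi>\<close> dominates its squarefree monomial, and the difference is the
  cofactor.\<close>

lemma hom_ideal_eq:
  "(hom_ideal :: ('p::{finite,order} \<times> 'q::{finite,order}, 'k::comm_ring_1) mpoly set) =
    sqfree_ideal (map_graph ` {\<phi>. mono \<phi>})" (is "_ = ?J")
proof
  interpret R: module "(*) :: ('p \<times> 'q, 'k) mpoly \<Rightarrow> _ \<Rightarrow> _" by (rule module_times)
  have J: "R.subspace ?J" using graded_ideal_sqfree unfolding graded_ideal_def by blast
  show "hom_ideal \<subseteq> ?J"
    unfolding hom_ideal_def
    by (rule R.span_minimal[OF _ J])
      (auto simp: sqfree_ideal_def hom_monomial_eq keys_sqfree_mono)
  show "?J \<subseteq> hom_ideal"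
  proof
    fix f assume f: "f \<in> ?J"
    have "single t (lookup f t) \<in> hom_ideal" if t: "t \<in> keys f" for t
    proof -
      obtain \<phi> :: "'p \<Rightarrow> 'q" where \<phi>: "mono \<phi>" "map_graph \<phi> \<subseteq> keys t" using f t by (auto simp: sqfree_ideal_def)
      let ?m = "sqfree_mono (map_graph \<phi>)"
      have "t = (t - ?m) + ?m"
        using \<phi>(2) by (intro poly_mapping_eqI)
          (auto simp: lookup_add lookup_minus lookup_sqfree_mono in_keys_iff subset_iff Suc_le_eq)
      then have eq: "single t (lookup f t) = single (t - ?m) (lookup f t) * hom_monomial \<phi>"
        by (simp add: hom_monomial_eq mult_single)
      have "(hom_monomial \<phi> :: ('p \<times> 'q, 'k) mpoly) \<in> {hom_monomial \<phi> | \<phi>. mono \<phi>}" using \<phi>(1) by blast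
      then show ?thesis unfolding eq hom_ideal_def by (intro R.span_scale R.span_base)
    qed
    then have "(\<Sum>t\<in>keys f. single t (lookup f t)) \<in> hom_ideal"
      unfolding hom_ideal_def by (intro R.span_sum) auto
    moreover have "f = (\<Sum>t\<in>keys f. single t (lookup f t))"
      by (rule poly_mapping_eqI) (auto simp: lookup_sum lookup_single when_def in_keys_iff)
    ultimately show "f \<in> hom_ideal" by simp
  qed
qed

section \<open>Bounds for the projective dimension\<close>

lemma pdim_quotient_le:
  assumes "bounded_res I n \<rho>" and I: "graded_ideal I" shows "pdim_quotient I \<le> enat n"
proof -
  obtain r \<delta> D where F: "aug_res I r \<delta> D" and r: "\<And>i. i > n \<Longrightarrow> r (Suc i) = 0"
    using assms(1) unfolding bounded_res_def by blast
  have "resolution I (\<lambda>i. free_mod (r (Suc i))) (\<lambda>i. D (Suc i)) (\<lambda>v. lookup (D 0 v) 0)"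
    using graded_free_resolution_of_aug_res[OF F I] by (simp add: graded_free_resolution_def)
  then have "n \<in> {n. \<exists>M d e. resolution I M d e \<and> (\<forall>i. projective_module (M i)) \<and> (\<forall>i>n. M i = {0})}"
    using projective_free_mod r free_mod_0
    by (intro CollectI exI[of _ "\<lambda>i. free_mod (r (Suc i))"] exI) auto
  then show ?thesis unfolding pdim_quotient_def by (rule INF_lower)
qed

lemma lookup_var_mult:
  "lookup (var v * f) t = (if v \<in> keys t then lookup (f :: ('x, 'k::comm_ring_1) mpoly) (t - single v 1) else 0)"
proof (cases "v \<in> keys t")
  case True
  then have "t = single v 1 + (t - single v 1)"
    by (intro poly_mapping_eqI) (auto simp: lookup_add lookup_minus lookup_single in_keys_iff when_def)
  then show ?thesis using True lookup_single_mult[of "single v 1" 1 f "t - single v 1"] by (simp add: var_def)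
next
  case False
  have "t \<notin> keys (var v * f)"
    unfolding var_def keys_single_mult using False by (auto simp: keys_add_nat)
  then show ?thesis using False by (simp add: in_keys_iff)
qed

text \<open>Shifting exponents by that of \<open>v\<close> loses exactly the terms not divisible by
  \<open>v\<close>, and multiplication by another variable does not interfere with the
  shift.\<close>

lemma var_division:
  "\<exists>q. (\<forall>f g. q (f - g) = q f - q g) \<and> (\<forall>f. q (var v * f) = f) \<and>
     (\<forall>w. w \<noteq> v \<longrightarrow> (\<forall>f. q (var w * f) = var w * q (f :: ('x, 'k::comm_ring_1) mpoly)))"
proof (intro exI conjI allI impI)
  define s where "s = single v (1::nat)"
  have var: "var v = single s (1 :: 'k)" by (simp add: var_def s_def)
  let ?q = "Poly_Mapping.map_key ((+) s)"
  have q: "lookup (?q f) t = lookup f (s + t)" for f :: "('x, 'k) mpoly" and t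
    by (simp add: map_key.rep_eq)
  show "?q (f - g) = ?q f - ?q g" for f g :: "('x, 'k) mpoly"
    by (rule poly_mapping_eqI) (simp add: q lookup_minus)
  show "?q (var v * f) = f" for f :: "('x, 'k) mpoly"
    by (rule poly_mapping_eqI) (simp add: q var lookup_single_mult)
  show "?q (var w * f) = var w * ?q f" if "w \<noteq> v" for w and f :: "('x, 'k) mpoly"
  proof (rule poly_mapping_eqI)
    fix t
    have "s + t - single w 1 = s + (t - single w 1)"
      using that by (intro poly_mapping_eqI) (auto simp: s_def lookup_add lookup_minus lookup_single when_def)
    moreover have "w \<in> keys (s + t) \<longleftrightarrow> w \<in> keys t" using that by (simp add: keys_add_nat s_def)
    ultimately show "lookup (?q (var w * f)) t = lookup (var w * ?q f) t" by (simp add: q lookup_var_mult)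
  qed
qed

lemma inj_var: "inj (var :: 'x \<Rightarrow> ('x, 'k::comm_ring_1) mpoly)"
proof (rule injI)
  fix v w :: 'x assume "var v = (var w :: ('x, 'k) mpoly)"
  then have "keys (var v :: ('x, 'k) mpoly) = keys (var w :: ('x, 'k) mpoly)" by simp
  then have "single v (1::nat) = single w 1" by (simp add: var_def)
  then have "keys (single v (1::nat)) = keys (single w (1::nat))" by simp
  then show "v = w" by simp
qed

text \<open>The monomial of \<open>S\<close> is a socle element with respect to the variables in
  \<open>X\<close>. The infimum runs over all projective resolutions, and
  \<open>length_le_resolution\<close> applies to each.\<close>

lemma card_le_pdim_quotient:
  fixes \<G> :: "'x set set"
  assumes "finite X" and "finite S" and "\<And>g. g \<in> \<G> \<Longrightarrow> \<not> g \<subseteq> S" and "\<And>x. x \<in> X \<Longrightarrow> \<exists>g\<in>\<G>. g \<subseteq> insert x S"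
  shows "enat (card X) \<le> pdim_quotient (sqfree_ideal \<G> :: ('x, 'k::comm_ring_1) mpoly set)"
  unfolding pdim_quotient_def
proof (rule INF_greatest)
  let ?I = "sqfree_ideal \<G> :: ('x, 'k) mpoly set" let ?u = "single (sqfree_mono S) 1 :: ('x, 'k) mpoly"
  fix n assume "n \<in> {n. \<exists>M d e. resolution ?I M d e \<and> (\<forall>i. projective_module (M i)) \<and> (\<forall>i>n. M i = {0})}"
  then obtain M d e where M: "resolution ?I M d e" "\<And>i. projective_module (M i)" "\<And>i. i > n \<Longrightarrow> M i = {0}" by blast
  obtain vs where vs: "set vs = X" "distinct vs" using finite_distinct_list[OF assms(1)] by blast
  have "length (map var vs :: ('x, 'k) mpoly list) \<le> n"
  proof (rule length_le_resolution[OF M])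
    show "module.subspace (*) ?I" using graded_ideal_sqfree by (auto simp: graded_ideal_def)
    show "distinct (map var vs :: ('x, 'k) mpoly list)"
      using vs(2) inj_var by (simp add: distinct_map inj_on_subset[OF inj_var])
    show "?u \<notin> ?I" using assms(3) by (auto simp: sqfree_ideal_def keys_sqfree_mono[OF assms(2)])
    fix x :: "('x, 'k) mpoly" assume "x \<in> set (map var vs)"
    then obtain v where v: "v \<in> X" "x = var v" using vs(1) by auto
    show "x * ?u \<in> ?I"
      using assms(4)[OF v(1)]
      by (auto simp: v(2) var_def mult_single sqfree_ideal_def keys_add_nat keys_sqfree_mono[OF assms(2)])
    obtain q :: "('x, 'k) mpoly \<Rightarrow> _" where "\<forall>f g. q (f - g) = q f - q g" "\<forall>f. q (var v * f) = f"
      "\<forall>w. w \<noteq> v \<longrightarrow> (\<forall>f. q (var w * f) = var w * q f)" using var_division[of v] by blast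
    then show "\<exists>q. (\<forall>a b. q (a - b) = q a - q b) \<and> (\<forall>a. q (x * a) = a) \<and>
       (\<forall>y\<in>set (map var vs). y \<noteq> x \<longrightarrow> (\<forall>a. q (y * a) = y * q a))"
      by (intro exI[of _ q]) (auto simp: v(2))
  qed
  moreover have "length (map var vs) = card X" using vs distinct_card by force
  ultimately show "enat (card X) \<le> enat n" by simp
qed

section \<open>Bounds for the regularity\<close>

lemma card_keys_le_mono_deg: "card (keys t) \<le> mono_deg t"
proof -
  have "(\<Sum>v\<in>keys t. 1) \<le> (\<Sum>v\<in>keys t. lookup t v)"
    by (rule sum_mono) (auto simp: in_keys_iff Suc_le_eq)
  then show ?thesis by (simp add: mono_deg_def)
qed

lemma homogeneous_sqfree_ideal_eq_0:
  assumes f: "f \<in> sqfree_ideal \<G>" "homogeneous m f" and m: "m < int n" and n: "\<And>g. g \<in> \<G> \<Longrightarrow> card g = n"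
  shows "f = 0"
proof -
  have "t \<notin> keys f" for t
  proof
    assume t: "t \<in> keys f"
    then obtain g where "g \<in> \<G>" "g \<subseteq> keys t" using f(1) by (auto simp: sqfree_ideal_def)
    then have "n \<le> mono_deg t" using n card_mono[of "keys t" g] card_keys_le_mono_deg[of t] by force
    then show False using f(2) m t by (auto simp: homogeneous_def)
  qed
  then show ?thesis by (metis keys_eq_empty all_not_in_conv)
qed

lemma betti_sqfree_neq_0:
  assumes R: "graded_free_resolution (sqfree_ideal \<G> :: ('x, 'k::field) mpoly set) r \<delta> d e"
    and g: "g \<in> \<G>" and n: "\<And>g. g \<in> \<G> \<Longrightarrow> card g = n" "1 \<le> n"
  shows "vsf.dim (tensor_cycles r \<delta> d 1 (int n)) - vsf.dim (tensor_boundaries r \<delta> d 1 (int n)) \<noteq> 0"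
proof -
  let ?Z = "tensor_cycles r \<delta> d 1 (int n)" and ?B = "tensor_boundaries r \<delta> d 1 (int n)"
  have fin: "finite g" using n g by (metis card.infinite not_one_le_zero)
  have "?Z \<noteq> ?B"
  proof (rule tensor_cycles_1_neq_boundaries[OF R graded_ideal_sqfree])
    let ?u = "single (sqfree_mono g) 1 :: ('x, 'k) mpoly"
    show "?u \<in> sqfree_ideal \<G>" using g by (auto simp: sqfree_ideal_def keys_sqfree_mono[OF fin])
    show "homogeneous (int n) ?u" using n(1)[OF g] by (simp add: homogeneous_def mono_deg_sqfree_mono[OF fin])
    show "?u \<noteq> 0" by (metis lookup_single_eq lookup_zero zero_neq_one)
    show "f = 0" if "f \<in> sqfree_ideal \<G>" "homogeneous m f" "m < int n" for f :: "('x, 'k) mpoly" and m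
      using homogeneous_sqfree_ideal_eq_0[OF that n(1)] .
  qed (rule n(2))
  moreover have "?B \<subseteq> ?Z" by (rule tensor_boundaries_subset[OF R graded_ideal_sqfree])
  ultimately have "?B \<subset> ?Z" by blast
  moreover have "vs.subspace ?B"
    unfolding tensor_boundaries_def tensor_diff_eq_vextend[abs_def]
    by (rule module_hom.subspace_image[OF lin_vextend subspace_tensor_part])
  moreover have "?Z \<subseteq> vs.span (unit_vec ` {..<r 1})"
  proof
    fix v assume "v \<in> ?Z"
    then have "keys v \<subseteq> {..<r 1}" by (auto simp: tensor_cycles_def tensor_part_def)
    then have "vextend unit_vec v \<in> vs.span (unit_vec ` {..<r 1})"
      by (intro vextend_mem vs.subspace_span vs.span_base) auto
    then show "v \<in> vs.span (unit_vec ` {..<r 1})" by (simp add: vextend_units)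
  qed
  ultimately have "vsf.dim ?B < vsf.dim ?Z" by (intro dim_less[of ?B ?Z "unit_vec ` {..<r 1}"]) auto
  then show ?thesis by simp
qed

text \<open>\<open>Max\<close> is meaningful because the set is finite, by the two-sided degree
  bounds, and nonempty, by the Betti number in homological degree 1.\<close>

lemma reg_quotient_sqfree_bounds:
  assumes B: "bounded_res (sqfree_ideal \<G> :: ('x, 'k::field) mpoly set) N \<rho>"
    and g: "g \<in> \<G>" and n: "\<And>g. g \<in> \<G> \<Longrightarrow> card g = n" "1 \<le> n"
  shows "int n - 1 \<le> reg_quotient (sqfree_ideal \<G> :: ('x, 'k) mpoly set) \<and>
    reg_quotient (sqfree_ideal \<G> :: ('x, 'k) mpoly set) \<le> \<rho>"
proof -
  let ?I = "sqfree_ideal \<G> :: ('x, 'k) mpoly set" let ?S = "{j - int i | i j. betti ?I i j \<noteq> 0}"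
  obtain rG \<delta>G DG where G: "aug_res ?I rG \<delta>G DG"
    and Gd: "\<And>i k. k < rG (Suc i) \<Longrightarrow> int i \<le> \<delta>G (Suc i) k \<and> \<delta>G (Suc i) k \<le> int i + \<rho>"
    using B unfolding bounded_res_def by blast
  obtain r \<delta> d e where R: "graded_free_resolution ?I r \<delta> d e"
    and betti: "\<And>i j. betti ?I i j = vsf.dim (tensor_cycles r \<delta> d i j) - vsf.dim (tensor_boundaries r \<delta> d i j)"
    by (rule betti_obtain[OF graded_free_resolution_of_aug_res[OF G graded_ideal_sqfree]]) (rule that)
  have sub: "?S \<subseteq> {0..\<rho>}"
  proof
    fix x assume "x \<in> ?S"
    then obtain i j where x: "x = j - int i" "betti ?I i j \<noteq> 0" by blast
    have "\<exists>k<rG (Suc i). \<delta>G (Suc i) k = j"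
    proof (rule ccontr)
      assume "\<not> ?thesis"
      then have "tensor_cycles r \<delta> d i j = tensor_boundaries r \<delta> d i j"
        by (intro tensor_cycles_eq_boundaries[OF R graded_ideal_sqfree G]) auto
      then show False using x(2) by (simp add: betti)
    qed
    then show "x \<in> {0..\<rho>}" using Gd[of _ i] x(1) by force
  qed
  then have fin: "finite ?S" by (rule finite_subset) simp
  have "betti ?I 1 (int n) \<noteq> 0"
    unfolding betti using betti_sqfree_neq_0[OF R g n] .
  then have mem: "int n - 1 \<in> ?S" by (metis (mono_tags, lifting) mem_Collect_eq of_nat_1)
  then have "Max ?S \<in> ?S" using fin by (intro Max_in) auto
  then have "Max ?S \<in> {0..\<rho>}" using sub by blast
  then show ?thesis using Max_ge[OF fin mem] unfolding reg_quotient_def by simp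
qed

theorem proposition4p1:
  fixes L :: "('p::{finite,order} \<times> 'q::{finite,order}, 'k::field) mpoly set"
  assumes "L = hom_ideal"
  shows
    "(enat CARD('q) \<le> pdim_quotient L \<and>
      pdim_quotient L \<le> enat (CARD('p) * (CARD('q) - 1) + 1)) \<and>
     (int CARD('p) - 1 \<le> reg_quotient L \<and>
      reg_quotient L \<le> int CARD('q) * (int CARD('p) - 1))"
proof -
  let ?G = "map_graph ` {\<phi> :: 'p \<Rightarrow> 'q. mono \<phi>}"
  let ?c = "\<lambda>q::'q. map_graph (\<lambda>_::'p. q)"
  let ?p = "CARD('p)" and ?q = "CARD('q)"
  have L: "L = sqfree_ideal ?G" using assms hom_ideal_eq by simp
  have pos: "1 \<le> ?p" "1 \<le> ?q" by (simp_all add: Suc_le_eq)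
  have const: "?c q \<in> ?G" for q by (auto simp: mono_def)
  have card: "card g = ?p" if "g \<in> ?G" for g using that by (auto simp: card_map_graph)
  have inj: "inj ?c" by (rule injI) (auto simp: map_graph_def)
  have cC: "card (range ?c) = ?q" by (rule card_image[OF inj])
  \<comment> \<open>Here \<open>V\<close> consists of all variables, \<open>d\<close> is the size of
    P, and the graphs of the constant maps form the disjoint family.\<close>
  have "bounded_res L (card (UNIV :: ('p \<times> 'q) set) + 1 - ?p) (int (card (UNIV :: ('p \<times> 'q) set)) - int (card (range ?c)))"
    unfolding L
  proof (rule bounded_res_sqfree)
    show "range ?c \<subseteq> ?G" using const by blast
    show "disjoint (range ?c)" by (rule disjointI) (auto simp: map_graph_def)
  qed (use pos card in auto)
  moreover have "card (UNIV :: ('p \<times> 'q) set) = ?p * ?q" by (simp add: card_prod)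
  moreover have "?p * ?q + 1 - ?p = ?p * (?q - 1) + 1"
    using pos by (simp add: diff_mult_distrib2 Suc_diff_le)
  moreover have "int (?p * ?q) - int ?q = int ?q * (int ?p - 1)" by (simp add: algebra_simps)
  ultimately have B: "bounded_res L (?p * (?q - 1) + 1) (int ?q * (int ?p - 1))" by (simp add: cC)
  obtain p :: 'p where True by blast
  have "enat (card ({p} \<times> (UNIV :: 'q set))) \<le> pdim_quotient L"
    unfolding L
  \<comment> \<open>Every graph meets the row of \<open>p\<close>, and that of a constant map meets
    it in one prescribed variable.\<close>
  proof (rule card_le_pdim_quotient[where S = "{(p', q). p' \<noteq> p}"])
    show "\<not> g \<subseteq> {(p', q). p' \<noteq> p}" if "g \<in> ?G" for g using that by (auto simp: map_graph_def)
    fix x assume "x \<in> {p} \<times> (UNIV :: 'q set)"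
    then obtain q where "x = (p, q)" by auto
    then have "?c q \<subseteq> insert x {(p', q). p' \<noteq> p}" by (auto simp: map_graph_def)
    then show "\<exists>g\<in>?G. g \<subseteq> insert x {(p', q). p' \<noteq> p}" by (rule bexI) (rule const)
  qed simp_all
  then have "enat ?q \<le> pdim_quotient L" by (simp add: card_cartesian_product)
  moreover have "pdim_quotient L \<le> enat (?p * (?q - 1) + 1)"
    using pdim_quotient_le[OF B] graded_ideal_sqfree L by blast
  moreover have "int ?p - 1 \<le> reg_quotient L \<and> reg_quotient L \<le> int ?q * (int ?p - 1)"
    unfolding L by (rule reg_quotient_sqfree_bounds[OF B[unfolded L] const card pos(1)])
  ultimately show ?thesis by blast
qed

end
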